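(* Eulerian Extension with Advice (EEA) is polynomial-time polynomial-parameter many-one reducible to Eulerian Extension (EE), where both problems are parameterized by the number of connected components of the input graph.
   Context: A directed multigraph $G=(V,A)$ has vertex set $V$ and a finite multiset $A$ of arcs $(u,v)$, $u\neq v$; $\mathrm{balance}(v)=\mathrm{indeg}(v)-\mathrm{outdeg}(v)$; connected components refer to the underlying undirected multigraph. $G$ is Eulerian if it has a closed trail traversing every arc exactly once and every vertex at least once. A multiset $E$ of arcs is an Eulerian extension of $G$ if $(V,A\cup E)$ is Eulerian. Weight functions are $\omega:V\times V\to[0,\omega_{max}]\cup\{\infty\}$, $\omega(E)=\sum_{a\in E}\omega(a)$. The component graph $\mathcal C(G)$ is the complete undirected graph with one vertex per component of $G$. For a trail $t$ in $(V,V\times V)$, $\mathrm{meta}_G(t)$ is the undirected trail in $\mathcal C(G)$ obtained by replacing each maximal subtrail lying inside one component $K$ by the vertex of $K$ and forgetting directions. A hint is a path or cycle of length $\ge1$ in $\mathcal C(G)$, designated as path hint or cycle hint; an advice is a set of pairwise edge-disjoint hints. A path $p$ in $(V,V\times V)$ realizes a path hint $h$ if $\mathrm{meta}_G(p)=h$ and $p$ starts at a vertex of positive balance and ends at a vertex of negative balance in $G$; a cycle $q$ realizes a cycle hint $h$ if $\mathrm{meta}_G(q)=h$. $E$ heeds advice $P$ if $E$ contains paths and cycles realizing all hints of $P$. EE: given $G,\omega_{max},\omega$, is there an Eulerian extension of weight $\le\omega_{max}$? EEA: given $G,\omega_{max},\omega$ and an advice $P$, is there an Eulerian extension of weight $\le\omega_{max}$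 heeding $P$? A polynomial-time polynomial-parameter many-one reduction maps instances $I$ in polynomial time to instances $r(I)$ with $I$ a yes-instance iff $r(I)$ is, and parameter of $r(I)$ bounded by a polynomial in the parameter of $I$.
   Formalization: For a path hint whose trail is a cycle of the component graph, the realizing path may repeat vertices (a trail in the extension); with vertex-simple paths and arbitrary weights the claim would imply P = NP. Other hints are realized by simple paths and cycles as stated. *)

theory Defs
  imports
    Complex_Main
    "HOL-Library.Multiset"
    "HOL-Library.Extended_Real"
    "HOL-Computational_Algebra.Polynomial"
    "Graph_Theory.Graph_Theory"
begin

section \<open>Directed multigraphs and Eulerian extensions\<close>

text \<open>
  A multigraph is given by a vertex set and a multiset of pairs.  To use the notions of the
  library, the \<open>n\<close> copies of an arc \<open>a\<close> become the arcs \<open>(a, 0), \<dots>, (a, n - 1)\<close>.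
\<close>

definition multigraph ::
    "'v set \<Rightarrow> ('v \<times> 'v) multiset \<Rightarrow> ('v, ('v \<times> 'v) \<times> nat) pre_digraph" where
  "multigraph V A =
     \<lparr>verts = V, arcs = {(a, i). i < count A a}, tail = fst \<circ> fst, head = snd \<circ> fst\<rparr>"

text \<open>Vertices lie in \<open>V\<close> and there are no loops.\<close>

definition arcs_on :: "'v set \<Rightarrow> ('v \<times> 'v) multiset \<Rightarrow> bool" where
  "arcs_on V A \<longleftrightarrow> (\<forall>(u, v) \<in># A. u \<in> V \<and> v \<in> V \<and> u \<noteq> v)"

definition balance :: "'v set \<Rightarrow> ('v \<times> 'v) multiset \<Rightarrow> 'v \<Rightarrow> int" where
  "balance V A v =
     int (in_degree (multigraph V A) v) - int (out_degree (multigraph V A) v)"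

text \<open>
  Connected components of the underlying undirected graph, as vertex sets:
  the strong components of the symmetrized graph.
\<close>

definition components :: "'v set \<Rightarrow> ('v \<times> 'v) multiset \<Rightarrow> 'v set set" where
  "components V A = pre_digraph.sccs_verts (with_proj (mk_symmetric (multigraph V A)))"

definition component_of :: "'v set \<Rightarrow> ('v \<times> 'v) multiset \<Rightarrow> 'v \<Rightarrow> 'v set" where
  "component_of V A v = pre_digraph.scc_of (with_proj (mk_symmetric (multigraph V A))) v"

definition eulerian :: "'v set \<Rightarrow> ('v \<times> 'v) multiset \<Rightarrow> bool" where
  "eulerian V A \<longleftrightarrow> (\<exists>u p. pre_digraph.euler_trail (multigraph V A) u p u)"

definition eulerian_extension ::
    "'v set \<Rightarrow> ('v \<times> 'v) multiset \<Rightarrow> ('v \<times> 'v) multiset \<Rightarrow> bool" where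
  "eulerian_extension V A E \<longleftrightarrow> arcs_on V E \<and> eulerian V (A + E)"

definition total_weight :: "('v \<times> 'v \<Rightarrow> ereal) \<Rightarrow> ('v \<times> 'v) multiset \<Rightarrow> ereal" where
  "total_weight w E = (\<Sum>a \<in># E. w a)"


section \<open>Hints and advice\<close>

text \<open>
  Undirected trails in the component graph are vertex lists; a closed trail repeats its first
  vertex at the end.
\<close>

definition component_graph :: "'v set \<Rightarrow> ('v \<times> 'v) multiset \<Rightarrow> 'v set pair_pre_digraph" where
  "component_graph V A =
     \<lparr>pverts = components V A,
      parcs = {(K, L). K \<in> components V A \<and> L \<in> components V A \<and> K \<noteq> L}\<rparr>"

definition closed_list :: "'a list \<Rightarrow> bool" where
  "closed_list t \<longleftrightarrow> length t \<ge> 2 \<and> hd t = last t"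

text \<open>
  A cycle of a simple undirected graph has at least three edges (\<open>K, L, K\<close> would use the edge
  between \<open>K\<close> and \<open>L\<close> twice).
\<close>

definition component_path :: "'v set \<Rightarrow> ('v \<times> 'v) multiset \<Rightarrow> 'v set list \<Rightarrow> bool" where
  "component_path V A t \<longleftrightarrow> vpath t (with_proj (component_graph V A)) \<and> vwalk_length t \<ge> 1"

definition component_cycle :: "'v set \<Rightarrow> ('v \<times> 'v) multiset \<Rightarrow> 'v set list \<Rightarrow> bool" where
  "component_cycle V A t \<longleftrightarrow>
     vwalk t (with_proj (component_graph V A)) \<and> closed_list t \<and> distinct (tl t) \<and>
     vwalk_length t \<ge> 3"

text \<open>
  Equality of undirected trails: up to reversal and, for closed trails, up to the choice of the
  first vertex.
\<close>

definition same_trail :: "'a list \<Rightarrow> 'a list \<Rightarrow> bool" where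
  "same_trail s t \<longleftrightarrow>
     t = s \<or> t = rev s \<or>
     (closed_list s \<and> closed_list t \<and>
      (\<exists>n. butlast t = rotate n (butlast s) \<or> butlast t = rotate n (butlast (rev s))))"

definition undirected_edges :: "'a list \<Rightarrow> 'a set set" where
  "undirected_edges t = (\<lambda>(x, y). {x, y}) ` set (vwalk_arcs t)"

text \<open>
  The designation is independent of the shape of the trail: a directed path that returns to the
  component in which it starts corresponds to a cycle of the component graph.
\<close>

datatype 'v hint = Path_Hint (hint_trail: "'v set list") | Cycle_Hint (hint_trail: "'v set list")

definition hint_on :: "'v set \<Rightarrow> ('v \<times> 'v) multiset \<Rightarrow> 'v hint \<Rightarrow> bool" where
  "hint_on V A h \<longleftrightarrow> component_path V A (hint_trail h) \<or> component_cycle V A (hint_trail h)"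

definition advice_on :: "'v set \<Rightarrow> ('v \<times> 'v) multiset \<Rightarrow> 'v hint set \<Rightarrow> bool" where
  "advice_on V A P \<longleftrightarrow>
     (\<forall>h \<in> P. hint_on V A h) \<and>
     pairwise (\<lambda>h h'. undirected_edges (hint_trail h) \<inter> undirected_edges (hint_trail h') = {}) P"

text \<open>
  A trail of \<open>(V, V \<times> V)\<close> is given by its vertex list. In a closed list, the two end segments lie
  in the same component, so that the resulting list is again closed.
\<close>

definition meta :: "'v set \<Rightarrow> ('v \<times> 'v) multiset \<Rightarrow> 'v list \<Rightarrow> 'v set list" where
  "meta V A t = remdups_adj (map (component_of V A) t)"

definition full_digraph :: "'v set \<Rightarrow> 'v pair_pre_digraph" where
  "full_digraph V = \<lparr>pverts = V, parcs = V \<times> V\<rparr>"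

text \<open>
  If the trail of a path hint is a cycle of the component graph, then a realizing path has two
  separate segments in its first component. These segments are allowed to meet, that is, such a
  path is a trail of the multigraph formed by the extension. Requiring the segments to be disjoint
  would, for arbitrary weights, encode the NP-hard directed two disjoint paths problem with three
  components, whereas the problem without advice is polynomial for boundedly many components.
  For all other hints, paths and cycles have no repeated vertices.
\<close>

fun realizes :: "'v set \<Rightarrow> ('v \<times> 'v) multiset \<Rightarrow> 'v list \<Rightarrow> 'v hint \<Rightarrow> bool" where
  "realizes V A p (Path_Hint t) \<longleftrightarrow>
     vwalk p (with_proj (full_digraph V)) \<and> (\<not> closed_list t \<longrightarrow> distinct p) \<and>
     same_trail t (meta V A p) \<and> balance V A (hd p) > 0 \<and> balance V A (last p) < 0"
| "realizes V A q (Cycle_Hint t) \<longleftrightarrow>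
     vwalk q (with_proj (full_digraph V)) \<and> closed_list q \<and> distinct (tl q) \<and>
     same_trail t (meta V A q)"

text \<open>
  The realizations are contained in the multiset jointly: no copy of an arc is used by two of them.
\<close>

definition heeds ::
    "'v set \<Rightarrow> ('v \<times> 'v) multiset \<Rightarrow> ('v \<times> 'v) multiset \<Rightarrow> 'v hint set \<Rightarrow> bool" where
  "heeds V A E P \<longleftrightarrow>
     (\<exists>f. (\<forall>h \<in> P. realizes V A (f h) h) \<and> (\<Sum>h \<in> P. mset (vwalk_arcs (f h))) \<subseteq># E)"


section \<open>Polynomial time\<close>

text \<open>
  Data are binary trees without labels. The machine model is Jones' WHILE language over such
  trees; programs use finitely many of the variables. Every evaluation of an expression is charged
  the sizes of all values it produces. Hence the size of the store is at most the size of the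
  input plus the time spent, and the model and Turing machines simulate each other with
  polynomial overhead.
\<close>

datatype tree = Leaf | Node tree tree

datatype exp = Var nat | Empty | Join exp exp | Hd exp | Tl exp | Equal exp exp

datatype com = Skip | Assign nat exp | Seq com com | Cond exp com com | While exp com

type_synonym store = "nat \<Rightarrow> tree"

fun left :: "tree \<Rightarrow> tree" where
  "left Leaf = Leaf"
| "left (Node s t) = s"

fun right :: "tree \<Rightarrow> tree" where
  "right Leaf = Leaf"
| "right (Node s t) = t"

fun eval_exp :: "exp \<Rightarrow> store \<Rightarrow> tree" where
  "eval_exp (Var x) s = s x"
| "eval_exp Empty s = Leaf"
| "eval_exp (Join d e) s = Node (eval_exp d s) (eval_exp e s)"
| "eval_exp (Hd e) s = left (eval_exp e s)"
| "eval_exp (Tl e) s = right (eval_exp e s)"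
| "eval_exp (Equal d e) s = (if eval_exp d s = eval_exp e s then Node Leaf Leaf else Leaf)"

fun sub_cost :: "exp \<Rightarrow> store \<Rightarrow> nat"
and exp_cost :: "exp \<Rightarrow> store \<Rightarrow> nat" where
  "sub_cost (Var x) s = 0"
| "sub_cost Empty s = 0"
| "sub_cost (Join d e) s = exp_cost d s + exp_cost e s"
| "sub_cost (Hd e) s = exp_cost e s"
| "sub_cost (Tl e) s = exp_cost e s"
| "sub_cost (Equal d e) s = exp_cost d s + exp_cost e s"
| "exp_cost e s = sub_cost e s + size (eval_exp e s) + 1"

text \<open>\<open>exec c s n s'\<close>: started in \<open>s\<close>, the command \<open>c\<close> stops in \<open>s'\<close> after time \<open>n\<close>.\<close>

inductive exec :: "com \<Rightarrow> store \<Rightarrow> nat \<Rightarrow> store \<Rightarrow> bool" where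
  Skip: "exec Skip s 1 s"
| Assign: "exec (Assign x e) s (exp_cost e s + 1) (s(x := eval_exp e s))"
| Seq: "exec c s m s' \<Longrightarrow> exec d s' n s'' \<Longrightarrow> exec (Seq c d) s (m + n) s''"
| CondTrue: "eval_exp e s \<noteq> Leaf \<Longrightarrow> exec c s n s' \<Longrightarrow> exec (Cond e c d) s (exp_cost e s + n) s'"
| CondFalse: "eval_exp e s = Leaf \<Longrightarrow> exec d s n s' \<Longrightarrow> exec (Cond e c d) s (exp_cost e s + n) s'"
| WhileFalse: "eval_exp e s = Leaf \<Longrightarrow> exec (While e c) s (exp_cost e s) s"
| WhileTrue: "eval_exp e s \<noteq> Leaf \<Longrightarrow> exec c s m s' \<Longrightarrow> exec (While e c) s' n s'' \<Longrightarrow>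
    exec (While e c) s (exp_cost e s + m + n) s''"

text \<open>Input and output are in variable 0; all other variables are initially empty.\<close>

definition computes_in_time :: "com \<Rightarrow> tree \<Rightarrow> tree \<Rightarrow> nat \<Rightarrow> bool" where
  "computes_in_time c x y n \<longleftrightarrow> (\<exists>s. exec c ((\<lambda>_. Leaf)(0 := x)) n s \<and> s 0 = y)"


section \<open>Parameterized problems and reductions\<close>

text \<open>
  An instance may have several encodings, for instance due to the order in which its vertices are
  listed. A reduction must work for every encoding of every instance.
\<close>

record 'i problem =
  is_instance :: "'i \<Rightarrow> bool"
  encodes :: "tree \<Rightarrow> 'i \<Rightarrow> bool"
  is_yes :: "'i \<Rightarrow> bool"
  parameter :: "'i \<Rightarrow> nat"

definition poly_time_poly_parameter_reducible :: "'i problem \<Rightarrow> 'j problem \<Rightarrow> bool" where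
  "poly_time_poly_parameter_reducible Q R \<longleftrightarrow>
     (\<exists>(c :: com) (time :: nat poly) (bound :: nat poly).
        \<forall>I x. is_instance Q I \<and> encodes Q x I \<longrightarrow>
          (\<exists>J y n. computes_in_time c x y n \<and> n \<le> poly time (size x) \<and>
             is_instance R J \<and> encodes R y J \<and>
             (is_yes Q I \<longleftrightarrow> is_yes R J) \<and>
             parameter R J \<le> poly bound (parameter Q I)))"


section \<open>The two problems\<close>

record 'v ee_instance =
  vertices :: "'v set"
  arc_mset :: "('v \<times> 'v) multiset"
  max_weight :: real
  weight :: "'v \<times> 'v \<Rightarrow> ereal"

record 'v eea_instance = "'v ee_instance" +
  advice :: "'v hint set"

definition ee_instance_ok :: "('v, 'b) ee_instance_scheme \<Rightarrow> bool" where
  "ee_instance_ok I \<longleftrightarrow>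
     finite (vertices I) \<and> arcs_on (vertices I) (arc_mset I) \<and> 0 \<le> max_weight I \<and>
     (\<forall>a \<in> vertices I \<times> vertices I. weight I a \<in> {0..ereal (max_weight I)} \<union> {\<infinity>})"

definition eea_instance_ok :: "'v eea_instance \<Rightarrow> bool" where
  "eea_instance_ok I \<longleftrightarrow>
     ee_instance_ok I \<and> advice_on (vertices I) (arc_mset I) (advice I)"

definition ee_yes :: "'v ee_instance \<Rightarrow> bool" where
  "ee_yes I \<longleftrightarrow>
     (\<exists>E. eulerian_extension (vertices I) (arc_mset I) E \<and>
          total_weight (weight I) E \<le> ereal (max_weight I))"

definition eea_yes :: "'v eea_instance \<Rightarrow> bool" where
  "eea_yes I \<longleftrightarrow>
     (\<exists>E. eulerian_extension (vertices I) (arc_mset I) E \<and>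
          total_weight (weight I) E \<le> ereal (max_weight I) \<and>
          heeds (vertices I) (arc_mset I) E (advice I))"

definition component_number :: "('v, 'b) ee_instance_scheme \<Rightarrow> nat" where
  "component_number I = card (components (vertices I) (arc_mset I))"

text \<open>
  For encoded instances the vertices themselves are trees, natural numbers are written in binary
  (least significant bit first), and the finite weights and the maximum weight are nonnegative
  rational numbers, given as fractions.
\<close>

definition tree_of_list :: "tree list \<Rightarrow> tree" where
  "tree_of_list ts = foldr Node ts Leaf"

fun tree_of_nat :: "nat \<Rightarrow> tree" where
  "tree_of_nat n =
     (if n = 0 then Leaf
      else Node (if even n then Leaf else Node Leaf Leaf) (tree_of_nat (n div 2)))"

declare tree_of_nat.simps [simp del]

definition encodes_real :: "tree \<Rightarrow> real \<Rightarrow> bool" where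
  "encodes_real x r \<longleftrightarrow>
     (\<exists>p q. q > 0 \<and> x = Node (tree_of_nat p) (tree_of_nat q) \<and> r = real p / real q)"

definition encodes_weight :: "tree \<Rightarrow> ereal \<Rightarrow> bool" where
  "encodes_weight x w \<longleftrightarrow> x = Leaf \<and> w = \<infinity> \<or> (\<exists>r. encodes_real x r \<and> w = ereal r)"

definition encodes_set :: "tree \<Rightarrow> tree set \<Rightarrow> bool" where
  "encodes_set x S \<longleftrightarrow> (\<exists>ts. x = tree_of_list ts \<and> distinct ts \<and> set ts = S)"

definition encodes_arcs :: "tree \<Rightarrow> (tree \<times> tree) multiset \<Rightarrow> bool" where
  "encodes_arcs x A \<longleftrightarrow>
     (\<exists>as. x = tree_of_list (map (\<lambda>(u, v). Node u v) as) \<and> mset as = A)"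

definition encodes_weights :: "tree \<Rightarrow> tree set \<Rightarrow> (tree \<times> tree \<Rightarrow> ereal) \<Rightarrow> bool" where
  "encodes_weights x V w \<longleftrightarrow>
     (\<exists>tab. x = tree_of_list (map (\<lambda>((u, v), t). Node (Node u v) t) tab) \<and>
        distinct (map fst tab) \<and> set (map fst tab) = V \<times> V \<and>
        (\<forall>(a, t) \<in> set tab. encodes_weight t (w a)))"

definition encodes_hint :: "tree \<Rightarrow> tree hint \<Rightarrow> bool" where
  "encodes_hint x h \<longleftrightarrow>
     (\<exists>ts. list_all2 encodes_set ts (hint_trail h) \<and>
        x = Node (if is_Path_Hint h then Leaf else Node Leaf Leaf) (tree_of_list ts))"

definition encodes_advice :: "tree \<Rightarrow> tree hint set \<Rightarrow> bool" where
  "encodes_advice x P \<longleftrightarrow>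
     (\<exists>ts hs. x = tree_of_list ts \<and> list_all2 encodes_hint ts hs \<and> distinct hs \<and> set hs = P)"

definition encodes_ee :: "tree \<Rightarrow> (tree, 'b) ee_instance_scheme \<Rightarrow> bool" where
  "encodes_ee x I \<longleftrightarrow>
     (\<exists>xv xa xm xw. x = tree_of_list [xv, xa, xm, xw] \<and>
        encodes_set xv (vertices I) \<and> encodes_arcs xa (arc_mset I) \<and>
        encodes_real xm (max_weight I) \<and> encodes_weights xw (vertices I) (weight I))"

definition encodes_eea :: "tree \<Rightarrow> tree eea_instance \<Rightarrow> bool" where
  "encodes_eea x I \<longleftrightarrow>
     (\<exists>xg xp. x = Node xg xp \<and> encodes_ee xg I \<and> encodes_advice xp (advice I))"

definition EE :: "tree ee_instance problem" where
  "EE = \<lparr>is_instance = ee_instance_ok, encodes = encodes_ee, is_yes = ee_yes,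
         parameter = component_number\<rparr>"

definition EEA :: "tree eea_instance problem" where
  "EEA = \<lparr>is_instance = eea_instance_ok, encodes = encodes_eea, is_yes = eea_yes,
          parameter = component_number\<rparr>"

end

theory Submission
  imports Defs
begin

text \<open>
  Every hint gets a hub, which lies in a component of its own and which an Eulerian extension of the
  new graph has to connect to the rest.  For every way to traverse the hint and every choice of the
  end vertices \<open>v\<close> and \<open>u\<close> of a realization there is a chain, that is, a layered copy of the
  components on the hint: arcs of finite weight stay in a layer or lead to the next one, with the
  weights of the original arcs; the chain is entered only at the copy of \<open>v\<close> in the first layer and
  left only at the copy of \<open>u\<close> in the last one, at no cost.  Pairs of opposite arcs, which change no
  balance, tie the first layer to the hub and every copy in a later layer to its original vertex.

  All copies being balanced, an extension obeys flow conservation there.  Hence connecting the hub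
  requires a path through a whole chain, and this path projects to a realization of the hint.
  Conversely, realizations are lifted to the chains.  The number of hints is at most the square of
  the number of components, because they are edge-disjoint.  The reduction only copies weights and
  computes no distances, so that it needs no arithmetic.
\<close>

section \<open>Polynomial-time computable functions on trees\<close>

text \<open>What makes a hub hard to reach is the direction of its chains. Arcs of finite weight
  inside a chain never go back to an earlier layer, none touches a hub, and no tie crosses the
  boundary of a hub together with the first layers of its chains. So an extension has to cross this
  boundary, and the flow crossing it can only have come in through an entry and can only drain
  through an exit. Fixing both ends in a chain encodes the balance conditions of a path hint, at the
  price of quadratically many chains per traversal. Chains of different hints share no copy, so the
  realizations extracted from them use different arcs of the extension, which gives the joint
  containment demanded by \<open>heeds\<close>. Consecutive components differ, so no arc inside a
  chain used by an extension collapses to a loop; only entries and exits disappear in the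
  projection.\<close>

named_theorems poly_time_intros

section \<open>Polynomial bounds on natural numbers\<close>

definition poly_bounded :: "(nat \<Rightarrow> nat) \<Rightarrow> bool" where
  "poly_bounded b \<longleftrightarrow> (\<exists>p. \<forall>n. b n \<le> poly p n)"

text \<open>The coefficients are natural numbers, so every polynomial is monotone and bounds can be
  composed.\<close>

lemma poly_mono_nat: "m \<le> n \<Longrightarrow> poly (p :: nat poly) m \<le> poly p n"
  by (induction p) (auto intro!: add_mono mult_mono)

lemma poly_bounded_poly [intro]: "poly_bounded (poly p)"
  by (auto simp: poly_bounded_def)

lemma poly_bounded_const [intro]: "poly_bounded (\<lambda>n. c)"
  unfolding poly_bounded_def by (rule exI[of _ "[:c:]"]) simp

lemma poly_bounded_id [intro]: "poly_bounded (\<lambda>n. n)"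
  unfolding poly_bounded_def by (rule exI[of _ "[:0, 1:]"]) simp

lemma poly_bounded_add [intro]:
  "poly_bounded f \<Longrightarrow> poly_bounded g \<Longrightarrow> poly_bounded (\<lambda>n. f n + g n)"
  unfolding poly_bounded_def by (metis add_mono poly_add)

lemma poly_bounded_mult [intro]:
  "poly_bounded f \<Longrightarrow> poly_bounded g \<Longrightarrow> poly_bounded (\<lambda>n. f n * g n)"
  unfolding poly_bounded_def by (metis mult_mono' poly_mult zero_le)

lemma poly_bounded_comp:
  assumes "poly_bounded f" "poly_bounded g"
  shows "poly_bounded (\<lambda>n. f (g n))"
proof -
  obtain p q where "\<And>n. f n \<le> poly p n" "\<And>n. g n \<le> poly q n"
    using assms unfolding poly_bounded_def by blast
  then have "f (g n) \<le> poly (pcompose p q) n" for n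
    by (metis order_trans poly_mono_nat poly_pcompose)
  then show ?thesis unfolding poly_bounded_def by blast
qed

lemma poly_bounded_poly_comp [intro]: "poly_bounded g \<Longrightarrow> poly_bounded (\<lambda>n. poly p (g n))"
  by (rule poly_bounded_comp) auto

lemma poly_bounded_Suc [intro]: "poly_bounded g \<Longrightarrow> poly_bounded (\<lambda>n. Suc (g n))"
  using poly_bounded_add[of g "\<lambda>_. 1"] by auto

section \<open>Programs that overwrite their argument with the result\<close>

lemma exec_AssignI: "n = exp_cost e s + 1 \<Longrightarrow> s' = s(x := eval_exp e s) \<Longrightarrow> exec (Assign x e) s n s'"
  by (metis exec.Assign)

text \<open>
  A program for the argument in variable \<open>k\<close> may use the variables above \<open>k\<close> as scratch space with
  arbitrary initial contents; so programs compose without renaming variables or clearing the store.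
\<close>

definition runs_in :: "nat \<Rightarrow> com \<Rightarrow> (tree \<Rightarrow> tree) \<Rightarrow> (nat \<Rightarrow> nat) \<Rightarrow> bool" where
  "runs_in k c f b \<longleftrightarrow>
     (\<forall>s. \<exists>n s'. exec c s n s' \<and> s' k = f (s k) \<and> (\<forall>j<k. s' j = s j) \<and> n \<le> b (size (s k)))"

text \<open>The output bound is a conjunct of its own because the time of a composed program is
  measured in the size of the intermediate result. Programs are demanded for every base variable
  \<open>k\<close>, so that one program can call another on a higher block of variables.\<close>

definition poly_time :: "(tree \<Rightarrow> tree) \<Rightarrow> bool" where
  "poly_time f \<longleftrightarrow>
     (\<exists>p. \<forall>x. size (f x) \<le> poly p (size x)) \<and> (\<forall>k. \<exists>c p. runs_in k c f (poly p))"

lemma poly_timeI: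
  assumes "poly_bounded b" "\<And>x. size (f x) \<le> b (size x)"
    and "\<And>k. \<exists>c t. poly_bounded t \<and> runs_in k c f t"
  shows "poly_time f"
  unfolding poly_time_def
proof (intro conjI allI)
  show "\<exists>p. \<forall>x. size (f x) \<le> poly p (size x)"
    using assms(1,2) unfolding poly_bounded_def by (meson order_trans)
  fix k
  obtain c t where ct: "poly_bounded t" "runs_in k c f t" using assms(3) by blast
  then obtain p where "\<And>n. t n \<le> poly p n" by (auto simp: poly_bounded_def)
  with ct(2) show "\<exists>c p. runs_in k c f (poly p)"
    unfolding runs_in_def by (meson order_trans)
qed

lemma poly_time_sizeE:
  assumes "poly_time f"
  obtains p where "\<And>x. size (f x) \<le> poly p (size x)"
  using assms by (auto simp: poly_time_def)

lemma poly_time_program: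
  assumes "poly_time f"
  obtains c p where "runs_in k c f (poly p)"
  using assms unfolding poly_time_def by blast

lemma runs_inD:
  "runs_in k c f b \<Longrightarrow>
    \<exists>n s'. exec c s n s' \<and> s' k = f (s k) \<and> (\<forall>j<k. s' j = s j) \<and> n \<le> b (size (s k))"
  by (simp add: runs_in_def)

text \<open>One assignment suffices. Since every evaluation is charged the size of its value, the
  cost bound also bounds the size of the output.\<close>

lemma poly_time_expr:
  assumes "\<And>k s. eval_exp (e k) s = f (s k)" "poly_bounded b"
    and "\<And>k s. exp_cost (e k) s \<le> b (size (s k))"
  shows "poly_time f"
proof (rule poly_timeI[OF assms(2)])
  fix x
  have "size (f x) \<le> exp_cost (e 0) (\<lambda>_. x)"
    using assms(1)[of 0 "\<lambda>_. x"] by (cases "e 0") auto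
  also have "\<dots> \<le> b (size x)" using assms(3)[of 0 "\<lambda>_. x"] by simp
  finally show "size (f x) \<le> b (size x)" .
next
  fix k
  have "runs_in k (Assign k (e k)) f (\<lambda>n. b n + 1)"
    unfolding runs_in_def
  proof
    fix s :: store
    show "\<exists>n s'. exec (Assign k (e k)) s n s' \<and> s' k = f (s k) \<and> (\<forall>j<k. s' j = s j) \<and>
      n \<le> b (size (s k)) + 1"
      using exec.Assign[of k "e k" s] assms(1,3)[of k s]
      by (intro exI[of _ "exp_cost (e k) s + 1"] exI[of _ "s(k := f (s k))"]) auto
  qed
  then show "\<exists>c t. poly_bounded t \<and> runs_in k c f t" using assms(2) by blast
qed

section \<open>Basic functions, composition, pairs and branching\<close>

lemma poly_time_id [poly_time_intros]: "poly_time (\<lambda>x. x)"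
  by (rule poly_time_expr[where e = Var and b = "\<lambda>n. n + 1"]) auto

lemma poly_time_const [poly_time_intros]: "poly_time (\<lambda>x. t)"
proof (induction t)
  case Leaf
  show ?case by (rule poly_time_expr[where e = "\<lambda>_. Empty" and b = "\<lambda>n. 1"]) auto
next
  case (Node t1 t2)
  \<comment> \<open>The expression that builds its argument from \<open>Empty\<close> by
    \<open>Join\<close>; its cost does not depend on the store, so it serves as a constant
    bound.\<close>
  define q where "q = rec_tree Empty (\<lambda>_ _. Join)"
  have ev: "eval_exp (q t) s = t" for t s
    by (induction t) (auto simp: q_def)
  have cost: "exp_cost (q t) s = exp_cost (q t) (\<lambda>_. Leaf)" for t s
    by (induction t) (auto simp: q_def ev[unfolded q_def])
  show ?case
  proof (rule poly_time_expr)
    show "exp_cost (q (Node t1 t2)) s \<le> exp_cost (q (Node t1 t2)) (\<lambda>_. Leaf)" for s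
      by (rule eq_refl, rule cost)
  qed (auto simp: ev)
qed

lemma size_left: "size (left t) \<le> size t" and size_right: "size (right t) \<le> size t"
  by (cases t; simp)+

lemma poly_time_comp:
  assumes "poly_time f" "poly_time g"
  shows "poly_time (\<lambda>x. f (g x))"
proof -
  obtain p q where p: "\<And>x. size (f x) \<le> poly p (size x)" and q: "\<And>x. size (g x) \<le> poly q (size x)"
    using assms by (meson poly_time_sizeE)
  show ?thesis
  proof (rule poly_timeI[where b = "\<lambda>n. poly p (poly q n)"])
    show "size (f (g x)) \<le> poly p (poly q (size x))" for x
      using p[of "g x"] q[of x] poly_mono_nat order_trans by blast
    fix k
    obtain c pc where c: "runs_in k c f (poly pc)"
      by (rule poly_time_program[OF assms(1)])
    obtain d pd where d: "runs_in k d g (poly pd)"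
      by (rule poly_time_program[OF assms(2)])
    have "runs_in k (Seq d c) (\<lambda>x. f (g x)) (\<lambda>n. poly pd n + poly pc (poly q n))"
      unfolding runs_in_def
    proof
      fix s :: store
      obtain n s' where s': "exec d s n s'" "s' k = g (s k)" "\<forall>j<k. s' j = s j" "n \<le> poly pd (size (s k))"
        using runs_inD[OF d] by blast
      obtain m s'' where s'': "exec c s' m s''" "s'' k = f (s' k)" "\<forall>j<k. s'' j = s' j"
          "m \<le> poly pc (size (s' k))"
        using runs_inD[OF c] by blast
      have "m \<le> poly pc (poly q (size (s k)))"
        using s''(4) s'(2) q poly_mono_nat order_trans by metis
      then show "\<exists>n s'. exec (Seq d c) s n s' \<and> s' k = f (g (s k)) \<and> (\<forall>j<k. s' j = s j) \<and>
          n \<le> poly pd (size (s k)) + poly pc (poly q (size (s k)))"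
        using exec.Seq[OF s'(1) s''(1)] s' s'' by (intro exI[of _ "n + m"] exI[of _ s'']) auto
    qed
    then show "\<exists>c t. poly_bounded t \<and> runs_in k c (\<lambda>x. f (g x)) t" by blast
  qed auto
qed

lemma poly_time_left [poly_time_intros]: "poly_time f \<Longrightarrow> poly_time (\<lambda>x. left (f x))"
  by (rule poly_time_comp[of left], rule poly_time_expr[where e = "\<lambda>k. Hd (Var k)"
      and b = "\<lambda>n. n + (n + 2)"])
    (auto simp: size_left simp del: add_2_eq_Suc' intro!: poly_bounded_add)

lemma poly_time_right [poly_time_intros]: "poly_time f \<Longrightarrow> poly_time (\<lambda>x. right (f x))"
  by (rule poly_time_comp[of right], rule poly_time_expr[where e = "\<lambda>k. Tl (Var k)"
      and b = "\<lambda>n. n + (n + 2)"])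
    (auto simp: size_right simp del: add_2_eq_Suc' intro!: poly_bounded_add)

text \<open>The argument must survive the first computation: it is copied to \<open>k + 1\<close>
  for \<open>f\<close> and later from \<open>k\<close> to \<open>k + 2\<close> for \<open>g\<close>.
  As programs leave lower variables alone, \<open>k + 1\<close> keeps the first result
  meanwhile.\<close>

lemma poly_time_Node [poly_time_intros]:
  assumes "poly_time f" "poly_time g"
  shows "poly_time (\<lambda>x. Node (f x) (g x))"
proof -
  obtain p q where p: "\<And>x. size (f x) \<le> poly p (size x)" and q: "\<And>x. size (g x) \<le> poly q (size x)"
    using assms by (meson poly_time_sizeE)
  show ?thesis
  proof (rule poly_timeI[where b = "\<lambda>n. poly p n + poly q n + 1"])
    show "size (Node (f x) (g x)) \<le> poly p (size x) + poly q (size x) + 1" for x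
      using p[of x] q[of x] by simp
    fix k
    obtain c pc where c: "runs_in (k + 1) c f (poly pc)"
      by (rule poly_time_program[OF assms(1)])
    obtain d pd where d: "runs_in (k + 2) d g (poly pd)"
      by (rule poly_time_program[OF assms(2)])
    let ?c = "Seq (Assign (k + 1) (Var k)) (Seq c (Seq (Assign (k + 2) (Var k)) (Seq d
      (Assign k (Join (Var (k + 1)) (Var (k + 2)))))))"
    let ?t = "\<lambda>n. n + 2 + (poly pc n + (n + 2 + (poly pd n + (2 * (poly p n + poly q n) + 5))))"
    have "runs_in k ?c (\<lambda>x. Node (f x) (g x)) ?t"
      unfolding runs_in_def
    proof
      fix s :: store
      let ?x = "s k" and ?s0 = "s(k + 1 := s k)"
      obtain n1 s1 where s1: "exec c ?s0 n1 s1" "s1 (k + 1) = f ?x" "\<forall>j<k+1. s1 j = ?s0 j"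
          "n1 \<le> poly pc (size ?x)"
        using runs_inD[OF c, of ?s0] by auto
      let ?s1 = "s1(k + 2 := ?x)"
      obtain n2 s2 where s2: "exec d ?s1 n2 s2" "s2 (k + 2) = g ?x" "\<forall>j<k+2. s2 j = ?s1 j"
          "n2 \<le> poly pd (size ?x)"
        using runs_inD[OF d, of ?s1] by auto
      let ?s2 = "s2(k := Node (f ?x) (g ?x))"
      have k: "s1 k = ?x" "s2 k = ?x" "s2 (k + 1) = f ?x" using s1 s2 by auto
      have e0: "exec (Assign (k + 1) (Var k)) s (size ?x + 2) ?s0"
        by (rule exec_AssignI) auto
      have e1: "exec (Assign (k + 2) (Var k)) s1 (size ?x + 2) ?s1"
        by (rule exec_AssignI) (use k in auto)
      have e2: "exec (Assign k (Join (Var (k + 1)) (Var (k + 2)))) s2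
          (2 * (size (f ?x) + size (g ?x)) + 5) ?s2"
        by (rule exec_AssignI) (use k s2(2) in auto)
      have "exec ?c s (size ?x + 2 + (n1 + (size ?x + 2 + (n2 +
          (2 * (size (f ?x) + size (g ?x)) + 5))))) ?s2"
        by (rule exec.Seq[OF e0 exec.Seq[OF s1(1) exec.Seq[OF e1 exec.Seq[OF s2(1) e2]]]])
      moreover have "size ?x + 2 + (n1 + (size ?x + 2 + (n2 +
          (2 * (size (f ?x) + size (g ?x)) + 5)))) \<le> ?t (size ?x)"
        by (intro add_mono mult_le_mono2 le_refl s1(4) s2(4) p q)
      moreover have "?s2 k = Node (f ?x) (g ?x)" by simp
      moreover have "\<forall>j<k. ?s2 j = s j" using s1(3) s2(3) by auto
      ultimately show "\<exists>n s'. exec ?c s n s' \<and> s' k = Node (f ?x) (g ?x) \<and>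
        (\<forall>j<k. s' j = s j) \<and> n \<le> ?t (size ?x)" by blast
    qed
    moreover have "poly_bounded ?t" by (intro poly_bounded_add poly_bounded_mult) auto
    ultimately show "\<exists>c t. poly_bounded t \<and> runs_in k c (\<lambda>x. Node (f x) (g x)) t" by blast
  qed (intro poly_bounded_add poly_bounded_poly poly_bounded_const)
qed

text \<open>Truth values are coded as by \<open>Equal\<close>; \<open>Cond\<close> and
  \<open>While\<close> test for a tree other than \<open>Leaf\<close>.\<close>

definition poly_time_test :: "(tree \<Rightarrow> bool) \<Rightarrow> bool" where
  "poly_time_test b \<longleftrightarrow> poly_time (\<lambda>x. if b x then Node Leaf Leaf else Leaf)"

lemma poly_time_if [poly_time_intros]:
  assumes "poly_time_test b" "poly_time f" "poly_time g"
  shows "poly_time (\<lambda>x. if b x then f x else g x)"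
proof -
  let ?b = "\<lambda>x. if b x then Node Leaf Leaf else Leaf"
  let ?f = "\<lambda>x. if b x then f x else g x"
  obtain p q where p: "\<And>x. size (f x) \<le> poly p (size x)" and q: "\<And>x. size (g x) \<le> poly q (size x)"
    using assms by (meson poly_time_sizeE)
  show ?thesis
  proof (rule poly_timeI[where b = "\<lambda>n. poly p n + poly q n"])
    show "size (?f x) \<le> poly p (size x) + poly q (size x)" for x
      using p[of x] q[of x] by auto
    fix k
    obtain c pc where c: "runs_in (k + 1) c ?b (poly pc)"
      by (rule poly_time_program[OF assms(1)[unfolded poly_time_test_def]])
    obtain d1 p1 where d1: "runs_in k d1 f (poly p1)"
      by (rule poly_time_program[OF assms(2)])
    obtain d2 p2 where d2: "runs_in k d2 g (poly p2)"
      by (rule poly_time_program[OF assms(3)])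
    let ?c = "Seq (Assign (k + 1) (Var k)) (Seq c (Cond (Var (k + 1)) d1 d2))"
    let ?t = "\<lambda>n. n + 2 + (poly pc n + (2 + (poly p1 n + poly p2 n)))"
    have "runs_in k ?c ?f ?t"
      unfolding runs_in_def
    proof
      fix s :: store
      let ?x = "s k" and ?s0 = "s(k + 1 := s k)"
      obtain n1 s1 where s1: "exec c ?s0 n1 s1" "s1 (k + 1) = ?b ?x" "\<forall>j<k+1. s1 j = ?s0 j"
          "n1 \<le> poly pc (size ?x)"
        using runs_inD[OF c, of ?s0] by auto
      have k: "s1 k = ?x" using s1 by auto
      have e0: "exec (Assign (k + 1) (Var k)) s (size ?x + 2) ?s0"
        by (rule exec_AssignI) auto
      obtain n2 s2 where s2: "exec (Cond (Var (k + 1)) d1 d2) s1 n2 s2" "s2 k = ?f ?x"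
        "\<forall>j<k. s2 j = s1 j" "n2 \<le> 2 + (poly p1 (size ?x) + poly p2 (size ?x))"
      proof (cases "b ?x")
        case True
        obtain m s2 where s2: "exec d1 s1 m s2" "s2 k = f ?x" "\<forall>j<k. s2 j = s1 j"
            "m \<le> poly p1 (size ?x)"
          using runs_inD[OF d1, of s1] k by auto
        show ?thesis
          by (rule that[OF exec.CondTrue[OF _ s2(1)]]) (use True s1 s2 in auto)
      next
        case False
        obtain m s2 where s2: "exec d2 s1 m s2" "s2 k = g ?x" "\<forall>j<k. s2 j = s1 j"
            "m \<le> poly p2 (size ?x)"
          using runs_inD[OF d2, of s1] k by auto
        show ?thesis
          by (rule that[OF exec.CondFalse[OF _ s2(1)]]) (use False s1 s2 in auto)
      qed
      have "exec ?c s (size ?x + 2 + (n1 + n2)) s2"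
        by (rule exec.Seq[OF e0 exec.Seq[OF s1(1) s2(1)]])
      moreover have "size ?x + 2 + (n1 + n2) \<le> ?t (size ?x)"
        using s1(4) s2(4) by linarith
      moreover have "\<forall>j<k. s2 j = s j" using s1(3) s2(3) by auto
      ultimately show "\<exists>n s'. exec ?c s n s' \<and> s' k = ?f ?x \<and>
        (\<forall>j<k. s' j = s j) \<and> n \<le> ?t (size ?x)" using s2(2) by blast
    qed
    moreover have "poly_bounded ?t" by (intro poly_bounded_add) auto
    ultimately show "\<exists>c t. poly_bounded t \<and> runs_in k c ?f t" by blast
  qed auto
qed

text \<open>The comparison is programmed once, on the two halves of a pair; pairing and composition
  do the rest.\<close>

lemma poly_time_test_eq [poly_time_intros]:
  assumes "poly_time f" "poly_time g"
  shows "poly_time_test (\<lambda>x. f x = g x)"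
proof -
  have "poly_time (\<lambda>x. if left x = right x then Node Leaf Leaf else Leaf)"
  proof (rule poly_time_expr[where e = "\<lambda>k. Equal (Hd (Var k)) (Tl (Var k))"])
    show "exp_cost (Equal (Hd (Var k)) (Tl (Var k))) s \<le> 4 * size (s k) + 10" for k s
      using size_left[of "s k"] size_right[of "s k"] by auto
    show "poly_bounded (\<lambda>n. 4 * n + 10)"
      by (intro poly_bounded_add poly_bounded_mult poly_bounded_const poly_bounded_id)
  qed auto
  from poly_time_comp[OF this poly_time_Node[OF assms]] show ?thesis
    by (simp add: poly_time_test_def)
qed

lemma poly_time_test_not [poly_time_intros]:
  assumes "poly_time_test b"
  shows "poly_time_test (\<lambda>x. \<not> b x)"
proof -
  have "poly_time (\<lambda>x. if b x then Leaf else Node Leaf Leaf)"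
    by (intro poly_time_if assms poly_time_const)
  moreover have "(\<lambda>x. if b x then Leaf else Node Leaf Leaf) =
      (\<lambda>x. if \<not> b x then Node Leaf Leaf else Leaf)" by auto
  ultimately show ?thesis by (simp add: poly_time_test_def)
qed

lemma poly_time_test_conj [poly_time_intros]:
  assumes "poly_time_test b" "poly_time_test b'"
  shows "poly_time_test (\<lambda>x. b x \<and> b' x)"
proof -
  have "poly_time (\<lambda>x. if b x then (if b' x then Node Leaf Leaf else Leaf) else Leaf)"
    by (intro poly_time_if assms poly_time_const poly_time_Node)
  moreover have "(\<lambda>x. if b x then (if b' x then Node Leaf Leaf else Leaf) else Leaf) =
      (\<lambda>x. if b x \<and> b' x then Node Leaf Leaf else Leaf)" by auto
  ultimately show ?thesis by (simp add: poly_time_test_def)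
qed

lemma poly_time_test_disj [poly_time_intros]:
  "poly_time_test b \<Longrightarrow> poly_time_test b' \<Longrightarrow> poly_time_test (\<lambda>x. b x \<or> b' x)"
  using poly_time_test_not[OF poly_time_test_conj[OF poly_time_test_not poly_time_test_not]]
  by simp

text \<open>The source of every loop in the programs: it runs along the right spine, and each round
  gets the parameter \<open>x\<close>, the whole remaining list and the accumulator. Passing the
  remaining list instead of its head makes suffixes available.\<close>

fun fold_tree :: "(tree \<Rightarrow> tree) \<Rightarrow> tree \<Rightarrow> tree \<Rightarrow> tree \<Rightarrow> tree" where
  "fold_tree f x Leaf a = a"
| "fold_tree f x (Node t u) a = fold_tree f x u (f (Node x (Node (Node t u) a)))"

text \<open>A polynomially bounded step could square the accumulator in every round. Bounding its
  growth by a summand that depends on \<open>x\<close> and the list only keeps the result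
  polynomial, since there are at most \<open>size t\<close> rounds.\<close>

lemma fold_tree_size:
  assumes "\<And>x t a. size (f (Node x (Node t a))) \<le> size a + poly p (size x + size t)"
    and "size x + size t \<le> N"
  shows "size (fold_tree f x t a) \<le> size a + size t * poly p N"
  using assms(2)
proof (induction t arbitrary: a)
  case (Node t1 t2)
  let ?a = "f (Node x (Node (Node t1 t2) a))"
  have "size ?a \<le> size a + poly p N"
    using assms(1)[of x "Node t1 t2" a] poly_mono_nat[OF Node.prems, of p] by linarith
  then have "size (fold_tree f x t2 ?a) \<le> size a + poly p N + size t2 * poly p N"
    using Node.IH(2)[of ?a] Node.prems by simp
  also have "\<dots> \<le> size a + size (Node t1 t2) * poly p N" by simp
  finally show ?case by simp
qed simp

text \<open>Variable \<open>k\<close> holds the parameter, \<open>k + 1\<close> the remaining list,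
  \<open>k + 2\<close> the accumulator, and \<open>k + 3\<close> the argument and result of the
  step. \<open>N\<close> bounds the first two sizes together, \<open>M\<close> the accumulator plus
  all growth still to come; both bounds survive a round. The second factor of the time bound covers
  one round.\<close>

lemma exec_fold_loop:
  assumes d: "\<And>s. \<exists>n s'. exec d s n s' \<and> s' (k + 3) = f (s (k + 3)) \<and> (\<forall>j<k+3. s' j = s j) \<and>
      n \<le> poly pd (size (s (k + 3)))"
    and g: "\<And>x t a. size (f (Node x (Node t a))) \<le> size a + poly p (size x + size t)"
    and "size (s k) + size (s (k + 1)) \<le> N"
    and "size (s (k + 2)) + size (s (k + 1)) * poly p N \<le> M"
  shows "\<exists>n s'. exec (While (Var (k + 1))
      (Seq (Assign (k + 3) (Join (Var k) (Join (Var (k + 1)) (Var (k + 2)))))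
      (Seq d (Seq (Assign (k + 2) (Var (k + 3))) (Assign (k + 1) (Tl (Var (k + 1)))))))) s n s' \<and>
    s' (k + 2) = fold_tree f (s k) (s (k + 1)) (s (k + 2)) \<and> (\<forall>j\<le>k. s' j = s j) \<and>
    n \<le> (size (s (k + 1)) + 1) * (10 * N + 10 * M + 100 + poly pd (N + M + 2))"
  (is "\<exists>n s'. exec ?W _ _ _ \<and> _ \<and> _ \<and> _ \<le> _ * ?K")
  using assms(3,4)
proof (induction "s (k + 1)" arbitrary: s)
  case Leaf
  have "exec ?W s (exp_cost (Var (k + 1)) s) s"
    by (rule exec.WhileFalse) (use Leaf(1) in simp)
  then show ?case using Leaf(1)[symmetric]
    by (intro exI[of _ "exp_cost (Var (k + 1)) s"] exI[of _ s]) simp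
next
  case (Node t u)
  note t = Node.hyps(3)[symmetric]
  let ?x = "s k" and ?a = "s (k + 2)"
  let ?y = "Node ?x (Node (Node t u) ?a)"
  let ?s0 = "s(k + 3 := ?y)"
  have sx: "size ?x + size u + size t + 1 \<le> N" using Node.prems(1) t by simp
  have sa: "size ?a \<le> M" using Node.prems(2) by linarith
  have sy: "size ?y \<le> N + M + 2" using sx sa by simp
  obtain n1 s1 where s1: "exec d ?s0 n1 s1" "s1 (k + 3) = f ?y" "\<forall>j<k+3. s1 j = ?s0 j"
      "n1 \<le> poly pd (size ?y)"
    using d[of ?s0] by auto
  have k: "s1 k = ?x" "s1 (k + 1) = Node t u" "s1 (k + 2) = ?a" using s1(3) t by auto
  let ?s1 = "s1(k + 2 := f ?y)"
  let ?s2 = "?s1(k + 1 := u)"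
  have "size (f ?y) \<le> size ?a + poly p (size ?x + size (Node t u))" by (rule g)
  also have "\<dots> \<le> size ?a + poly p N" using poly_mono_nat[of _ N p] Node.prems(1) t by simp
  finally have sf: "size (f ?y) \<le> size ?a + poly p N" .
  \<comment> \<open>One round adds at most \<open>poly p N\<close> to the accumulator but removes at
    least one node from the list, so the quantity bounded by \<open>M\<close> does not
    increase.\<close>
  have "size ?a + poly p N + size u * poly p N \<le> M"
    using Node.prems(2) t by (simp add: distrib_right)
  with sf have M: "size (?s2 (k + 2)) + size (?s2 (k + 1)) * poly p N \<le> M" by simp
  then have sfM: "size (f ?y) \<le> M" by (simp; linarith)
  have N: "size (?s2 k) + size (?s2 (k + 1)) \<le> N" using k sx by simp
  have "u = ?s2 (k + 1)" by simp
  from Node.hyps(2)[OF this N M] obtain n2 s' where IH: "exec ?W ?s2 n2 s'"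
      "s' (k + 2) = fold_tree f (?s2 k) (?s2 (k + 1)) (?s2 (k + 2))" "\<forall>j\<le>k. s' j = ?s2 j"
      "n2 \<le> (size (?s2 (k + 1)) + 1) * ?K"
    by (elim exE conjE) (rule that)
  have s': "exec ?W ?s2 n2 s'" "s' (k + 2) = fold_tree f ?x u (f ?y)" "\<forall>j\<le>k. s' j = s1 j"
      "n2 \<le> (size u + 1) * ?K"
    using IH k by simp_all
  have e0: "exec (Assign (k + 3) (Join (Var k) (Join (Var (k + 1)) (Var (k + 2))))) s
      (exp_cost (Join (Var k) (Join (Var (k + 1)) (Var (k + 2)))) s + 1) ?s0"
    by (rule exec_AssignI) (use t in auto)
  have e1: "exec (Assign (k + 2) (Var (k + 3))) s1 (size (f ?y) + 2) ?s1"
    by (rule exec_AssignI) (use s1(2) in auto)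
  have e2: "exec (Assign (k + 1) (Tl (Var (k + 1)))) ?s1 (size (Node t u) + size u + 3) ?s2"
    by (rule exec_AssignI) (use k in auto)
  let ?n = "exp_cost (Var (k + 1)) s + (exp_cost (Join (Var k) (Join (Var (k + 1)) (Var (k + 2)))) s
      + 1 + (n1 + (size (f ?y) + 2 + (size (Node t u) + size u + 3)))) + n2"
  have "exec ?W s ?n s'"
    by (intro exec.WhileTrue[OF _ exec.Seq[OF e0 exec.Seq[OF s1(1) exec.Seq[OF e1 e2]]] s'(1)])
      (use t in simp)
  moreover have "?n \<le> (size (s (k + 1)) + 1) * ?K"
  proof -
    have "n1 \<le> poly pd (N + M + 2)" by (rule le_trans[OF s1(4) poly_mono_nat[OF sy]])
    then have "exp_cost (Var (k + 1)) s + (exp_cost (Join (Var k) (Join (Var (k + 1)) (Var (k + 2)))) s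
      + 1 + (n1 + (size (f ?y) + 2 + (size (Node t u) + size u + 3)))) \<le> ?K"
      using sx sa sfM t by simp
    moreover have "(size (s (k + 1)) + 1) * ?K \<ge> ?K + (size u + 1) * ?K"
      using t by (simp add: algebra_simps)
    ultimately show ?thesis using s'(4) by linarith
  qed
  moreover have "\<forall>j\<le>k. s' j = s j" using s'(3) s1(3) by auto
  moreover have "s' (k + 2) = fold_tree f (s k) (s (k + 1)) (s (k + 2))" using s'(2) t by simp
  ultimately show ?case by blast
qed

lemma poly_time_fold:
  assumes f: "poly_time f" and l: "poly_time l" and i: "poly_time i"
    and g: "\<And>x t a. size (f (Node x (Node t a))) \<le> size a + poly p (size x + size t)"
  shows "poly_time (\<lambda>x. fold_tree f x (l x) (i x))"
proof -
  obtain pl pi where pl: "\<And>x. size (l x) \<le> poly pl (size x)" and pi: "\<And>x. size (i x) \<le> poly pi (size x)"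
    using l i by (meson poly_time_sizeE)
  let ?N = "\<lambda>n. n + poly pl n"
  let ?M = "\<lambda>n. poly pi n + poly pl n * poly p (?N n)"
  have size: "size (fold_tree f x (l x) (i x)) \<le> ?M (size x)" for x
  proof -
    have "size (fold_tree f x (l x) (i x)) \<le> size (i x) + size (l x) * poly p (?N (size x))"
      by (rule fold_tree_size[OF g]) (simp add: pl)
    then show ?thesis using pl[of x] pi[of x]
      by (meson add_mono mult_le_mono1 order_trans)
  qed
  show ?thesis
  proof (rule poly_timeI[where b = ?M])
    fix k
    obtain c1 p1 where c1: "runs_in (k + 1) c1 l (poly p1)"
      by (rule poly_time_program[OF l])
    obtain c2 p2 where c2: "runs_in (k + 2) c2 i (poly p2)"
      by (rule poly_time_program[OF i])
    obtain d pd where d: "runs_in (k + 3) d f (poly pd)"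
      by (rule poly_time_program[OF f])
    let ?W = "While (Var (k + 1))
      (Seq (Assign (k + 3) (Join (Var k) (Join (Var (k + 1)) (Var (k + 2)))))
      (Seq d (Seq (Assign (k + 2) (Var (k + 3))) (Assign (k + 1) (Tl (Var (k + 1)))))))"
    let ?c = "Seq (Assign (k + 1) (Var k)) (Seq c1 (Seq (Assign (k + 2) (Var k)) (Seq c2 (Seq ?W
      (Assign k (Var (k + 2)))))))"
    let ?T = "\<lambda>n. (poly pl n + 1) * (10 * ?N n + 10 * ?M n + 100 + poly pd (?N n + ?M n + 2))"
    let ?t = "\<lambda>n. n + 2 + (poly p1 n + (n + 2 + (poly p2 n + (?T n + (?M n + 2)))))"
    have "runs_in k ?c (\<lambda>x. fold_tree f x (l x) (i x)) ?t"
      unfolding runs_in_def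
    proof
      fix s :: store
      let ?x = "s k" and ?s0 = "s(k + 1 := s k)"
      let ?r = "fold_tree f ?x (l ?x) (i ?x)"
      obtain n1 s1 where s1: "exec c1 ?s0 n1 s1" "s1 (k + 1) = l ?x" "\<forall>j<k+1. s1 j = ?s0 j"
          "n1 \<le> poly p1 (size ?x)"
        using runs_inD[OF c1, of ?s0] by auto
      let ?s1 = "s1(k + 2 := ?x)"
      obtain n2 s2 where s2: "exec c2 ?s1 n2 s2" "s2 (k + 2) = i ?x" "\<forall>j<k+2. s2 j = ?s1 j"
          "n2 \<le> poly p2 (size ?x)"
        using runs_inD[OF c2, of ?s1] by auto
      have k: "s1 k = ?x" "s2 k = ?x" "s2 (k + 1) = l ?x" using s1 s2 by auto
      have N: "size (s2 k) + size (s2 (k + 1)) \<le> ?N (size ?x)" using k pl by simp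
      have M: "size (s2 (k + 2)) + size (s2 (k + 1)) * poly p (?N (size ?x)) \<le> ?M (size ?x)"
        using k s2(2) pl[of ?x] pi[of ?x] by (simp add: add_mono)
      obtain n3 s3 where s3: "exec ?W s2 n3 s3" "s3 (k + 2) = ?r" "\<forall>j\<le>k. s3 j = s2 j"
        "n3 \<le> (size (s2 (k + 1)) + 1) *
           (10 * ?N (size ?x) + 10 * ?M (size ?x) + 100 + poly pd (?N (size ?x) + ?M (size ?x) + 2))"
        using exec_fold_loop[OF runs_inD[OF d] g N M] k s2(2) by metis
      have "n3 \<le> (size (l ?x) + 1) *
           (10 * ?N (size ?x) + 10 * ?M (size ?x) + 100 + poly pd (?N (size ?x) + ?M (size ?x) + 2))"
        using s3(4) unfolding k(3) .
      also have "\<dots> \<le> ?T (size ?x)"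
        by (intro mult_le_mono1 add_mono pl le_refl)
      finally have n3: "n3 \<le> ?T (size ?x)" .
      have e0: "exec (Assign (k + 1) (Var k)) s (size ?x + 2) ?s0"
        by (rule exec_AssignI) auto
      have e1: "exec (Assign (k + 2) (Var k)) s1 (size ?x + 2) ?s1"
        by (rule exec_AssignI) (use k in auto)
      have e2: "exec (Assign k (Var (k + 2))) s3 (size ?r + 2) (s3(k := ?r))"
        by (rule exec_AssignI) (use s3(2) in auto)
      have "exec ?c s (size ?x + 2 + (n1 + (size ?x + 2 + (n2 + (n3 + (size ?r + 2))))))
          (s3(k := ?r))"
        by (rule exec.Seq[OF e0 exec.Seq[OF s1(1) exec.Seq[OF e1 exec.Seq[OF s2(1) exec.Seq[OF s3(1) e2]]]]])
      moreover have "size ?x + 2 + (n1 + (size ?x + 2 + (n2 + (n3 + (size ?r + 2))))) \<le> ?t (size ?x)"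
        using s1(4) s2(4) n3 size[of ?x] by linarith
      moreover have "(s3(k := ?r)) k = ?r" "\<forall>j<k. (s3(k := ?r)) j = s j"
        using s1(3) s2(3) s3(3) by auto
      ultimately show "\<exists>n s'. exec ?c s n s' \<and> s' k = ?r \<and>
        (\<forall>j<k. s' j = s j) \<and> n \<le> ?t (size ?x)" by blast
    qed
    moreover have "poly_bounded ?t"
      by (intro poly_bounded_add poly_bounded_mult poly_bounded_poly_comp) auto
    ultimately show "\<exists>c t. poly_bounded t \<and> runs_in k c (\<lambda>x. fold_tree f x (l x) (i x)) t" by blast
  next
    show "poly_bounded ?M"
      by (intro poly_bounded_add poly_bounded_mult poly_bounded_poly_comp) auto
  qed (rule size)
qed


subsection \<open>Lists\<close>

text \<open>Every tree is the list of the left subtrees along its right spine, so this is a total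
  inverse of \<open>tree_of_list\<close> and no malformed lists arise.\<close>

fun elems :: "tree \<Rightarrow> tree list" where
  "elems Leaf = []"
| "elems (Node t u) = t # elems u"

lemma tree_of_list_simps [simp]:
  "tree_of_list [] = Leaf" "tree_of_list (t # ts) = Node t (tree_of_list ts)"
  by (simp_all add: tree_of_list_def)

lemma elems_tree_of_list [simp]: "elems (tree_of_list ts) = ts"
  by (induction ts) auto

lemma tree_of_list_elems [simp]: "tree_of_list (elems t) = t"
  by (induction t) auto

lemma tree_of_list_eq_iff [simp]: "tree_of_list ts = tree_of_list us \<longleftrightarrow> ts = us"
  by (metis elems_tree_of_list)

lemma left_tree_of_list: "ts \<noteq> [] \<Longrightarrow> left (tree_of_list ts) = hd ts"
  by (cases ts) auto

lemma elems_right: "elems (right t) = tl (elems t)"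
  by (cases t) auto

lemma size_tree_of_list_append:
  "size (tree_of_list (ts @ us)) = size (tree_of_list ts) + size (tree_of_list us)"
  by (induction ts) auto

lemma size_tree_of_list_rev: "size (tree_of_list (rev ts)) = size (tree_of_list ts)"
  by (induction ts) (auto simp: size_tree_of_list_append)

definition poly_time_list :: "(tree \<Rightarrow> tree list) \<Rightarrow> bool" where
  "poly_time_list l \<longleftrightarrow> poly_time (\<lambda>x. tree_of_list (l x))"

lemma poly_time_tree_of_list [poly_time_intros]: "poly_time_list l \<Longrightarrow> poly_time (\<lambda>x. tree_of_list (l x))"
  by (simp add: poly_time_list_def)

lemma poly_time_elems [poly_time_intros]: "poly_time f \<Longrightarrow> poly_time_list (\<lambda>x. elems (f x))"
  by (simp add: poly_time_list_def)

lemma poly_time_Nil [poly_time_intros]: "poly_time_list (\<lambda>x. [])"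
  by (simp add: poly_time_list_def poly_time_const)

lemma poly_time_Cons [poly_time_intros]: "poly_time f \<Longrightarrow> poly_time_list l \<Longrightarrow> poly_time_list (\<lambda>x. f x # l x)"
  by (simp add: poly_time_list_def poly_time_Node)

lemma poly_time_list_if [poly_time_intros]:
  "poly_time_test b \<Longrightarrow> poly_time_list f \<Longrightarrow> poly_time_list g \<Longrightarrow>
   poly_time_list (\<lambda>x. if b x then f x else g x)"
  unfolding poly_time_list_def if_distrib[of tree_of_list] by (rule poly_time_if)

lemma poly_time_tl [poly_time_intros]: "poly_time_list l \<Longrightarrow> poly_time_list (\<lambda>x. tl (l x))"
proof -
  assume l: "poly_time_list l"
  have "right (tree_of_list ts) = tree_of_list (tl ts)" for ts by (cases ts) auto
  with l show ?thesis
    using poly_time_right[of "\<lambda>x. tree_of_list (l x)"] by (simp add: poly_time_list_def)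
qed

lemma poly_time_list_fold:
  assumes "poly_time f" "poly_time_list l" "poly_time i"
    and "\<And>x t a. size (f (Node x (Node t a))) \<le> size a + poly p (size x + size t)"
    and "\<And>x. fold_tree f x (tree_of_list (l x)) (i x) = tree_of_list (r x)"
  shows "poly_time_list r"
  using poly_time_fold[OF assms(1) assms(2)[unfolded poly_time_list_def] assms(3,4)] assms(5)
  by (simp add: poly_time_list_def)

text \<open>A fold meets the head first, so consing onto the accumulator reverses. For
  \<open>tails\<close> and \<open>concat\<close> the reversed result is therefore computed and
  turned around afterwards.\<close>

lemma poly_time_rev_append:
  assumes "poly_time_list l" "poly_time_list m"
  shows "poly_time_list (\<lambda>x. rev (l x) @ m x)"
proof (rule poly_time_list_fold)
  let ?f = "\<lambda>z. Node (left (left (right z))) (right (right z))"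
  show "poly_time ?f" by (intro poly_time_intros)
  show "size (?f (Node x (Node t a))) \<le> size a + poly [:1, 1:] (size x + size t)" for x t a
    using size_left[of t] by simp
  show "fold_tree ?f x (tree_of_list (l x)) (tree_of_list (m x)) = tree_of_list (rev (l x) @ m x)" for x
  proof -
    have "fold_tree ?f x (tree_of_list ts) (tree_of_list us) = tree_of_list (rev ts @ us)" for ts us
    proof (induction ts arbitrary: us)
      case (Cons t ts)
      show ?case using Cons[of "t # us"] by simp
    qed simp
    then show ?thesis .
  qed
qed (intro poly_time_intros assms)+

lemma poly_time_rev [poly_time_intros]: "poly_time_list l \<Longrightarrow> poly_time_list (\<lambda>x. rev (l x))"
  using poly_time_rev_append[OF _ poly_time_Nil] by simp

lemma poly_time_append [poly_time_intros]:
  "poly_time_list l \<Longrightarrow> poly_time_list m \<Longrightarrow> poly_time_list (\<lambda>x. l x @ m x)"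
  using poly_time_rev_append[OF poly_time_rev] by simp

text \<open>A position in a list is represented by the suffix starting there. Such a suffix is
  itself a tree, and a map over suffixes sees each element together with its successors.\<close>

fun tails :: "tree list \<Rightarrow> tree list" where
  "tails [] = []"
| "tails (t # ts) = tree_of_list (t # ts) # tails ts"

lemma poly_time_tails [poly_time_intros]:
  assumes "poly_time_list l"
  shows "poly_time_list (\<lambda>x. tails (l x))"
proof -
  have "poly_time_list (\<lambda>x. rev (tails (l x)))"
  proof (rule poly_time_list_fold)
    let ?f = "right"
    show "poly_time ?f" by (intro poly_time_intros)
    show "size (?f (Node x (Node t a))) \<le> size a + poly [:1, 1:] (size x + size t)" for x t a
      by simp
    show "fold_tree ?f x (tree_of_list (l x)) Leaf = tree_of_list (rev (tails (l x)))" for x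
    proof -
      have "fold_tree ?f x (tree_of_list ts) (tree_of_list us) = tree_of_list (rev (tails ts) @ us)" for ts us
      proof (induction ts arbitrary: us)
        case (Cons t ts)
        show ?case using Cons[of "tree_of_list (t # ts) # us"] by simp
      qed simp
      from this[of _ "[]"] show ?thesis by simp
    qed
  qed (intro poly_time_intros assms)+
  from poly_time_rev[OF this] show ?thesis by simp
qed

text \<open>Functions of two arguments are programmed on pairs. Passing \<open>x\<close> along takes
  the place of closures: it makes the outer variables available inside, also in nested maps.\<close>

lemma poly_time_concat_map [poly_time_intros]:
  assumes "poly_time_list l" "poly_time_list (\<lambda>z. f (left z) (right z))"
  shows "poly_time_list (\<lambda>x. concat (map (f x) (l x)))"
proof -
  obtain p where p: "\<And>z. size (tree_of_list (f (left z) (right z))) \<le> poly p (size z)"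
    using assms(2) unfolding poly_time_list_def by (meson poly_time_sizeE)
  let ?g = "\<lambda>z. rev (f (left z) (left (left (right z)))) @ elems (right (right z))"
  let ?f = "\<lambda>z. tree_of_list (?g z)"
  have "poly_time_list (\<lambda>x. rev (concat (map (f x) (l x))))"
  proof (rule poly_time_list_fold)
    have "poly_time_list (\<lambda>z. f (left z) (left (left (right z))))"
      using poly_time_comp[OF assms(2)[unfolded poly_time_list_def],
        of "\<lambda>z. Node (left z) (left (left (right z)))"]
      unfolding poly_time_list_def by (simp add: poly_time_intros)
    then show "poly_time ?f" by (intro poly_time_intros)
    \<comment> \<open>Composition with \<open>[:1, 1:]\<close> accounts for the node that pairs
      \<open>x\<close> with the element.\<close>
    show "size (?f (Node x (Node t a))) \<le> size a + poly (pcompose p [:1, 1:]) (size x + size t)" for x t a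
    proof -
      have "size (tree_of_list (f x (left t))) \<le> poly p (size (Node x (left t)))"
        using p[of "Node x (left t)"] by simp
      also have "\<dots> \<le> poly p (1 + (size x + size t))"
        using size_left[of t] by (intro poly_mono_nat) simp
      finally show ?thesis by (simp add: size_tree_of_list_append size_tree_of_list_rev poly_pcompose)
    qed
    show "fold_tree ?f x (tree_of_list (l x)) Leaf = tree_of_list (rev (concat (map (f x) (l x))))" for x
    proof -
      have "fold_tree ?f x (tree_of_list ts) (tree_of_list us) =
          tree_of_list (rev (concat (map (f x) ts)) @ us)" for ts us
      proof (induction ts arbitrary: us)
        case (Cons t ts)
        show ?case using Cons[of "rev (f x t) @ us"] by simp
      qed simp
      from this[of _ "[]"] show ?thesis by simp
    qed
  qed (intro poly_time_intros assms)+
  from poly_time_rev[OF this] show ?thesis by simp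
qed

lemma poly_time_map [poly_time_intros]:
  assumes "poly_time_list l" "poly_time (\<lambda>z. f (left z) (right z))"
  shows "poly_time_list (\<lambda>x. map (f x) (l x))"
proof -
  have "poly_time_list (\<lambda>z. [f (left z) (right z)])"
    by (intro poly_time_intros assms(2))
  from poly_time_concat_map[OF assms(1), of "\<lambda>x a. [f x a]", OF this] show ?thesis
    by (simp add: map_eq_conv[symmetric] concat_map_singleton)
qed

lemma poly_time_filter [poly_time_intros]:
  assumes "poly_time_list l" "poly_time_test (\<lambda>z. b (left z) (right z))"
  shows "poly_time_list (\<lambda>x. filter (b x) (l x))"
proof -
  have "poly_time_list (\<lambda>z. if b (left z) (right z) then [right z] else [])"
    by (intro poly_time_intros assms(2))
  from poly_time_concat_map[OF assms(1), of "\<lambda>x a. if b x a then [a] else []", OF this]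
  have "poly_time_list (\<lambda>x. concat (map (\<lambda>a. if b x a then [a] else []) (l x)))" .
  moreover have "concat (map (\<lambda>a. if b x a then [a] else []) ts) = filter (b x) ts" for x ts
    by (induction ts) auto
  ultimately show ?thesis by simp
qed

lemma poly_time_test_null [poly_time_intros]:
  assumes "poly_time_list l"
  shows "poly_time_test (\<lambda>x. l x = [])"
proof -
  have "(\<lambda>x. l x = []) = (\<lambda>x. tree_of_list (l x) = Leaf)"
    by (metis tree_of_list_eq_iff tree_of_list_simps(1))
  then show ?thesis using poly_time_test_eq[OF poly_time_tree_of_list[OF assms] poly_time_const] by simp
qed

lemma poly_time_test_member [poly_time_intros]:
  assumes "poly_time f" "poly_time_list l"
  shows "poly_time_test (\<lambda>x. f x \<in> set (l x))"
proof -
  have "poly_time_test (\<lambda>x. \<not> filter (\<lambda>a. a = f x) (l x) = [])"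
    by (intro poly_time_intros assms poly_time_comp[OF assms(1), of left])
  moreover have "(\<lambda>x. f x \<in> set (l x)) = (\<lambda>x. \<not> filter (\<lambda>a. a = f x) (l x) = [])"
    by (auto simp: filter_empty_conv)
  ultimately show ?thesis by simp
qed

lemma poly_time_remdups [poly_time_intros]:
  assumes "poly_time_list l"
  shows "poly_time_list (\<lambda>x. remdups (l x))"
proof -
  let ?f = "\<lambda>x t. if left t \<in> set (elems (right t)) then [] else [left t]"
  have "poly_time_list (\<lambda>x. concat (map (?f x) (tails (l x))))"
    by (intro poly_time_intros assms)
  moreover have "concat (map (?f x) (tails ts)) = remdups ts" for x ts
    by (induction ts) auto
  ultimately show ?thesis by simp
qed

text \<open>Lengths are compared in unary, by shortening one list once per element of the other. The
  signs of balances are decided in this way later.\<close>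

lemma poly_time_drop_length:
  assumes "poly_time_list l" "poly_time_list m"
  shows "poly_time_list (\<lambda>x. drop (length (m x)) (l x))"
proof (rule poly_time_list_fold)
  let ?f = "\<lambda>z. right (right (right z))"
  show "poly_time ?f" by (intro poly_time_intros)
  show "size (?f (Node x (Node t a))) \<le> size a + poly 0 (size x + size t)" for x t a
    using size_right[of a] by simp
  show "fold_tree ?f x (tree_of_list (m x)) (tree_of_list (l x)) =
      tree_of_list (drop (length (m x)) (l x))" for x
  proof -
    have "fold_tree ?f x (tree_of_list ts) (tree_of_list us) = tree_of_list (drop (length ts) us)" for ts us
    proof (induction ts arbitrary: us)
      case (Cons t ts)
      show ?case using Cons[of "tl us"] by (cases us) (simp_all add: Cons[of "[]", simplified])
    qed simp
    then show ?thesis .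
  qed
qed (intro poly_time_intros assms)+

lemma poly_time_test_length_less [poly_time_intros]:
  assumes "poly_time_list l" "poly_time_list m"
  shows "poly_time_test (\<lambda>x. length (l x) < length (m x))"
proof -
  have "poly_time_test (\<lambda>x. \<not> drop (length (l x)) (m x) = [])"
    by (intro poly_time_test_not poly_time_test_null poly_time_drop_length assms)
  then show ?thesis by (simp add: not_le)
qed

section \<open>Balances and connectivity\<close>

text \<open>In-degree minus out-degree, written as a sum over arcs: it is additive in the multiset
  and refers neither to a vertex set nor to indexed copies of arcs.\<close>

definition net :: "('v \<times> 'v) multiset \<Rightarrow> 'v \<Rightarrow> int" where
  "net M v = (\<Sum>a\<in>#M. of_bool (snd a = v) - of_bool (fst a = v))"

lemma net_simps [simp]:
  "net {#} v = 0"
  "net (add_mset a M) v = of_bool (snd a = v) - of_bool (fst a = v) + net M v"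
  "net (M + N) v = net M v + net N v"
  by (simp_all add: net_def)

lemma net_sum: "net (\<Sum>i\<in>I. M i) v = (\<Sum>i\<in>I. net (M i) v)"
  by (induction I rule: infinite_finite_induct) auto

lemma net_eq_size: "net M v = int (size {#a \<in># M. snd a = v#}) - int (size {#a \<in># M. fst a = v#})"
  by (induction M) auto

lemma in_mset_if_less_count: "i < count A a \<Longrightarrow> a \<in># A"
  by (cases "a \<in># A") (auto simp: not_in_iff)

lemma card_indexed_arcs: "card {(a, i). i < count A a \<and> Q a} = size {#a \<in># A. Q a#}"
proof -
  have "{(a, i). i < count A a \<and> Q a} = (SIGMA a:set_mset {#a \<in># A. Q a#}. {..<count A a})"
    by (auto intro: in_mset_if_less_count)
  then have "card {(a, i). i < count A a \<and> Q a} = (\<Sum>a\<in>set_mset {#a \<in># A. Q a#}. count A a)"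
    by simp
  also have "\<dots> = (\<Sum>a\<in>set_mset {#a \<in># A. Q a#}. count {#a \<in># A. Q a#} a)"
    by (rule sum.cong) auto
  finally show ?thesis by (simp add: size_multiset_overloaded_eq)
qed

lemma degree_multigraph:
  "in_degree (multigraph V A) v = size {#a \<in># A. snd a = v#}"
  "out_degree (multigraph V A) v = size {#a \<in># A. fst a = v#}"
proof -
  have "in_arcs (multigraph V A) v = {(a, i). i < count A a \<and> snd a = v}"
    "out_arcs (multigraph V A) v = {(a, i). i < count A a \<and> fst a = v}"
    by (auto simp: in_arcs_def out_arcs_def multigraph_def)
  then show "in_degree (multigraph V A) v = size {#a \<in># A. snd a = v#}"
    "out_degree (multigraph V A) v = size {#a \<in># A. fst a = v#}"
    by (simp_all add: in_degree_def out_degree_def card_indexed_arcs)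
qed

lemma balance_eq_net: "balance V A v = net A v"
  by (simp add: balance_def degree_multigraph net_eq_size)

text \<open>Undirected connectivity by the arcs alone, as an equivalence on the whole type. Without
  a vertex set it is monotone in the multiset and easy to compare between graphs over different
  types.\<close>

definition linked :: "('v \<times> 'v) multiset \<Rightarrow> ('v \<times> 'v) set" where
  "linked M = (set_mset M \<union> (set_mset M)\<inverse>)\<^sup>*"

lemma linked_refl [simp]: "(x, x) \<in> linked M"
  by (simp add: linked_def)

lemma linked_trans: "(x, y) \<in> linked M \<Longrightarrow> (y, z) \<in> linked M \<Longrightarrow> (x, z) \<in> linked M"
  by (auto simp: linked_def)

lemma linked_sym: "(x, y) \<in> linked M \<Longrightarrow> (y, x) \<in> linked M"
proof -
  have "sym (set_mset M \<union> (set_mset M)\<inverse>)" by (auto simp: sym_def)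
  then show "(x, y) \<in> linked M \<Longrightarrow> (y, x) \<in> linked M"
    unfolding linked_def by (metis sym_rtrancl symD)
qed

lemma linked_arc: "(x, y) \<in># M \<Longrightarrow> (x, y) \<in> linked M"
  by (auto simp: linked_def)

text \<open>\<open>linked N\<close> is an equivalence, so it suffices to look at single arcs.
  Connectivity is carried between the old and the new graph in this way.\<close>

lemma linked_least:
  assumes "(x, y) \<in> linked M" "\<And>u v. (u, v) \<in># M \<Longrightarrow> (f u, f v) \<in> linked N"
  shows "(f x, f y) \<in> linked N"
  using assms(1) unfolding linked_def[of M]
proof (induction rule: rtrancl_induct)
  case (step y z)
  then have "(f y, f z) \<in> linked N" using assms(2) linked_sym by fastforce
  with step.IH show ?case by (rule linked_trans)
qed simp

lemma linked_mono: "M \<subseteq># N \<Longrightarrow> (x, y) \<in> linked M \<Longrightarrow> (x, y) \<in> linked N"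
  by (rule linked_least[where f = id, simplified]) (auto intro: linked_arc mset_subset_eqD)

lemma linked_cut:
  assumes "(x, y) \<in> linked M" "x \<in> S" "y \<notin> S"
  obtains u v where "(u, v) \<in># M" "u \<in> S \<longleftrightarrow> v \<notin> S"
proof -
  have "\<exists>u v. (u, v) \<in># M \<and> (u \<in> S \<longleftrightarrow> v \<notin> S)"
    using assms unfolding linked_def by (induction rule: rtrancl_induct) auto
  then show thesis using that by blast
qed

lemma linked_in:
  assumes "arcs_on V A" "(x, y) \<in> linked A" "x \<in> V"
  shows "y \<in> V"
proof (rule ccontr)
  assume "y \<notin> V"
  then obtain u v where "(u, v) \<in># A" "u \<in> V \<longleftrightarrow> v \<notin> V" by (rule linked_cut[OF assms(2,3)])
  then show False using assms(1) by (auto simp: arcs_on_def)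
qed

lemma fin_digraph_multigraph:
  assumes "finite V" "arcs_on V A"
  shows "fin_digraph (multigraph V A)"
proof
  have "{(a, i). i < count A a} = (SIGMA a:set_mset A. {..<count A a})"
    by (auto intro: in_mset_if_less_count)
  then show "finite (arcs (multigraph V A))" by (simp add: multigraph_def)
qed (use assms in \<open>auto simp: multigraph_def arcs_on_def
  dest!: in_mset_if_less_count\<close>)

lemma wf_digraph_multigraph: "arcs_on V A \<Longrightarrow> wf_digraph (multigraph V A)"
  by unfold_locales (auto simp: multigraph_def arcs_on_def
    dest!: in_mset_if_less_count)

text \<open>Reachability in the library is confined to the vertex set, \<open>linked\<close> is not;
  they agree because \<open>arcs_on\<close> keeps every undirected path from a vertex of
  \<open>V\<close> inside \<open>V\<close>.\<close>

lemma reachable_mk_symmetric_multigraph: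
  assumes "arcs_on V A"
  shows "u \<rightarrow>\<^sup>*\<^bsub>with_proj (mk_symmetric (multigraph V A))\<^esub> v \<longleftrightarrow> u \<in> V \<and> (u, v) \<in> linked A"
proof -
  have arcs: "arcs_ends (with_proj (mk_symmetric (multigraph V A))) = set_mset A \<union> (set_mset A)\<inverse>"
  proof -
    have "(\<Union>e\<in>arcs (multigraph V A). {(tail (multigraph V A) e, head (multigraph V A) e),
        (head (multigraph V A) e, tail (multigraph V A) e)}) = (\<Union>a\<in>set_mset A. {a, prod.swap a})"
    proof -
      let ?S = "{(a, i). i < count A a}"
      have "fst ` ?S = set_mset A"
      proof
        show "set_mset A \<subseteq> fst ` ?S"
          by (rule subsetI, rule image_eqI[where x = "(a, 0)" for a]) auto
      qed (auto intro: in_mset_if_less_count)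
      moreover have "(\<Union>e\<in>?S. {(fst (fst e), snd (fst e)), (snd (fst e), fst (fst e))}) =
          (\<Union>a\<in>fst ` ?S. {a, prod.swap a})"
        by (simp add: prod.swap_def)
      ultimately show ?thesis by (simp add: multigraph_def)
    qed
    also have "\<dots> = set_mset A \<union> (set_mset A)\<inverse>" by (auto simp: prod.swap_def)
    finally have "parcs (mk_symmetric (multigraph V A)) = set_mset A \<union> (set_mset A)\<inverse>"
      by (simp add: parcs_mk_symmetric)
    then show ?thesis by (simp add: arcs_ends_conv)
  qed
  have verts: "verts (with_proj (mk_symmetric (multigraph V A))) = V"
    by (simp add: multigraph_def)
  show ?thesis
  proof
    assume "u \<rightarrow>\<^sup>*\<^bsub>with_proj (mk_symmetric (multigraph V A))\<^esub> v"
    then show "u \<in> V \<and> (u, v) \<in> linked A"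
      unfolding reachable_def arcs verts linked_def
      by (auto dest: in_rtrancl_on_in_F rtrancl_on_rtranclI)
  next
    assume uv: "u \<in> V \<and> (u, v) \<in> linked A"
    then have "v \<in> V" using linked_in[OF assms] by blast
    with uv show "u \<rightarrow>\<^sup>*\<^bsub>with_proj (mk_symmetric (multigraph V A))\<^esub> v"
      unfolding reachable_def arcs verts linked_def
      by (intro rtrancl_consistent_rtrancl_on) (use assms in \<open>auto simp: arcs_on_def\<close>)
  qed
qed

text \<open>Euler's theorem replaces the closed trail by connectedness and balance, so that trails
  through a whole graph need not be constructed. Nonemptiness of \<open>V\<close> is part of
  connectedness in the library.\<close>

lemma eulerian_iff:
  assumes "finite V" "arcs_on V A"
  shows "eulerian V A \<longleftrightarrow> V \<noteq> {} \<and> V \<times> V \<subseteq> linked A \<and> (\<forall>v\<in>V. net A v = 0)"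
proof -
  interpret fin_digraph "multigraph V A" using assms by (rule fin_digraph_multigraph)
  have verts: "verts (multigraph V A) = V" by (simp add: multigraph_def)
  have "eulerian V A \<longleftrightarrow> connected (multigraph V A) \<and>
      (\<forall>u\<in>V. in_degree (multigraph V A) u = out_degree (multigraph V A) u)"
    unfolding eulerian_def closed_euler verts ..
  also have "connected (multigraph V A) \<longleftrightarrow> V \<noteq> {} \<and> V \<times> V \<subseteq> linked A"
    using verts by (auto simp: connected_def strongly_connected_def
        reachable_mk_symmetric_multigraph[OF assms(2)])
  finally show ?thesis by (auto simp: degree_multigraph net_eq_size)
qed

section \<open>Connected components\<close>

lemma component_of_eq:
  assumes "arcs_on V A" "v \<in> V"
  shows "component_of V A v = {u. (v, u) \<in> linked A}"
  using assms by (auto simp: component_of_def pre_digraph.scc_of_def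
      reachable_mk_symmetric_multigraph linked_in intro: linked_sym)

lemma components_eq:
  assumes "arcs_on V A"
  shows "components V A = component_of V A ` V"
proof -
  interpret wf_digraph "with_proj (mk_symmetric (multigraph V A))"
    using wf_digraph.wellformed_mk_symmetric[OF wf_digraph_multigraph[OF assms]]
    by (simp add: wf_digraph_wp_iff)
  show ?thesis
    unfolding components_def component_of_def sccs_verts_conv_scc_of by (simp add: multigraph_def)
qed

lemma component_of_eq_iff:
  assumes "arcs_on V A" "u \<in> V" "v \<in> V"
  shows "component_of V A u = component_of V A v \<longleftrightarrow> (u, v) \<in> linked A"
  using assms by (auto simp: component_of_eq intro: linked_sym linked_trans)

lemma in_component:
  assumes "arcs_on V A" "K \<in> components V A" "x \<in> K"
  shows "x \<in> V" "component_of V A x = K"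
proof -
  obtain v where v: "v \<in> V" "K = component_of V A v" using assms by (auto simp: components_eq)
  then have "(v, x) \<in> linked A" using assms by (simp add: component_of_eq)
  then show "x \<in> V" using linked_in[OF assms(1)] v by blast
  then show "component_of V A x = K"
    using component_of_eq_iff[OF assms(1)] v \<open>(v, x) \<in> linked A\<close> by metis
qed

lemma component_of_self: "arcs_on V A \<Longrightarrow> v \<in> V \<Longrightarrow> v \<in> component_of V A v"
  by (simp add: component_of_eq)

lemma component_of_in_components: "arcs_on V A \<Longrightarrow> v \<in> V \<Longrightarrow> component_of V A v \<in> components V A"
  by (simp add: components_eq)

lemma component_nonempty: "arcs_on V A \<Longrightarrow> K \<in> components V A \<Longrightarrow> K \<noteq> {}"
  using component_of_self[of V A] by (auto simp: components_eq)

subsection \<open>Walks and cuts\<close>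

lemma net_vwalk_arcs:
  "p \<noteq> [] \<Longrightarrow> net (mset (vwalk_arcs p)) v = of_bool (last p = v) - of_bool (hd p = v)"
  by (induction p rule: vwalk_arcs.induct) auto

lemma vwalk_arcs_map: "vwalk_arcs (map f p) = map (map_prod f f) (vwalk_arcs p)"
  by (induction p rule: vwalk_arcs.induct) auto

lemma set_vwalk_arcs_subset: "set (vwalk_arcs p) \<subseteq> set p \<times> set p"
  by (induction p rule: vwalk_arcs.induct) auto

lemma distinct_vwalk_arcs: "distinct p \<Longrightarrow> distinct (vwalk_arcs p)"
proof (induction p rule: vwalk_arcs.induct)
  case (3 y z p)
  then show ?case using set_vwalk_arcs_subset[of "z # p"] by auto
qed simp_all

lemma linked_vwalk:
  assumes "set (vwalk_arcs p) \<subseteq> linked M" "x \<in> set p"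
  shows "(hd p, x) \<in> linked M"
  using assms
proof (induction p rule: vwalk_arcs.induct)
  case (3 y z p)
  then show ?case using linked_trans[of y z M x] by auto
qed simp_all

text \<open>When the next vertex already lies on the path, the path is truncated there; this keeps
  it simple and its arcs in \<open>R\<close>.\<close>

lemma rtrancl_imp_path:
  assumes "(x, y) \<in> R\<^sup>*"
  shows "\<exists>p. p \<noteq> [] \<and> distinct p \<and> hd p = x \<and> last p = y \<and> set (vwalk_arcs p) \<subseteq> R"
  using assms
proof (induction rule: rtrancl_induct)
  case base
  show ?case by (rule exI[of _ "[x]"]) simp
next
  case (step y z)
  from step.IH obtain p where p: "p \<noteq> []" "distinct p" "hd p = x" "last p = y"
      "set (vwalk_arcs p) \<subseteq> R"
    by (elim exE conjE) (rule that)
  show ?case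
  proof (cases "z \<in> set p")
    case True
    from split_list[OF True] obtain q r where "p = q @ z # r" by (elim exE) (rule that)
    then have q: "p = (q @ [z]) @ r" by simp
    have "set (vwalk_arcs (q @ [z])) \<subseteq> R"
      using set_vwalk_arcs_append1[of "q @ [z]" r] p(5) unfolding q by (rule order_trans)
    moreover have "distinct (q @ [z])" "hd (q @ [z]) = x" using p q by (auto simp: hd_append)
    ultimately show ?thesis by (intro exI[of _ "q @ [z]"]) simp
  next
    case False
    have "set (vwalk_arcs (p @ [z])) \<subseteq> R"
      using p step.hyps(2) by (auto simp: vwalk_arcs_append)
    then show ?thesis using p False by (intro exI[of _ "p @ [z]"]) auto
  qed
qed

lemma sum_net:
  assumes "finite S"
  shows "(\<Sum>w\<in>S. net M w) = int (size {#a \<in># M. fst a \<notin> S \<and> snd a \<in> S#}) -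
    int (size {#a \<in># M. fst a \<in> S \<and> snd a \<notin> S#})"
proof (induction M)
  case (add a M)
  have "(\<Sum>w\<in>S. of_bool (snd a = w) - of_bool (fst a = w) :: int) =
      of_bool (snd a \<in> S) - of_bool (fst a \<in> S)"
    using assms by (simp add: sum_subtractf of_bool_def sum.delta)
  with add show ?case by (auto simp: sum.distrib)
qed simp

text \<open>Arcs inside \<open>S\<close> cancel in the sum of the balances, so equally many arcs
  enter and leave a finite set of balanced vertices. This is the flow conservation used for the
  chains.\<close>

lemma balanced_cut:
  assumes "finite S" "\<And>w. w \<in> S \<Longrightarrow> net M w = 0"
  shows "(\<exists>a\<in>#M. fst a \<notin> S \<and> snd a \<in> S) \<longleftrightarrow> (\<exists>a\<in>#M. fst a \<in> S \<and> snd a \<notin> S)"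
proof -
  have "size {#a \<in># M. fst a \<notin> S \<and> snd a \<in> S#} = size {#a \<in># M. fst a \<in> S \<and> snd a \<notin> S#}"
    using sum_net[OF assms(1), of M] assms(2) by simp
  then have *: "{#a \<in># M. fst a \<notin> S \<and> snd a \<in> S#} = {#} \<longleftrightarrow> {#a \<in># M. fst a \<in> S \<and> snd a \<notin> S#} = {#}"
    by (simp only: size_eq_0_iff_empty[symmetric])
  have **: "filter_mset P M = {#} \<longleftrightarrow> \<not> (\<exists>a\<in>#M. P a)" for P by (induction M) auto
  from * show ?thesis unfolding ** by blast
qed

text \<open>Identifying vertices adds up the balances over a fibre. The finite set \<open>D\<close>
  contains all end points, which makes this sum finite.\<close>

lemma net_image:
  assumes "finite D" "\<And>a. a \<in># M \<Longrightarrow> fst a \<in> D \<and> snd a \<in> D"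
  shows "net (image_mset (map_prod f f) M) v = (\<Sum>w\<in>{w\<in>D. f w = v}. net M w)"
  using assms(2)
proof (induction M)
  case (add a M)
  have *: "(\<Sum>w\<in>{w\<in>D. f w = v}. of_bool (u = w) :: int) = of_bool (f u = v)" if "u \<in> D" for u
    using assms(1) that by (simp add: of_bool_def sum.delta)
  have a: "fst a \<in> D" "snd a \<in> D" using add.prems by auto
  show ?case using add a by (simp add: sum.distrib sum_subtractf *)
qed simp

lemma net_filter_loops: "net {#a \<in># M. fst a \<noteq> snd a#} v = net M v"
  by (induction M) auto

lemma vwalk_full_digraph: "vwalk p (with_proj (full_digraph V)) \<longleftrightarrow> p \<noteq> [] \<and> set p \<subseteq> V"
proof -
  have "arcs_ends (with_proj (full_digraph V)) = V \<times> V"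
    by (simp add: full_digraph_def arcs_ends_conv)
  then show ?thesis
    using order_trans[OF set_vwalk_arcs_subset[of p] Sigma_mono[of "set p" V "\<lambda>_. set p" "\<lambda>_. V"]]
    by (auto simp: vwalk_def full_digraph_def)
qed

lemma set_vwalk_arcs_distinct_adj: "distinct_adj p \<longleftrightarrow> (\<forall>(x, y) \<in> set (vwalk_arcs p). x \<noteq> y)"
  by (induction p rule: vwalk_arcs.induct) auto

section \<open>Trails of the component graph\<close>

text \<open>The common shape of path hints and cycle hints that survives reversal and
  rotation.\<close>

definition component_walk :: "'v set \<Rightarrow> ('v \<times> 'v) multiset \<Rightarrow> 'v set list \<Rightarrow> bool" where
  "component_walk V A s \<longleftrightarrow> set s \<subseteq> components V A \<and> 2 \<le> length s \<and> distinct_adj s \<and>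
     (if closed_list s then distinct (tl s) else distinct s)"

text \<open>The part \<open>b\<close> before the repeated vertex is the cyclic word of a closed
  trail: changing the first vertex of the trail rotates \<open>b\<close>.\<close>

lemma closed_list_iff: "closed_list t \<longleftrightarrow> (\<exists>b. b \<noteq> [] \<and> t = b @ [hd b])"
proof
  assume t: "closed_list t"
  then obtain d x where d: "t = d @ [x]" "d \<noteq> []"
    by (cases t rule: rev_cases) (auto simp: closed_list_def Suc_le_eq)
  then have "hd d = x" using t by (simp add: closed_list_def)
  with d show "\<exists>b. b \<noteq> [] \<and> t = b @ [hd b]" by blast
next
  assume "\<exists>b. b \<noteq> [] \<and> t = b @ [hd b]"
  then obtain b where b: "b \<noteq> []" "t = b @ [hd b]" by blast
  then have "length b \<ge> 1" by (cases b) auto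
  with b show "closed_list t" by (simp add: closed_list_def)
qed

lemma closed_list_rev [simp]: "closed_list (rev t) \<longleftrightarrow> closed_list t"
  unfolding closed_list_def by (cases "t = []") (auto simp: hd_rev last_rev)

lemma tl_append_hd: "b \<noteq> [] \<Longrightarrow> tl (b @ [hd b]) = rotate1 b"
  by (cases b) auto

lemma same_trail_closed_iff:
  assumes "closed_list t"
  shows "same_trail t s \<longleftrightarrow> closed_list s \<and>
    (\<exists>n. butlast s = rotate n (butlast t) \<or> butlast s = rotate n (butlast (rev t)))"
proof
  assume "same_trail t s"
  then consider "s = t" | "s = rev t" | "closed_list s \<and>
    (\<exists>n. butlast s = rotate n (butlast t) \<or> butlast s = rotate n (butlast (rev t)))"
    by (auto simp: same_trail_def)
  then show "closed_list s \<and>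
    (\<exists>n. butlast s = rotate n (butlast t) \<or> butlast s = rotate n (butlast (rev t)))"
    using assms by cases (auto intro: exI[of _ 0])
qed (use assms in \<open>auto simp: same_trail_def\<close>)

lemma distinct_adj_append_hd:
  assumes "distinct b" "2 \<le> length b"
  shows "distinct_adj (b @ [hd b])"
proof -
  from assms(2) obtain x m y where b: "b = x # m @ [y]"
    by (cases b; cases "tl b" rule: rev_cases) auto
  then have "last b \<noteq> hd b" using assms(1) by auto
  moreover have "distinct_adj b"
    using assms(1) by (simp add: distinct_adj_altdef remdups_adj_distinct)
  ultimately show ?thesis by (simp add: distinct_adj_append_iff)
qed

lemma component_walk_closed_iff:
  assumes "b \<noteq> []"
  shows "component_walk V A (b @ [hd b]) \<longleftrightarrow> set b \<subseteq> components V A \<and> distinct b \<and> 2 \<le> length b"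
proof -
  have "closed_list (b @ [hd b])" using assms by (auto simp: closed_list_iff)
  moreover have "distinct (tl (b @ [hd b])) \<longleftrightarrow> distinct b" unfolding tl_append_hd[OF assms] by simp
  moreover have "distinct_adj (b @ [hd b]) \<Longrightarrow> 2 \<le> length b"
    using assms by (cases b; cases "tl b") auto
  moreover have "hd b \<in> set b" "length b \<ge> 1" using assms by (auto simp: Suc_le_eq)
  ultimately show ?thesis
    unfolding component_walk_def using distinct_adj_append_hd[of b] by auto
qed

lemma same_trail_component_walk:
  assumes "component_walk V A t" "same_trail t s"
  shows "component_walk V A s" "closed_list s \<longleftrightarrow> closed_list t" "set s = set t"
proof -
  have "component_walk V A s \<and> (closed_list s \<longleftrightarrow> closed_list t) \<and> set s = set t"
  proof (cases "closed_list t")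
    case True
    then obtain b where b: "b \<noteq> []" "t = b @ [hd b]" by (auto simp: closed_list_iff)
    from assms(2) True have s: "closed_list s"
      "\<exists>n. butlast s = rotate n (butlast t) \<or> butlast s = rotate n (butlast (rev t))"
      by (auto simp: same_trail_closed_iff)
    then obtain d where d: "d \<noteq> []" "s = d @ [hd d]" by (auto simp: closed_list_iff)
    have "butlast (rev t) = rev (rotate1 b)"
      unfolding b(2) butlast_rev by (simp only: rev_rev_ident tl_append_hd[OF b(1)])
    then have "\<exists>n. d = rotate n b \<or> d = rotate n (rev (rotate1 b))" using s(2) b d by simp
    then have "set d = set b" "distinct d = distinct b" "length d = length b" by auto
    then show ?thesis
      using assms(1) b d s(1) True component_walk_closed_iff[of b V A] component_walk_closed_iff[of d V A]
      by auto
  next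
    case False
    then have "s = t \<or> s = rev t" using assms(2) by (auto simp: same_trail_def)
    then show ?thesis using assms(1) False by (auto simp: component_walk_def)
  qed
  then show "component_walk V A s" "closed_list s \<longleftrightarrow> closed_list t" "set s = set t" by auto
qed

lemma vwalk_component_graph:
  assumes "vwalk t (with_proj (component_graph V A))"
  shows "set t \<subseteq> components V A" "distinct_adj t"
  using assms by (auto simp: vwalk_def component_graph_def arcs_ends_conv set_vwalk_arcs_distinct_adj)

lemma hint_on_component_walk:
  assumes "hint_on V A h"
  shows "component_walk V A (hint_trail h)"
  using assms unfolding hint_on_def
proof
  let ?t = "hint_trail h"
  assume t: "component_path V A ?t"
  then have "distinct ?t" "2 \<le> length ?t" by (auto simp: component_path_def vpath_def)
  moreover from this have "\<not> closed_list ?t"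
    by (cases ?t; cases "tl ?t" rule: rev_cases) (auto simp: closed_list_def)
  ultimately show ?thesis
    using t vwalk_component_graph[of ?t V A]
    by (auto simp: component_walk_def component_path_def vpath_def)
next
  let ?t = "hint_trail h"
  assume t: "component_cycle V A ?t"
  then show ?thesis
    using vwalk_component_graph[of ?t V A]
    by (auto simp: component_walk_def component_cycle_def)
qed

text \<open>
  A cycle can be rotated such that it leaves the component of its first vertex \<open>x\<close> at once.  Hence
  the first layer may be reduced to \<open>x\<close>, and paths from there to the copy of \<open>x\<close> in the last
  layer project to cycles without repeated vertices.
\<close>

fun fits :: "'v set \<Rightarrow> ('v \<times> 'v) multiset \<Rightarrow> 'v hint \<Rightarrow> 'v set list \<Rightarrow> 'v \<Rightarrow> 'v \<Rightarrow> bool" where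
  "fits V A (Path_Hint t) ls x y \<longleftrightarrow> same_trail t ls \<and> net A x > 0 \<and> net A y < 0"
| "fits V A (Cycle_Hint t) ls x y \<longleftrightarrow> (\<exists>s. same_trail t s \<and> x \<in> hd s \<and> ls = {x} # tl s) \<and> y = x"

text \<open>A common view of both kinds of hints: \<open>s\<close> is the traversed trail, and
  \<open>ls\<close> is \<open>s\<close> itself or, for a cycle hint, \<open>s\<close> with its first
  component shrunk to the start vertex.\<close>

lemma fits_trail:
  assumes "hint_on V A h" "fits V A h ls x y"
  obtains s where "same_trail (hint_trail h) s" "component_walk V A s" "length ls = length s"
    "tl ls = tl s" "\<And>i. i < length s \<Longrightarrow> ls ! i \<subseteq> s ! i"
    "is_Path_Hint h \<Longrightarrow> ls = s" "\<not> is_Path_Hint h \<Longrightarrow> ls = {x} # tl s \<and> y = x"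
proof (cases h)
  case (Path_Hint t)
  then have "same_trail (hint_trail h) ls" using assms(2) by simp
  from this same_trail_component_walk(1)[OF hint_on_component_walk[OF assms(1)] this]
  show thesis by (rule that) (use Path_Hint in auto)
next
  case (Cycle_Hint t)
  then obtain s where s: "same_trail t s" "x \<in> hd s" "ls = {x} # tl s" "y = x" using assms(2) by auto
  have w: "component_walk V A s"
    using same_trail_component_walk(1)[OF hint_on_component_walk[OF assms(1)]] s(1) Cycle_Hint by simp
  then obtain K s' where "s = K # s'" by (cases s) (auto simp: component_walk_def)
  then have "ls ! i \<subseteq> s ! i" for i using s by (cases i) auto
  with w show thesis using that[of s] s Cycle_Hint \<open>s = K # s'\<close> by auto
qed

section \<open>The gadgets\<close>

text \<open>The new vertices are kept abstract and described only by \<open>orig\<close>,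
  \<open>hub\<close>, \<open>copy\<close> and the projection \<open>proj\<close>. A copy determines
  its layer index only below the number of layers, since the encoding represents an index by a
  suffix, and all indices beyond the end share the empty one.\<close>

locale hint_gadgets =
  fixes V :: "'v set" and A :: "('v \<times> 'v) multiset" and w :: "'v \<times> 'v \<Rightarrow> ereal"
    and H :: "'k set" and hint :: "'k \<Rightarrow> 'v hint"
    and C :: "'c set" and owner :: "'c \<Rightarrow> 'k" and layers :: "'c \<Rightarrow> 'v set list"
    and src tgt :: "'c \<Rightarrow> 'v"
    and orig :: "'v \<Rightarrow> 'w" and hub :: "'k \<Rightarrow> 'w" and copy :: "'c \<Rightarrow> nat \<Rightarrow> 'v \<Rightarrow> 'w"
    and proj :: "'w \<Rightarrow> 'v" and w' :: "'w \<times> 'w \<Rightarrow> ereal"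
  assumes finite_V: "finite V" and arcs_A: "arcs_on V A"
    and finite_H: "finite H" and finite_C: "finite C"
    and advice: "advice_on V A (hint ` H)" and inj_hint: "inj_on hint H"
    and w_nonneg: "a \<in> V \<times> V \<Longrightarrow> 0 \<le> w a"
    and chain: "c \<in> C \<Longrightarrow> owner c \<in> H \<and> fits V A (hint (owner c)) (layers c) (src c) (tgt c)"
    and chain_exists: "k \<in> H \<Longrightarrow> fits V A (hint k) ls x y \<Longrightarrow> x \<in> V \<Longrightarrow> y \<in> V \<Longrightarrow>
      \<exists>c\<in>C. owner c = k \<and> layers c = ls \<and> src c = x \<and> tgt c = y"
    and proj_orig [simp]: "proj (orig x) = x"
    and proj_copy [simp]: "proj (copy c i x) = x"
    and inj_hub: "inj_on hub H"
    and hub_neq_orig: "k \<in> H \<Longrightarrow> hub k \<noteq> orig x"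
    and copy_neq_orig: "c \<in> C \<Longrightarrow> copy c i x \<noteq> orig y"
    and copy_neq_hub: "c \<in> C \<Longrightarrow> k \<in> H \<Longrightarrow> copy c i x \<noteq> hub k"
    and copy_eq: "c \<in> C \<Longrightarrow> d \<in> C \<Longrightarrow> i < length (layers c) \<Longrightarrow> j < length (layers d) \<Longrightarrow>
      copy c i x = copy d j y \<Longrightarrow> c = d \<and> i = j"
begin

definition cells :: "('c \<times> nat \<times> 'v) set" where
  "cells = {(c, i, x). c \<in> C \<and> i < length (layers c) \<and> x \<in> layers c ! i}"

definition copies :: "'w set" where
  "copies = (\<lambda>(c, i, x). copy c i x) ` cells"

definition new_verts :: "'w set" where
  "new_verts = orig ` V \<union> hub ` H \<union> copies"

fun anchor :: "'c \<times> nat \<times> 'v \<Rightarrow> 'w" where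
  "anchor (c, i, x) = (if i = 0 then hub (owner c) else orig x)"

definition ties :: "('w \<times> 'w) multiset" where
  "ties = (\<Sum>(c, i, x)\<in>cells.
     {#(copy c i x, anchor (c, i, x)), (anchor (c, i, x), copy c i x)#})"

definition new_arcs :: "('w \<times> 'w) multiset" where
  "new_arcs = image_mset (map_prod orig orig) A + ties"

definition inner :: "'c \<Rightarrow> ('w \<times> 'w) set" where
  "inner c = {(copy c i x, copy c j y) | i x j y.
     (c, i, x) \<in> cells \<and> (c, j, y) \<in> cells \<and> (j = i \<or> j = Suc i)}"

text \<open>The pairs that may have finite weight. No hub occurs in them, so in an extension of
  finite weight a hub is attached to the rest by ties alone.\<close>

inductive_set links :: "('w \<times> 'w) set" where
  original: "x \<in> V \<Longrightarrow> y \<in> V \<Longrightarrow> (orig x, orig y) \<in> links"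
| entry: "(c, 0, src c) \<in> cells \<Longrightarrow> (orig (src c), copy c 0 (src c)) \<in> links"
| exit: "(c, i, tgt c) \<in> cells \<Longrightarrow> Suc i = length (layers c) \<Longrightarrow>
    (copy c i (tgt c), orig (tgt c)) \<in> links"
| inner: "c \<in> C \<Longrightarrow> a \<in> inner c \<Longrightarrow> a \<in> links"

end

text \<open>The conditions on \<open>w'\<close> form a second locale because they speak of sets
  defined in the first.\<close>

locale weighted_hint_gadgets = hint_gadgets V A w H hint C owner layers src tgt orig hub copy proj w'
  for V :: "'v set" and A w and H :: "'k set" and hint and C :: "'c set" and owner layers src tgt
    and orig :: "'v \<Rightarrow> 'w" and hub copy proj w' +
  assumes w'_infinite: "a \<in> new_verts \<times> new_verts \<Longrightarrow> a \<notin> links \<Longrightarrow> w' a = \<infinity>"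
    and w'_original: "x \<in> V \<Longrightarrow> y \<in> V \<Longrightarrow> w' (orig x, orig y) = w (x, y)"
    and w'_entry: "(c, 0, src c) \<in> cells \<Longrightarrow> w' (orig (src c), copy c 0 (src c)) = 0"
    and w'_exit: "(c, i, tgt c) \<in> cells \<Longrightarrow> Suc i = length (layers c) \<Longrightarrow>
      w' (copy c i (tgt c), orig (tgt c)) = 0"
    and w'_inner: "c \<in> C \<Longrightarrow> (z, z') \<in> inner c \<Longrightarrow> w' (z, z') = w (proj z, proj z')"

context hint_gadgets
begin

section \<open>Elementary properties of the new graph\<close>

lemma orig_eq_iff [simp]: "orig x = orig y \<longleftrightarrow> x = y"
  by (metis proj_orig)

lemma hint_ok: "k \<in> H \<Longrightarrow> hint_on V A (hint k)"
  using advice by (auto simp: advice_on_def)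

text \<open>For a cycle hint the first layer is a single vertex; here its whole component is
  restored, so that the components of consecutive layers can be compared.\<close>

definition trail :: "'c \<Rightarrow> 'v set list" where
  "trail c = (SOME s. same_trail (hint_trail (hint (owner c))) s \<and> component_walk V A s \<and>
     length (layers c) = length s \<and> tl (layers c) = tl s \<and>
     (\<forall>i<length s. layers c ! i \<subseteq> s ! i) \<and>
     (is_Path_Hint (hint (owner c)) \<longrightarrow> layers c = s) \<and>
     (\<not> is_Path_Hint (hint (owner c)) \<longrightarrow> layers c = {src c} # tl s \<and> tgt c = src c))"

lemma trail:
  assumes "c \<in> C"
  shows "same_trail (hint_trail (hint (owner c))) (trail c)" "component_walk V A (trail c)"
    "length (layers c) = length (trail c)" "tl (layers c) = tl (trail c)"
    "i < length (trail c) \<Longrightarrow> layers c ! i \<subseteq> trail c ! i"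
    "is_Path_Hint (hint (owner c)) \<Longrightarrow> layers c = trail c"
    "\<not> is_Path_Hint (hint (owner c)) \<Longrightarrow> layers c = {src c} # tl (trail c) \<and> tgt c = src c"
proof -
  have "\<exists>s. same_trail (hint_trail (hint (owner c))) s \<and> component_walk V A s \<and>
     length (layers c) = length s \<and> tl (layers c) = tl s \<and>
     (\<forall>i<length s. layers c ! i \<subseteq> s ! i) \<and>
     (is_Path_Hint (hint (owner c)) \<longrightarrow> layers c = s) \<and>
     (\<not> is_Path_Hint (hint (owner c)) \<longrightarrow> layers c = {src c} # tl s \<and> tgt c = src c)"
    using chain[OF assms] hint_ok by (elim conjE fits_trail[rotated]) blast+
  from someI_ex[OF this, folded trail_def]
  show "same_trail (hint_trail (hint (owner c))) (trail c)" "component_walk V A (trail c)"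
    "length (layers c) = length (trail c)" "tl (layers c) = tl (trail c)"
    "i < length (trail c) \<Longrightarrow> layers c ! i \<subseteq> trail c ! i"
    "is_Path_Hint (hint (owner c)) \<Longrightarrow> layers c = trail c"
    "\<not> is_Path_Hint (hint (owner c)) \<Longrightarrow> layers c = {src c} # tl (trail c) \<and> tgt c = src c"
    by blast+
qed

lemma cells_D: "(c, i, x) \<in> cells \<Longrightarrow> c \<in> C \<and> i < length (layers c) \<and> x \<in> layers c ! i"
  by (simp add: cells_def)

lemma trail_components: "c \<in> C \<Longrightarrow> i < length (trail c) \<Longrightarrow> trail c ! i \<in> components V A"
  using trail(2)[of c] by (auto simp: component_walk_def)

lemma cells_trail:
  assumes "(c, i, x) \<in> cells"
  shows "i < length (trail c)" "x \<in> trail c ! i" "component_of V A x = trail c ! i" "x \<in> V"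
proof -
  have c: "c \<in> C" "i < length (trail c)" "x \<in> layers c ! i"
    using cells_D[OF assms] trail(3) by auto
  then show i: "i < length (trail c)" "x \<in> trail c ! i" using trail(5)[OF c(1,2)] by auto
  show "component_of V A x = trail c ! i" "x \<in> V"
    using in_component[OF arcs_A trail_components[OF c(1) i(1)] i(2)] by auto
qed

lemmas cells_V = cells_trail(4)

lemma finite_cells: "finite cells"
proof (rule finite_subset)
  show "cells \<subseteq> (SIGMA c:C. {..<length (layers c)} \<times> V)"
    using cells_V by (auto simp: cells_def)
  show "finite (SIGMA c:C. {..<length (layers c)} \<times> V)"
    using finite_C finite_V by auto
qed

lemma new_verts_cases:
  assumes "z \<in> new_verts"
  obtains (orig) x where "x \<in> V" "z = orig x" | (hub) k where "k \<in> H" "z = hub k"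
    | (copy) c i x where "(c, i, x) \<in> cells" "z = copy c i x"
  using assms by (auto simp: new_verts_def copies_def)

lemma finite_new_verts: "finite new_verts"
  using finite_cells finite_V finite_H by (auto simp: new_verts_def copies_def)

lemma copy_in_new_verts: "(c, i, x) \<in> cells \<Longrightarrow> copy c i x \<in> new_verts"
  by (force simp: new_verts_def copies_def)

lemma copy_eq_iff:
  assumes "(c, i, x) \<in> cells" "(d, j, y) \<in> cells"
  shows "copy c i x = copy d j y \<longleftrightarrow> c = d \<and> i = j \<and> x = y"
proof
  assume *: "copy c i x = copy d j y"
  have "x = y" using arg_cong[OF *, of proj] by simp
  moreover have "c = d \<and> i = j" using copy_eq[OF _ _ _ _ *] assms by (simp add: cells_def)
  ultimately show "c = d \<and> i = j \<and> x = y" by simp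
qed simp

lemma anchor_cases:
  assumes "(c, i, x) \<in> cells"
  shows "anchor (c, i, x) \<in> new_verts" "copy c i x \<noteq> anchor (c, i, x)"
proof -
  have c: "c \<in> C" "owner c \<in> H" "x \<in> V" using assms cells_V chain by (auto simp: cells_def)
  then show "anchor (c, i, x) \<in> new_verts" by (auto simp: new_verts_def)
  show "copy c i x \<noteq> anchor (c, i, x)"
    using copy_neq_orig[OF c(1)] copy_neq_hub[OF c(1,2)] by auto
qed

lemma in_ties:
  "(a, b) \<in># ties \<longleftrightarrow> (\<exists>c i x. (c, i, x) \<in> cells \<and>
     ((a, b) = (copy c i x, anchor (c, i, x)) \<or> (a, b) = (anchor (c, i, x), copy c i x)))"
proof -
  have "e \<in># (\<Sum>z\<in>cells. g z) \<longleftrightarrow> (\<exists>z\<in>cells. e \<in># g z)"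
    for e and g :: "'c \<times> nat \<times> 'v \<Rightarrow> ('w \<times> 'w) multiset"
    using finite_cells by (simp add: set_mset_sum)
  then show ?thesis
    unfolding ties_def by (simp add: Bex_def del: anchor.simps)
qed

lemma net_ties: "net ties v = 0"
proof -
  have "net ties v = (\<Sum>z\<in>cells. 0)"
    unfolding ties_def net_sum by (rule sum.cong) (auto split: prod.splits)
  then show ?thesis by simp
qed

lemma arcs_on_new: "arcs_on new_verts new_arcs"
proof -
  have "a \<in> new_verts \<and> b \<in> new_verts \<and> a \<noteq> b" if "(a, b) \<in># new_arcs" for a b
  proof (cases "(a, b) \<in># ties")
    case True
    then obtain c i x where *: "(c, i, x) \<in> cells"
      "(a, b) = (copy c i x, anchor (c, i, x)) \<or> (a, b) = (anchor (c, i, x), copy c i x)"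
      unfolding in_ties by blast
    from *(2) show ?thesis
      using anchor_cases[OF *(1)] copy_in_new_verts[OF *(1)] by (auto simp del: anchor.simps)
  next
    case False
    with that obtain x y where "(x, y) \<in># A" "a = orig x" "b = orig y"
      by (auto simp: new_arcs_def)
    then show ?thesis using arcs_A by (auto simp: arcs_on_def new_verts_def)
  qed
  then show ?thesis by (auto simp: arcs_on_def)
qed

lemma net_image_orig: "net (image_mset (map_prod orig orig) M) (orig x) = net M x"
  by (induction M) auto

lemma net_image_orig_other:
  "(\<And>x. z \<noteq> orig x) \<Longrightarrow> net (image_mset (map_prod orig orig) M) z = 0"
  by (induction M) auto

lemma net_new_arcs_orig: "net new_arcs (orig x) = net A x"
  by (simp add: new_arcs_def net_ties net_image_orig)

lemma net_new_arcs_other: "(\<And>x. z \<noteq> orig x) \<Longrightarrow> net new_arcs z = 0"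
  by (simp add: new_arcs_def net_ties net_image_orig_other)

lemma linked_anchor: "(c, i, x) \<in> cells \<Longrightarrow> (copy c i x, anchor (c, i, x)) \<in> linked new_arcs"
  by (intro linked_arc) (auto simp: new_arcs_def in_ties simp del: anchor.simps)

lemma linked_orig: "(x, y) \<in> linked A \<Longrightarrow> (orig x, orig y) \<in> linked new_arcs"
proof (erule linked_least)
  fix u v assume "(u, v) \<in># A"
  then have "map_prod orig orig (u, v) \<in># image_mset (map_prod orig orig) A"
    by (metis image_eqI set_image_mset)
  then show "(orig u, orig v) \<in> linked new_arcs" by (intro linked_arc) (simp add: new_arcs_def)
qed

text \<open>Every component contains an original vertex or a hub.\<close>

lemma card_components_new:
  "card (components new_verts new_arcs) \<le> card (components V A) + card H"
proof -
  let ?K = "component_of new_verts new_arcs"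
  have comp: "?K a = ?K b" if "a \<in> new_verts" "b \<in> new_verts" "(a, b) \<in> linked new_arcs" for a b
    using component_of_eq_iff[OF arcs_on_new] that by blast
  \<comment> \<open>Vertices of one old component lie in one new component, so the choice of the
    representative does not affect the new component.\<close>
  define rep where "rep K = orig (SOME x. x \<in> K)" for K
  have "components new_verts new_arcs \<subseteq> (?K \<circ> rep) ` components V A \<union> (?K \<circ> hub) ` H"
  proof
    fix K assume "K \<in> components new_verts new_arcs"
    then obtain z where z: "z \<in> new_verts" "K = ?K z" using components_eq[OF arcs_on_new] by auto
    have orig: "?K (orig x) \<in> (?K \<circ> rep) ` components V A" if "x \<in> V" for x
    proof -
      let ?L = "component_of V A x"
      have L: "?L \<in> components V A" using component_of_in_components[OF arcs_A that] .
      have "(SOME x. x \<in> ?L) \<in> ?L" using component_of_self[OF arcs_A that] by (rule someI)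
      then have "(SOME x. x \<in> ?L) \<in> V" "(x, SOME x. x \<in> ?L) \<in> linked A"
        using in_component(1)[OF arcs_A L] component_of_eq[OF arcs_A that] by auto
      then have "?K (orig x) = ?K (rep ?L)"
        unfolding rep_def using that by (intro comp linked_orig) (auto simp: new_verts_def)
      then show ?thesis using L by auto
    qed
    have hub: "?K (hub k) \<in> (?K \<circ> hub) ` H" if "k \<in> H" for k using that by auto
    consider x where "x \<in> V" "z = orig x" | k where "k \<in> H" "z = hub k"
      | c i x where "(c, i, x) \<in> cells" "z = copy c i x"
      using z(1) by (auto simp: new_verts_def copies_def)
    then show "K \<in> (?K \<circ> rep) ` components V A \<union> (?K \<circ> hub) ` H"
    proof cases
      case (3 c i x)
      then have "K = ?K (anchor (c, i, x))"
        using z comp linked_anchor[OF 3(1)] anchor_cases(1)[OF 3(1)] by blast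
      moreover have "x \<in> V" "owner c \<in> H" using 3 cells_V chain by (auto simp: cells_def)
      ultimately show ?thesis using orig[of x] hub[of "owner c"] by (cases "i = 0") auto
    qed (use z orig hub in auto)
  qed
  moreover have "finite (components V A)"
    using finite_V components_eq[OF arcs_A] by simp
  ultimately have "card (components new_verts new_arcs) \<le>
      card ((?K \<circ> rep) ` components V A \<union> (?K \<circ> hub) ` H)"
    using finite_H by (intro card_mono) auto
  also have "\<dots> \<le> card ((?K \<circ> rep) ` components V A) + card ((?K \<circ> hub) ` H)"
    by (rule card_Un_le)
  also have "\<dots> \<le> card (components V A) + card H"
    using \<open>finite (components V A)\<close> finite_H by (intro add_mono card_image_le)
  finally show ?thesis .
qed

text \<open>Edge-disjoint hints differ in their first edges.\<close>

lemma card_hints: "card H \<le> card (components V A) * card (components V A)"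
proof -
  let ?f = "\<lambda>k. (hint_trail (hint k) ! 0, hint_trail (hint k) ! 1)"
  have walk: "component_walk V A (hint_trail (hint k))" if "k \<in> H" for k
    using hint_on_component_walk[OF hint_ok[OF that]] .
  have "inj_on ?f H"
  proof (rule inj_onI)
    fix k l assume kl: "k \<in> H" "l \<in> H" "?f k = ?f l"
    obtain a b r where k: "hint_trail (hint k) = a # b # r"
      using walk[OF kl(1)] by (auto simp: component_walk_def Suc_le_length_iff numeral_2_eq_2)
    obtain a' b' r' where l: "hint_trail (hint l) = a' # b' # r'"
      using walk[OF kl(2)] by (auto simp: component_walk_def Suc_le_length_iff numeral_2_eq_2)
    have "{a, b} \<in> undirected_edges (hint_trail (hint k)) \<inter> undirected_edges (hint_trail (hint l))"
      using kl(3) k l by (auto simp: undirected_edges_def)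
    then have "hint k = hint l"
      using advice kl(1,2) by (auto simp: advice_on_def pairwise_def)
    then show "k = l" using inj_hint kl by (auto dest: inj_onD)
  qed
  moreover have "?f ` H \<subseteq> components V A \<times> components V A"
  proof
    fix z assume "z \<in> ?f ` H"
    then obtain k where k: "k \<in> H" "z = ?f k" by blast
    with walk[OF k(1)] show "z \<in> components V A \<times> components V A"
      by (auto simp: component_walk_def Suc_le_length_iff numeral_2_eq_2)
  qed
  moreover have "finite (components V A)"
    using finite_V components_eq[OF arcs_A] by simp
  ultimately have "card H \<le> card (components V A \<times> components V A)"
    by (intro card_inj_on_le) auto
  then show ?thesis by (simp add: card_cartesian_product)
qed

end

subsection \<open>Lifting a realization\<close>

text \<open>Labels each vertex of a walk with its position in the trail of components: the label
  advances exactly where \<open>remdups_adj\<close> of the images keeps a new entry.\<close>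

fun levels :: "('v \<Rightarrow> 'a) \<Rightarrow> nat \<Rightarrow> 'v list \<Rightarrow> (nat \<times> 'v) list" where
  "levels f i [] = []"
| "levels f i [x] = [(i, x)]"
| "levels f i (x # y # p) = (i, x) # levels f (if f x = f y then i else Suc i) (y # p)"

lemma map_snd_levels [simp]: "map snd (levels f i p) = p"
  by (induction f i p rule: levels.induct) auto

lemma levels_eq_Nil_iff [simp]: "levels f i p = [] \<longleftrightarrow> p = []"
  by (metis map_is_Nil_conv map_snd_levels)

lemma hd_levels: "p \<noteq> [] \<Longrightarrow> hd (levels f i p) = (i, hd p)"
  by (induction f i p rule: levels.induct) auto

lemma levels_step:
  "((j, x), (j', y)) \<in> set (vwalk_arcs (levels f i p)) \<Longrightarrow> j' = j \<or> j' = Suc j"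
  by (induction f i p rule: levels.induct) (auto simp: hd_levels split: if_splits)

text \<open>Formulated for a suffix of the trail \<open>s\<close>, as the induction along the walk
  continues from layer \<open>i\<close>.\<close>

lemma levels_drop:
  assumes "remdups_adj (map f p) = drop i s" "p \<noteq> []"
  shows "last (levels f i p) = (length s - 1, last p)"
    and "(j, x) \<in> set (levels f i p) \<Longrightarrow> i \<le> j \<and> j < length s \<and> f x = s ! j"
proof -
  have "last (levels f i p) = (length s - 1, last p) \<and>
      (\<forall>(j, x) \<in> set (levels f i p). i \<le> j \<and> j < length s \<and> f x = s ! j)"
    using assms
  proof (induction f i p rule: levels.induct)
    case (2 f i x)
    then have "drop i s = [f x]" by simp
    moreover from this have "i < length s" by (metis drop_eq_Nil2 leI list.distinct(1))
    ultimately have "drop (Suc i) s = []" "s ! i = f x"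
      by (metis Cons_nth_drop_Suc list.inject)+
    with \<open>i < length s\<close> show ?case by simp
  next
    case (3 f i x y p)
    have i: "i < length s" using 3(2) by (metis drop_eq_Nil2 leI list.simps(9) remdups_adj_Nil_iff list.distinct(1))
    then have d: "drop i s = s ! i # drop (Suc i) s" by (simp add: Cons_nth_drop_Suc)
    have h: "s ! i = f x"
      using arg_cong[OF 3(2), of hd] unfolding d hd_remdups_adj by simp
    show ?case
    proof (cases "f x = f y")
      case True
      then have "remdups_adj (map f (y # p)) = drop i s" using 3(2) by simp
      with 3(1) True i h show ?thesis by auto
    next
      case False
      then have "remdups_adj (map f (y # p)) = drop (Suc i) s" using 3(2) d by simp
      with 3(1) False i h show ?thesis by fastforce
    qed
  qed simp
  then show "last (levels f i p) = (length s - 1, last p)"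
    "(j, x) \<in> set (levels f i p) \<Longrightarrow> i \<le> j \<and> j < length s \<and> f x = s ! j" by auto
qed

lemma total_weight_simps [simp]:
  "total_weight w {#} = 0"
  "total_weight w (add_mset a M) = w a + total_weight w M"
  "total_weight w (M + N) = total_weight w M + total_weight w N"
  by (simp_all add: total_weight_def)

lemma total_weight_sum: "total_weight w (\<Sum>i\<in>I. M i) = (\<Sum>i\<in>I. total_weight w (M i))"
  by (induction I rule: infinite_finite_induct) auto

lemma total_weight_image: "total_weight w (image_mset f M) = total_weight (w \<circ> f) M"
  by (induction M) auto

lemma total_weight_cong: "(\<And>a. a \<in># M \<Longrightarrow> w a = w' a) \<Longrightarrow> total_weight w M = total_weight w' M"
  by (induction M) auto

lemma remdups_adj_append_const:
  assumes "xs \<noteq> []" "\<And>y. y \<in> set ys \<Longrightarrow> y = last xs"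
  shows "remdups_adj (xs @ ys) = remdups_adj xs"
  using assms(2)
proof (induction ys rule: rev_induct)
  case (snoc y ys)
  then have "last (xs @ ys) = y" by (cases ys rule: rev_cases) auto
  then have "remdups_adj ((xs @ ys) @ [y]) = remdups_adj (xs @ ys)"
    using assms(1) by (subst remdups_adj_append'') auto
  with snoc show ?case by simp
qed simp

lemma remdups_adj_const_append:
  assumes "ys \<noteq> []" "\<And>x. x \<in> set xs \<Longrightarrow> x = hd ys"
  shows "remdups_adj (xs @ ys) = remdups_adj ys"
proof -
  have "remdups_adj (rev ys @ rev xs) = remdups_adj (rev ys)"
    using assms by (intro remdups_adj_append_const) (auto simp: last_rev)
  then have "rev (remdups_adj (rev (xs @ ys))) = rev (remdups_adj (rev ys))" by simp
  then show ?thesis by (simp only: remdups_adj_rev rev_rev_ident)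
qed

context weighted_hint_gadgets
begin

abbreviation comp_of :: "'v \<Rightarrow> 'v set" where
  "comp_of \<equiv> component_of V A"

text \<open>A walk that can be lifted into the chain \<open>c\<close>. The condition on
  \<open>levels\<close> confines the first segment of a cycle to \<open>src c\<close>, which the
  equation on components does not imply; \<open>distinct_adj\<close> keeps the lift free of
  loops.\<close>

definition fitting :: "'c \<Rightarrow> 'v list \<Rightarrow> bool" where
  "fitting c q \<longleftrightarrow> c \<in> C \<and> q \<noteq> [] \<and> set q \<subseteq> V \<and> distinct_adj q \<and>
     remdups_adj (map comp_of q) = trail c \<and> hd q = src c \<and> last q = tgt c \<and>
     (\<forall>(j, x) \<in> set (levels comp_of 0 q). x \<in> layers c ! j)"

text \<open>The detour begins and ends at original vertices. Its two extra arcs cost nothing and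
  project to loops, so the weight and the balances at original vertices are those of
  \<open>q\<close>.\<close>

definition lift :: "'c \<Rightarrow> 'v list \<Rightarrow> 'w list" where
  "lift c q = orig (hd q) # map (\<lambda>(j, x). copy c j x) (levels comp_of 0 q) @ [orig (last q)]"

context
  fixes c q assumes q: "fitting c q"
begin

lemma levels_cells: "(j, x) \<in> set (levels comp_of 0 q) \<Longrightarrow> (c, j, x) \<in> cells"
  using q levels_drop(2)[of comp_of q 0 "trail c" j x] trail(3)[of c]
  by (auto simp: fitting_def cells_def)

lemma hd_levels_q: "hd (levels comp_of 0 q) = (0, src c)"
  using q by (simp add: fitting_def hd_levels)

lemma last_levels_q: "last (levels comp_of 0 q) = (length (layers c) - 1, tgt c)"
  using q levels_drop(1)[of comp_of q 0 "trail c"] trail(3)[of c] by (auto simp: fitting_def)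

lemma first_last_cells: "(c, 0, src c) \<in> cells" "(c, length (layers c) - 1, tgt c) \<in> cells"
  "Suc (length (layers c) - 1) = length (layers c)"
proof -
  have ne: "levels comp_of 0 q \<noteq> []" using q by (simp add: fitting_def)
  then show 1: "(c, 0, src c) \<in> cells" "(c, length (layers c) - 1, tgt c) \<in> cells"
    using hd_in_set[OF ne] last_in_set[OF ne] levels_cells by (auto simp: hd_levels_q last_levels_q)
  from 1(1) show "Suc (length (layers c) - 1) = length (layers c)" by (auto simp: cells_def)
qed

lemma vwalk_arcs_lift:
  "vwalk_arcs (lift c q) = (orig (src c), copy c 0 (src c)) #
     map (map_prod (\<lambda>(j, x). copy c j x) (\<lambda>(j, x). copy c j x)) (vwalk_arcs (levels comp_of 0 q)) @
     [(copy c (length (layers c) - 1) (tgt c), orig (tgt c))]"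
proof -
  have ne: "levels comp_of 0 q \<noteq> []" using q by (simp add: fitting_def)
  then show ?thesis
    using q hd_levels_q last_levels_q
    by (simp add: lift_def vwalk_arcs_append hd_append hd_map last_map fitting_def flip: vwalk_arcs_map)
qed

lemma vwalk_arcs_q: "vwalk_arcs q = map (map_prod snd snd) (vwalk_arcs (levels comp_of 0 q))"
  by (simp flip: vwalk_arcs_map)

lemma level_arc_inner:
  assumes "e \<in> set (vwalk_arcs (levels comp_of 0 q))"
  shows "map_prod (\<lambda>(j, x). copy c j x) (\<lambda>(j, x). copy c j x) e \<in> inner c"
proof -
  obtain j x j' y where e: "e = ((j, x), (j', y))"
    by (cases e; cases "fst e"; cases "snd e") auto
  then have "(c, j, x) \<in> cells" "(c, j', y) \<in> cells"
    using assms set_vwalk_arcs_subset[of "levels comp_of 0 q"] levels_cells by auto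
  moreover have "j' = j \<or> j' = Suc j" using assms unfolding e by (rule levels_step)
  ultimately show ?thesis unfolding inner_def e by auto
qed

lemma weight_lift:
  "total_weight w' (mset (vwalk_arcs (lift c q))) = total_weight w (mset (vwalk_arcs q))"
proof -
  let ?cp = "\<lambda>(j, x). copy c j x" and ?L = "vwalk_arcs (levels comp_of 0 q)"
  have c: "c \<in> C" using q by (simp add: fitting_def)
  have "total_weight (w' \<circ> map_prod ?cp ?cp) (mset ?L) = total_weight (w \<circ> map_prod snd snd) (mset ?L)"
  proof (rule total_weight_cong)
    fix e assume "e \<in># mset ?L"
    then have "map_prod ?cp ?cp e \<in> inner c" using level_arc_inner by simp
    then show "(w' \<circ> map_prod ?cp ?cp) e = (w \<circ> map_prod snd snd) e"
      using w'_inner[OF c] by (cases e) (auto split: prod.splits)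
  qed
  then show ?thesis
    using w'_entry[OF first_last_cells(1)] w'_exit[OF first_last_cells(2,3)]
    by (simp add: vwalk_arcs_lift vwalk_arcs_q total_weight_image flip: image_mset.comp)
qed

lemma arcs_on_lift: "arcs_on new_verts (mset (vwalk_arcs (lift c q)))"
proof -
  have c: "c \<in> C" using q by (simp add: fitting_def)
  have "a \<in> new_verts \<and> b \<in> new_verts \<and> a \<noteq> b" if ab: "(a, b) \<in> set (vwalk_arcs (lift c q))" for a b
  proof -
    have V: "src c \<in> V" "tgt c \<in> V" using first_last_cells(1,2) cells_V by blast+
    from ab consider "(a, b) = (orig (src c), copy c 0 (src c))"
      | "(a, b) = (copy c (length (layers c) - 1) (tgt c), orig (tgt c))"
      | j x j' y where "((j, x), (j', y)) \<in> set (vwalk_arcs (levels comp_of 0 q))" "a = copy c j x" "b = copy c j' y"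
      unfolding vwalk_arcs_lift by fastforce
    then show ?thesis
    proof cases
      case 1
      then show ?thesis using V copy_in_new_verts[OF first_last_cells(1)] copy_neq_orig[OF c, of 0 "src c" "src c"]
        by (auto simp: new_verts_def)
    next
      case 2
      then show ?thesis using V copy_in_new_verts[OF first_last_cells(2)] copy_neq_orig[OF c]
        by (auto simp: new_verts_def)
    next
      case (3 j x j' y)
      then have "(c, j, x) \<in> cells" "(c, j', y) \<in> cells"
        using set_vwalk_arcs_subset[of "levels comp_of 0 q"] levels_cells by auto
      moreover have "(x, y) \<in> set (vwalk_arcs q)" using 3(1) unfolding vwalk_arcs_q by force
      then have "x \<noteq> y" using q unfolding fitting_def set_vwalk_arcs_distinct_adj by blast
      ultimately show ?thesis using 3 copy_in_new_verts proj_copy by metis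
    qed
  qed
  then show ?thesis by (auto simp: arcs_on_def)
qed

lemma net_lift_orig: "net (mset (vwalk_arcs (lift c q))) (orig x) = net (mset (vwalk_arcs q)) x"
  using q by (simp add: net_vwalk_arcs lift_def fitting_def)

lemma net_lift_other: "(\<And>x. z \<noteq> orig x) \<Longrightarrow> net (mset (vwalk_arcs (lift c q))) z = 0"
  by (simp add: net_vwalk_arcs lift_def eq_commute[of _ z])

text \<open>Replacing a walk by its lift must not disconnect the vertices that it visited.\<close>

lemma linked_lift:
  assumes "mset (vwalk_arcs (lift c q)) \<subseteq># M" "new_arcs \<subseteq># M"
  shows "(orig (src c), copy c 0 (src c)) \<in> linked M"
    and "x \<in> set q \<Longrightarrow> (orig (src c), orig x) \<in> linked M"
proof -
  have "set (vwalk_arcs (lift c q)) \<subseteq> linked M"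
    using assms(1) by (auto intro!: linked_arc dest: mset_subset_eqD)
  then have lift: "(orig (src c), z) \<in> linked M" if "z \<in> set (lift c q)" for z
    using linked_vwalk[OF _ that, of M] q by (simp add: lift_def fitting_def)
  show "(orig (src c), copy c 0 (src c)) \<in> linked M"
  proof (rule lift)
    have "(0, src c) \<in> set (levels comp_of 0 q)"
      using hd_in_set[of "levels comp_of 0 q"] hd_levels_q q by (simp add: fitting_def)
    then show "copy c 0 (src c) \<in> set (lift c q)" by (force simp: lift_def)
  qed
  assume "x \<in> set q"
  then have "x \<in> snd ` set (levels comp_of 0 q)" by (metis list.set_map map_snd_levels)
  then obtain j where j: "(j, x) \<in> set (levels comp_of 0 q)" by force
  show "(orig (src c), orig x) \<in> linked M"
  \<comment> \<open>Copies in the first layer are tied to the hub instead of the original vertex,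
    but there \<open>x\<close> and \<open>src c\<close> lie in the same component already.\<close>
  proof (cases "j = 0")
    case True
    have "comp_of x = trail c ! 0" "comp_of (src c) = trail c ! 0"
      using cells_trail(3)[OF levels_cells[OF j]] cells_trail(3)[OF first_last_cells(1)] True by auto
    then have "(src c, x) \<in> linked A"
      using component_of_eq_iff[OF arcs_A cells_V[OF first_last_cells(1)] cells_V[OF levels_cells[OF j]]] by simp
    then show ?thesis using linked_mono[OF assms(2)] linked_orig by blast
  next
    case False
    have "(orig (src c), copy c j x) \<in> linked M"
      using j by (intro lift) (force simp: lift_def)
    moreover have "(copy c j x, orig x) \<in> linked M"
      using linked_mono[OF assms(2) linked_anchor[OF levels_cells[OF j]]] False by simp
    ultimately show ?thesis by (rule linked_trans)
  qed
qed

end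

text \<open>A path is taken as it is, and its trail of components gives the layers. A cycle is
  rotated to start at the last vertex of its initial segment in \<open>K\<close>; this preserves the
  multiset of arcs, which is all that the extension sees.\<close>

lemma fitting_chain:
  assumes k: "k \<in> H" and p: "realizes V A p (hint k)" and adj: "distinct_adj p"
  shows "\<exists>c q. owner c = k \<and> fitting c q \<and> mset (vwalk_arcs q) = mset (vwalk_arcs p)"
proof (cases "hint k")
  case (Path_Hint t)
  with p have p': "p \<noteq> []" "set p \<subseteq> V" "same_trail t (meta V A p)" "net A (hd p) > 0" "net A (last p) < 0"
    by (auto simp: vwalk_full_digraph balance_eq_net)
  then have "fits V A (hint k) (meta V A p) (hd p) (last p)" "hd p \<in> V" "last p \<in> V"
    using Path_Hint by auto
  then obtain c where c: "c \<in> C" "owner c = k" "layers c = meta V A p" "src c = hd p" "tgt c = last p"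
    using chain_exists[OF k] by metis
  have t: "trail c = meta V A p" using trail(6)[OF c(1)] c Path_Hint by simp
  have "x \<in> layers c ! j" if "(j, x) \<in> set (levels comp_of 0 p)" for j x
  proof -
    have "x \<in> snd ` set (levels comp_of 0 p)" using that by force
    then have "x \<in> V" using p'(2) by (metis list.set_map map_snd_levels subsetD)
    moreover have "comp_of x = layers c ! j"
      using levels_drop(2)[of comp_of p 0 "meta V A p" j x] that p'(1) c(3) by (simp add: meta_def)
    ultimately show ?thesis using component_of_self[OF arcs_A] by metis
  qed
  then have "fitting c p"
    using c p' adj t by (auto simp: fitting_def meta_def)
  with c(2) show ?thesis by blast
next
  case (Cycle_Hint t)
  let ?s = "meta V A p"
  from p Cycle_Hint have p': "p \<noteq> []" "set p \<subseteq> V" "same_trail t ?s" "closed_list p"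
    by (auto simp: vwalk_full_digraph)
  have walk: "component_walk V A ?s"
    using same_trail_component_walk(1)[OF hint_on_component_walk[OF hint_ok[OF k]]] p'(3) Cycle_Hint
    by simp
  define K where "K = comp_of (hd p)"
  define a where "a = takeWhile (\<lambda>x. comp_of x = K) p"
  define b where "b = dropWhile (\<lambda>x. comp_of x = K) p"
  have ab: "p = a @ b" by (simp add: a_def b_def)
  have a: "a \<noteq> []" "hd a = hd p" using p'(1) by (cases p; simp add: a_def K_def)+
  have aK: "comp_of x = K" if "x \<in> set a" for x
    using that set_takeWhileD unfolding a_def by fastforce
  \<comment> \<open>A closed walk inside \<open>K\<close> would have a trail with one entry, whereas
    trails of hints have at least two.\<close>
  have b: "b \<noteq> []"
  proof
    assume "b = []"
    then have "p = a" using ab by simp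
    then have "map comp_of p = [] @ replicate (length p) K" using aK by (auto intro!: nth_equalityI)
    then have "length (remdups_adj (map comp_of p)) \<le> 1" by (simp add: remdups_adj_replicate)
    then show False using walk by (simp add: component_walk_def meta_def)
  qed
  have bK: "comp_of (hd b) \<noteq> K" using b hd_dropWhile unfolding b_def by blast
  have lastb: "last b = hd a"
  proof -
    have "last p = last b" unfolding ab using b by simp
    moreover have "hd p = last p" using p'(4) by (simp add: closed_list_def)
    ultimately show ?thesis using a(2) by simp
  qed
  \<comment> \<open>As \<open>p = a @ b\<close> and \<open>last b = hd a\<close>, the walk
    \<open>x # b @ tl a\<close> runs through \<open>b\<close> back to \<open>hd a\<close> and then
    along \<open>a\<close> to its last vertex \<open>x\<close>.\<close>
  define x where "x = last a"
  define r where "r = b @ tl a"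
  define q where "q = x # r"
  have xa: "x \<in> set a" using a by (simp add: x_def)
  have r: "r \<noteq> []" "hd r = hd b" using b by (simp_all add: r_def)
  have lastq: "last q = x"
    using a lastb b by (cases a) (auto simp: q_def r_def x_def)
  have "mset (vwalk_arcs r) = mset (vwalk_arcs b) + mset (vwalk_arcs a)"
  proof (cases "tl a = []")
    case True
    then show ?thesis using a by (cases a) (auto simp: r_def)
  next
    case False
    then have "vwalk_arcs a = (hd a, hd (tl a)) # vwalk_arcs (tl a)"
      using a by (metis list.collapse vwalk_arcs_Cons)
    then show ?thesis using False b lastb by (simp add: r_def vwalk_arcs_append)
  qed
  then have arcs: "mset (vwalk_arcs q) = mset (vwalk_arcs p)"
    using r a b by (simp add: q_def ab vwalk_arcs_append x_def)
  have s: "remdups_adj (map comp_of (x # b)) = ?s"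
  proof -
    have "remdups_adj (map comp_of (butlast a) @ map comp_of (x # b)) = remdups_adj (map comp_of (x # b))"
      using aK xa by (intro remdups_adj_const_append) (auto dest: in_set_butlastD)
    moreover have "butlast a @ x # b = p" using a ab by (simp add: x_def)
    ultimately show ?thesis unfolding meta_def by (simp only: map_append[symmetric])
  qed
  have meta: "remdups_adj (map comp_of q) = ?s"
  proof -
    have "remdups_adj (map comp_of (x # b) @ map comp_of (tl a)) = remdups_adj (map comp_of (x # b))"
    proof (rule remdups_adj_append_const)
      fix y assume "y \<in> set (map comp_of (tl a))"
      then have "y = K" using aK by (auto dest: list.set_sel(2)[OF a(1)])
      then show "y = last (map comp_of (x # b))" using b lastb a by (simp add: last_map K_def)
    qed simp
    with s show ?thesis by (simp add: q_def r_def)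
  qed
  have xK: "comp_of x = K" using aK xa .
  have tls: "remdups_adj (map comp_of r) = tl ?s" and hds: "hd ?s = K"
  proof -
    have "remdups_adj (map comp_of q) = K # remdups_adj (map comp_of r)"
      using xK bK r by (cases r) (auto simp: q_def)
    then show "remdups_adj (map comp_of r) = tl ?s" "hd ?s = K" using meta by (metis list.sel)+
  qed
  have setq: "set q \<subseteq> V" using p'(2) xa ab by (auto simp: q_def r_def dest: list.set_sel(2)[OF a(1)])
  have xV: "x \<in> V" using setq by (simp add: q_def)
  have "fits V A (hint k) ({x} # tl ?s) x x"
    using Cycle_Hint p'(3) hds xK component_of_self[OF arcs_A xV] by auto
  then obtain c where c: "c \<in> C" "owner c = k" "layers c = {x} # tl ?s" "src c = x" "tgt c = x"
    using chain_exists[OF k _ xV xV] by metis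
  have "trail c = ?s"
  proof -
    have "tl (trail c) = tl ?s" using trail(4)[OF c(1)] c(3) by simp
    moreover have "length (trail c) = Suc (length (tl ?s))" using trail(3)[OF c(1)] c(3) by simp
    then have "(c, 0, x) \<in> cells" using c by (simp add: cells_def)
    then have "trail c ! 0 = K" using cells_trail(3) xK by metis
    moreover have "trail c \<noteq> []" "?s \<noteq> []"
      using \<open>length (trail c) = _\<close> walk by (auto simp: component_walk_def)
    ultimately show ?thesis using hds by (metis hd_conv_nth list.collapse)
  qed
  moreover have "distinct_adj q"
    using adj arg_cong[OF arcs, of set_mset] by (simp add: set_vwalk_arcs_distinct_adj)
  moreover have "y \<in> layers c ! j" if jy: "(j, y) \<in> set (levels comp_of 0 q)" for j y
  proof -
    have "levels comp_of 0 q = (0, x) # levels comp_of 1 r"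
      using r xK bK by (cases r) (auto simp: q_def)
    with jy consider "j = 0" "y = x" | "(j, y) \<in> set (levels comp_of 1 r)" by auto
    then show ?thesis
    proof cases
      case 2
      then have "y \<in> snd ` set (levels comp_of 1 r)" by force
      then have "y \<in> V" using setq by (metis list.set_map list.set_intros(2) map_snd_levels q_def subsetD)
      moreover have "1 \<le> j" "j < length ?s" "comp_of y = ?s ! j"
        using levels_drop(2)[of comp_of r 1 ?s j y] 2 tls r by (simp_all add: drop_Suc)
      moreover have "layers c ! j = ?s ! j"
        using \<open>1 \<le> j\<close> \<open>j < length ?s\<close> c(3) by (cases j) (auto simp: nth_tl)
      ultimately show ?thesis using component_of_self[OF arcs_A] by metis
    qed (use c in simp)
  qed
  ultimately have "fitting c q"
    using c setq lastq meta by (auto simp: fitting_def) (simp_all add: q_def)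
  with c(2) arcs show ?thesis by blast
qed

end

lemma linked_common: "(a, x) \<in> linked M \<Longrightarrow> (a, y) \<in> linked M \<Longrightarrow> (x, y) \<in> linked M"
  by (rule linked_trans[OF linked_sym])

context weighted_hint_gadgets
begin

text \<open>The arcs of the realizations are exchanged for the lifts, and the remaining arcs are
  kept between original vertices. Weight and balances are unchanged, and ties connect the copies
  that no lift uses.\<close>

lemma extension_of_new_if_extension:
  assumes E: "eulerian_extension V A E" and heeds: "heeds V A E (hint ` H)"
  shows "\<exists>E'. eulerian_extension new_verts new_arcs E' \<and> total_weight w' E' = total_weight w E"
proof -
  from heeds obtain f where f: "\<forall>h\<in>hint ` H. realizes V A (f h) h"
      "(\<Sum>h\<in>hint ` H. mset (vwalk_arcs (f h))) \<subseteq># E"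
    by (auto simp: heeds_def)
  have fE: "(\<Sum>k\<in>H. mset (vwalk_arcs (f (hint k)))) \<subseteq># E"
    using f(2) by (simp add: sum.reindex[OF inj_hint] comp_def)
  have arcsE: "arcs_on V E" using E by (simp add: eulerian_extension_def)
  have "arcs_on V (A + E)" using arcs_A arcsE by (auto simp: arcs_on_def)
  then have VE: "V \<noteq> {}" "V \<times> V \<subseteq> linked (A + E)" "\<And>v. v \<in> V \<Longrightarrow> net (A + E) v = 0"
    using E eulerian_iff[OF finite_V] by (auto simp: eulerian_extension_def)
  have sub: "mset (vwalk_arcs (f (hint k))) \<subseteq># E" if "k \<in> H" for k
  proof -
    have "mset (vwalk_arcs (f (hint k))) \<subseteq># (\<Sum>k\<in>H. mset (vwalk_arcs (f (hint k))))"
      unfolding sum.remove[OF finite_H that] by simp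
    then show ?thesis using fE by (rule subset_mset.order_trans)
  qed
  have "\<forall>k\<in>H. \<exists>z. owner (fst z) = k \<and> fitting (fst z) (snd z) \<and>
      mset (vwalk_arcs (snd z)) = mset (vwalk_arcs (f (hint k)))"
  proof
    fix k assume k: "k \<in> H"
    have "distinct_adj (f (hint k))"
      unfolding set_vwalk_arcs_distinct_adj
      using mset_subset_eqD[OF sub[OF k]] arcsE by (fastforce simp: arcs_on_def)
    from fitting_chain[OF k _ this] f(1) k
    show "\<exists>z. owner (fst z) = k \<and> fitting (fst z) (snd z) \<and>
      mset (vwalk_arcs (snd z)) = mset (vwalk_arcs (f (hint k)))" by auto
  qed
  from bchoice[OF this] obtain g where g: "\<And>k. k \<in> H \<Longrightarrow> owner (fst (g k)) = k"
      "\<And>k. k \<in> H \<Longrightarrow> fitting (fst (g k)) (snd (g k))"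
      "\<And>k. k \<in> H \<Longrightarrow> mset (vwalk_arcs (snd (g k))) = mset (vwalk_arcs (f (hint k)))" by auto
  define L where "L k = mset (vwalk_arcs (lift (fst (g k)) (snd (g k))))" for k
  define S where "S = (\<Sum>k\<in>H. mset (vwalk_arcs (snd (g k))))"
  have "S = (\<Sum>k\<in>H. mset (vwalk_arcs (f (hint k))))"
    unfolding S_def by (rule sum.cong) (simp_all add: g(3))
  with fE have "S \<subseteq># E" by simp
  \<comment> \<open>Here joint containment is essential: all realizations are removed from
    \<open>E\<close> at once.\<close>
  then obtain R where R: "E = R + S" by (metis add.commute mset_subset_eq_exists_conv)
  define T where "T = (\<Sum>k\<in>H. L k)"
  define E' where "E' = image_mset (map_prod orig orig) R + T"
  let ?M = "new_arcs + E'"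
  have in_T: "(a, b) \<in># T \<longleftrightarrow> (\<exists>k\<in>H. (a, b) \<in># L k)" for a b
    unfolding T_def using finite_H by (simp add: set_mset_sum)
  have in_S: "(a, b) \<in># S \<longleftrightarrow> (\<exists>k\<in>H. (a, b) \<in> set (vwalk_arcs (snd (g k))))" for a b
    unfolding S_def using finite_H by (simp add: set_mset_sum)
  have "total_weight w' T = total_weight w S"
    unfolding T_def S_def total_weight_sum by (rule sum.cong) (simp_all add: L_def weight_lift g(2))
  moreover have "total_weight w' (image_mset (map_prod orig orig) R) = total_weight w R"
    unfolding total_weight_image
  proof (rule total_weight_cong)
    fix a assume "a \<in># R"
    then have "fst a \<in> V" "snd a \<in> V" using arcsE by (cases a; auto simp: arcs_on_def R)+
    then show "(w' \<circ> map_prod orig orig) a = w a" using w'_original by (cases a) simp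
  qed
  ultimately have weight: "total_weight w' E' = total_weight w E" by (simp add: E'_def R)
  have "arcs_on new_verts E'"
  proof -
    have "a \<in> new_verts \<and> b \<in> new_verts \<and> a \<noteq> b" if "(a, b) \<in># E'" for a b
    proof (cases "(a, b) \<in># T")
      case True
      then obtain k where "k \<in> H" "(a, b) \<in># L k"
        by (auto simp: in_T)
      then show ?thesis using arcs_on_lift[OF g(2)] unfolding arcs_on_def L_def by blast
    next
      case False
      with that obtain x y where "(x, y) \<in># E" "a = orig x" "b = orig y" by (auto simp: E'_def R)
      then show ?thesis using arcsE by (auto simp: arcs_on_def new_verts_def)
    qed
    then show ?thesis by (auto simp: arcs_on_def)
  qed
  moreover from this have "arcs_on new_verts ?M" using arcs_on_new by (auto simp: arcs_on_def)
  moreover have "net ?M z = 0" if z: "z \<in> new_verts" for z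
  proof (cases "z \<in> range orig")
    case True
    then obtain x where x: "z = orig x" by blast
    have "x \<in> V"
      using z
    proof (cases rule: new_verts_cases)
      case (hub k)
      then show ?thesis using hub_neq_orig x by blast
    next
      case (copy c i y)
      then show ?thesis using copy_neq_orig x cells_D by blast
    qed (use x in simp)
    have "net T (orig x) = net S x"
      unfolding T_def S_def net_sum by (rule sum.cong) (simp_all add: L_def net_lift_orig g(2))
    then have "net ?M z = net (A + E) x"
      by (simp add: x E'_def R net_new_arcs_orig net_image_orig)
    then show ?thesis using VE(3) \<open>x \<in> V\<close> by simp
  next
    case False
    then have *: "z \<noteq> orig x" for x by blast
    have "net T z = 0"
      unfolding T_def net_sum by (rule sum.neutral) (simp add: L_def net_lift_other[OF g(2)] *)
    then show ?thesis using * by (simp add: E'_def net_new_arcs_other net_image_orig_other)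
  qed
  moreover have "new_verts \<times> new_verts \<subseteq> linked ?M"
  proof -
    have lift_sub: "mset (vwalk_arcs (lift (fst (g k)) (snd (g k)))) \<subseteq># ?M" if "k \<in> H" for k
    proof -
      have "mset (vwalk_arcs (lift (fst (g k)) (snd (g k)))) \<subseteq># T"
        unfolding T_def sum.remove[OF finite_H that] L_def by simp
      also have "T \<subseteq># ?M" by (simp add: E'_def)
      finally show ?thesis .
    qed
    have new_sub: "new_arcs \<subseteq># ?M" by simp
    have orig: "(orig x, orig y) \<in> linked ?M" if "x \<in> V" "y \<in> V" for x y
    proof (rule linked_least[where f = orig and M = "A + E"])
      show "(x, y) \<in> linked (A + E)" using VE(2) that by blast
      fix u v assume "(u, v) \<in># A + E"
      then consider "(u, v) \<in># A" | "(u, v) \<in># R" | "(u, v) \<in># S" by (auto simp: R)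
      then show "(orig u, orig v) \<in> linked ?M"
      proof cases
        case 1
        then show ?thesis by (intro linked_mono[OF new_sub] linked_orig linked_arc)
      next
        case 2
        then have "map_prod orig orig (u, v) \<in># image_mset (map_prod orig orig) R"
          by (metis image_eqI set_image_mset)
        then show ?thesis by (intro linked_arc) (simp add: E'_def)
      next
        case 3
        then obtain k where k: "k \<in> H" "(u, v) \<in> set (vwalk_arcs (snd (g k)))" by (auto simp: in_S)
        then have "u \<in> set (snd (g k))" "v \<in> set (snd (g k))"
          using set_vwalk_arcs_subset[of "snd (g k)"] by auto
        then show ?thesis
          by (intro linked_common[OF linked_lift(2)[OF g(2)[OF k(1)] lift_sub[OF k(1)] new_sub]
                linked_lift(2)[OF g(2)[OF k(1)] lift_sub[OF k(1)] new_sub]])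
      qed
    qed
    obtain x0 where x0: "x0 \<in> V" using VE(1) by blast
    \<comment> \<open>A hub is reached through the tie of the first copy on its lift.\<close>
    have hub: "(orig x0, hub k) \<in> linked ?M" if k: "k \<in> H" for k
    proof -
      let ?c = "fst (g k)"
      have fit: "fitting ?c (snd (g k))" using g(2) k .
      have "(copy ?c 0 (src ?c), hub k) \<in> linked ?M"
        using linked_mono[OF new_sub linked_anchor[OF first_last_cells(1)[OF fit]]] g(1)[OF k] by simp
      moreover have "(orig (src ?c), copy ?c 0 (src ?c)) \<in> linked ?M"
        using linked_lift(1)[OF fit lift_sub[OF k] new_sub] .
      moreover have "(orig x0, orig (src ?c)) \<in> linked ?M"
        using orig[OF x0 cells_V[OF first_last_cells(1)[OF fit]]] .
      ultimately show ?thesis by (blast intro: linked_trans[OF linked_trans])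
    qed
    have "(orig x0, z) \<in> linked ?M" if z: "z \<in> new_verts" for z
      using z
    proof (cases rule: new_verts_cases)
      case (copy c i x)
        then have "owner c \<in> H" "x \<in> V" using chain cells_V by (auto simp: cells_def)
        then have "(orig x0, anchor (c, i, x)) \<in> linked ?M" using orig[OF x0] hub by simp
        moreover have "(anchor (c, i, x), z) \<in> linked ?M"
          using linked_sym[OF linked_mono[OF new_sub linked_anchor[OF copy(1)]]] copy(2) by simp
        ultimately show ?thesis by (rule linked_trans)
    qed (use orig[OF x0] hub in auto)
    then show ?thesis by (auto intro: linked_common)
  qed
  moreover have "new_verts \<noteq> {}" using VE(1) by (auto simp: new_verts_def)
  ultimately have "eulerian_extension new_verts new_arcs E'"
    unfolding eulerian_extension_def using eulerian_iff[OF finite_new_verts] by blast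
  with weight show ?thesis by blast
qed

end

subsection \<open>Projecting an extension of the new graph\<close>

text \<open>Lists that repeat no element, alone or together, use each one at most once, so
  containment in the support suffices whatever the multiplicities in \<open>M\<close> are.\<close>

lemma sum_mset_disjoint_subseteq:
  assumes "finite I" "\<And>i. i \<in> I \<Longrightarrow> distinct (l i)" "\<And>i. i \<in> I \<Longrightarrow> set (l i) \<subseteq> set_mset M"
    and "\<And>i j. i \<in> I \<Longrightarrow> j \<in> I \<Longrightarrow> i \<noteq> j \<Longrightarrow> set (l i) \<inter> set (l j) = {}"
  shows "(\<Sum>i\<in>I. mset (l i)) \<subseteq># M"
proof -
  have "(\<Sum>i\<in>I. mset (l i)) = mset_set (\<Union>i\<in>I. set (l i))"
    using assms(1,2,4)
  proof (induction I rule: finite_induct)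
    case (insert i I)
    have "set (l i) \<inter> (\<Union>i\<in>I. set (l i)) = {}" using insert.prems(2) insert.hyps(2) by fastforce
    then have "mset_set (set (l i) \<union> (\<Union>i\<in>I. set (l i))) = mset_set (set (l i)) + mset_set (\<Union>i\<in>I. set (l i))"
      using insert.hyps(1) by (intro mset_set_Union) auto
    then show ?case using insert by (simp add: mset_set_set)
  qed simp
  also have "\<dots> \<subseteq># mset_set (set_mset M)"
    using assms(3) by (intro subset_imp_msubset_mset_set) auto
  also have "\<dots> \<subseteq># M" by (rule mset_set_set_mset_msubset)
  finally show ?thesis .
qed

context weighted_hint_gadgets
begin

lemma copy_distinct:
  assumes "(c, i, x) \<in> cells"
  shows "copy c i x \<noteq> orig y" "k \<in> H \<Longrightarrow> copy c i x \<noteq> hub k"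
    "orig y \<noteq> copy c i x" "k \<in> H \<Longrightarrow> hub k \<noteq> copy c i x"
  using copy_neq_orig copy_neq_hub cells_D[OF assms] by metis+

lemma length_trail: "c \<in> C \<Longrightarrow> 2 \<le> length (trail c)"
  using trail(2) by (auto simp: component_walk_def)

lemma trail_adj: "c \<in> C \<Longrightarrow> Suc i < length (trail c) \<Longrightarrow> trail c ! i \<noteq> trail c ! Suc i"
  using trail(2) distinct_adj_nth by (auto simp: component_walk_def)

lemma links_cells_proj:
  assumes "(a, b) \<in> links"
  shows "proj a \<in> V" "proj b \<in> V" "a \<in> orig ` V \<union> copies" "b \<in> orig ` V \<union> copies"
proof -
  have "proj a \<in> V \<and> proj b \<in> V \<and> a \<in> orig ` V \<union> copies \<and> b \<in> orig ` V \<union> copies"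
    using assms
  proof (cases rule: links.cases)
    case inner
    then show ?thesis using cells_V by (force simp: inner_def copies_def)
  qed (use cells_V in \<open>force simp: copies_def\<close>)+
  then show "proj a \<in> V" "proj b \<in> V" "a \<in> orig ` V \<union> copies" "b \<in> orig ` V \<union> copies" by auto
qed

text \<open>Arcs inside a chain advance by at most one layer, so a path to the last layer cannot
  skip any; and as consecutive components differ, the projection shows whether an arc stays or
  advances. The start layer \<open>i\<close> is arbitrary for the induction.\<close>

lemma proj_path:
  assumes c: "c \<in> C" and p: "set (vwalk_arcs p) \<subseteq> inner c" "p \<noteq> []"
    and hd: "hd p = copy c i x" "(c, i, x) \<in> cells"
    and last: "last p = copy c (length (trail c) - 1) y"
  shows "remdups_adj (map comp_of (map proj p)) = drop i (trail c)"
    and "\<And>z. z \<in> set p \<Longrightarrow> \<exists>j u. z = copy c j u \<and> (c, j, u) \<in> cells"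
proof -
  have "remdups_adj (map comp_of (map proj p)) = drop i (trail c) \<and>
      (\<forall>z\<in>set p. \<exists>j u. z = copy c j u \<and> (c, j, u) \<in> cells)"
    using p hd last
  proof (induction p arbitrary: i x rule: vwalk_arcs.induct)
    case (2 z)
    have "i < length (trail c)" "comp_of x = trail c ! i" using cells_trail[OF 2(4)] by auto
    moreover have "i = length (trail c) - 1"
      using 2 copy_eq[OF c c] calculation(1) trail(3)[OF c] by simp
    ultimately have "drop i (trail c) = [comp_of x]"
      by (metis Cons_nth_drop_Suc One_nat_def Suc_pred drop_all le_refl length_greater_0_conv list.size(3) not_less0)
    moreover have "z = copy c i x" using 2(3) by simp
    ultimately show ?case using 2(4) by auto
  next
    case (3 z z' p)
    have "(z, z') \<in> inner c" using 3(2) by simp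
    then obtain i' x' j y' where a: "z = copy c i' x'" "z' = copy c j y'" "(c, i', x') \<in> cells"
        "(c, j, y') \<in> cells" "j = i' \<or> j = Suc i'"
      by (auto simp: inner_def)
    then have "i' = i" "x' = x" using 3(4,5) copy_eq_iff by auto
    have IH: "remdups_adj (map comp_of (map proj (z' # p))) = drop j (trail c)"
        "\<forall>z\<in>set (z' # p). \<exists>j u. z = copy c j u \<and> (c, j, u) \<in> cells"
      using 3(1)[of j y'] 3(2,6) a by auto
    have i: "i < length (trail c)" "comp_of x = trail c ! i" using cells_trail[OF 3(5)] by auto
    have j: "j < length (trail c)" "comp_of y' = trail c ! j" using cells_trail[OF a(4)] by auto
    have "remdups_adj (map comp_of (map proj (z # z' # p))) = drop i (trail c)"
    proof (cases "j = i")
      case True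
      then have "comp_of (proj z) = comp_of (proj z')" using i j a \<open>x' = x\<close> by simp
      then show ?thesis using IH(1) True by simp
    next
      case False
      then have "j = Suc i" using a(5) \<open>i' = i\<close> by simp
      then have "comp_of (proj z) \<noteq> comp_of (proj z')"
        using trail_adj[OF c] i j a \<open>x' = x\<close> by simp
      then show ?thesis
        using IH(1) i a \<open>x' = x\<close> \<open>j = Suc i\<close> by (simp add: Cons_nth_drop_Suc)
    qed
    then show ?case using IH(2) a by auto
  qed simp
  then show "remdups_adj (map comp_of (map proj p)) = drop i (trail c)"
    "\<And>z. z \<in> set p \<Longrightarrow> \<exists>j u. z = copy c j u \<and> (c, j, u) \<in> cells" by auto
qed

text \<open>Layers of distinct components project to disjoint sets, and a component is repeated only
  at the two ends of a closed trail. There a path hint allows repeated vertices, and for a cycle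
  hint the first layer contributes only the start.\<close>

lemma realizes_proj_path:
  assumes c: "c \<in> C" and p: "set (vwalk_arcs p) \<subseteq> inner c" "p \<noteq> []" "distinct p"
    and hd: "hd p = copy c 0 (src c)" "(c, 0, src c) \<in> cells"
    and last: "last p = copy c (length (trail c) - 1) (tgt c)"
  shows "realizes V A (map proj p) (hint (owner c))"
proof -
  let ?q = "map proj p"
  have meta: "meta V A ?q = trail c"
    unfolding meta_def using proj_path(1)[OF c p(1,2) hd last] by simp
  have cells: "\<exists>j u. z = copy c j u \<and> (c, j, u) \<in> cells" if "z \<in> set p" for z
    using proj_path(2)[OF c p(1,2) hd last that] .
  have V: "set ?q \<subseteq> V" using cells cells_V by fastforce
  have ends: "hd ?q = src c" "last ?q = tgt c" using p hd last by (simp_all add: hd_map last_map)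
  have st: "same_trail (hint_trail (hint (owner c))) (trail c)" using trail(1)[OF c] .
  have fits: "fits V A (hint (owner c)) (layers c) (src c) (tgt c)" using chain[OF c] by blast
  \<comment> \<open>\<open>J\<close> is a set of layers with pairwise distinct components: all
    layers of an open trail, all but the first for a cycle.\<close>
  have inj: "inj_on proj {z \<in> set p. \<forall>i u. z = copy c i u \<longrightarrow> (c, i, u) \<in> cells \<longrightarrow> i \<in> J}"
    if J: "inj_on ((!) (trail c)) J" for J
  proof (rule inj_onI, clarify)
    fix z z' assume *: "z \<in> set p" "z' \<in> set p" "proj z = proj z'"
      "\<forall>i u. z = copy c i u \<longrightarrow> (c, i, u) \<in> cells \<longrightarrow> i \<in> J"
      "\<forall>i u. z' = copy c i u \<longrightarrow> (c, i, u) \<in> cells \<longrightarrow> i \<in> J"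
    obtain i u where z: "z = copy c i u" "(c, i, u) \<in> cells" using cells[OF *(1)] by blast
    obtain j v where z': "z' = copy c j v" "(c, j, v) \<in> cells" using cells[OF *(2)] by blast
    have "u = v" using *(3) z z' by simp
    then have "trail c ! i = trail c ! j" using cells_trail(3)[OF z(2)] cells_trail(3)[OF z'(2)] by simp
    moreover have "i \<in> J" "j \<in> J" using *(4,5) z z' by blast+
    ultimately have "i = j" using J by (auto dest: inj_onD)
    with \<open>u = v\<close> z z' show "z = z'" by simp
  qed
  show ?thesis
  proof (cases "hint (owner c)")
    case (Path_Hint t)
    have "distinct ?q" if "\<not> closed_list t"
    proof -
      have "\<not> closed_list (trail c)"
        using same_trail_component_walk(2)[OF hint_on_component_walk[OF hint_ok] st]
          chain[OF c] that Path_Hint by auto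
      then have "distinct (trail c)" using trail(2)[OF c] by (simp add: component_walk_def)
      then have "inj_on ((!) (trail c)) {..<length (trail c)}"
        by (auto simp: inj_on_def nth_eq_iff_index_eq)
      from inj[OF this] have "inj_on proj (set p)"
        using cells_trail(1) by (rule_tac inj_on_subset) auto
      then show ?thesis using p(3) by (simp add: distinct_map)
    qed
    then show ?thesis
      using V p(2) st meta ends fits Path_Hint by (simp add: vwalk_full_digraph balance_eq_net)
  next
    case (Cycle_Hint t)
    have lay: "layers c = {src c} # tl (trail c)" "tgt c = src c" using trail(7)[OF c] Cycle_Hint by auto
    \<comment> \<open>Start and end are different copies of one vertex, in layer zero and in the
      last layer.\<close>
    have len: "length p \<ge> 2"
    proof (rule ccontr)
      assume "\<not> 2 \<le> length p"
      then have "hd p = last p" using p(2) by (cases p; cases "tl p") auto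
      then have "copy c 0 (src c) = copy c (length (trail c) - 1) (tgt c)" using hd last by simp
      moreover have "0 < length (layers c)" "length (trail c) - 1 < length (layers c)"
        using length_trail[OF c] trail(3)[OF c] by arith+
      ultimately have "0 = length (trail c) - 1" using copy_eq[OF c c] by blast
      then show False using length_trail[OF c] by simp
    qed
    have "closed_list ?q" using ends lay len by (simp add: closed_list_def)
    moreover have "distinct (tl ?q)"
    proof -
      have "distinct (tl (trail c))"
        using trail(2)[OF c] distinct_tl by (auto simp: component_walk_def split: if_splits)
      then have "inj_on ((!) (trail c)) {1..<length (trail c)}"
      proof -
        assume d: "distinct (tl (trail c))"
        have "i = j" if "1 \<le> i" "i < length (trail c)" "1 \<le> j" "j < length (trail c)"
          "trail c ! i = trail c ! j" for i j
          using that d by (cases i; cases j) (auto simp: nth_tl[symmetric] nth_eq_iff_index_eq)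
        then show ?thesis by (auto simp: inj_on_def)
      qed
      from inj[OF this] have "inj_on proj (set (tl p))"
      proof (rule inj_on_subset, intro subsetI CollectI conjI allI impI)
        fix z assume z: "z \<in> set (tl p)"
        then show "z \<in> set p" using p(2) by (rule list.set_sel(2)[rotated])
        fix i u assume *: "z = copy c i u" "(c, i, u) \<in> cells"
        \<comment> \<open>The first layer is \<open>{src c}\<close>, so another visit to it would
          repeat the head of the distinct list \<open>p\<close>.\<close>
        have "i \<noteq> 0"
        proof
          assume "i = 0"
          then have "u = src c" using cells_D[OF *(2)] lay by simp
          then have "z = hd p" using * hd \<open>i = 0\<close> by simp
          then show False using z p(2,3) by (cases p) auto
        qed
        then show "i \<in> {1..<length (trail c)}" using cells_trail(1)[OF *(2)] by simp
      qed
      then show ?thesis using p(3) by (simp add: distinct_map distinct_tl flip: map_tl)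
    qed
    ultimately show ?thesis
      using V p(2) st meta Cycle_Hint by (simp add: vwalk_full_digraph)
  qed
qed

text \<open>Three cuts: the boundary of a hub with its first layers forces an arc of
  \<open>E'\<close> across it, tracing back from there inside the chain yields the entry, and
  tracing forward from the entry yields the exit.\<close>

lemma chain_path_exists:
  assumes E': "eulerian_extension new_verts new_arcs E'" and fin: "set_mset E' \<subseteq> links"
    and k: "k \<in> H"
  shows "\<exists>c p. c \<in> C \<and> owner c = k \<and> p \<noteq> [] \<and> distinct p \<and>
    set (vwalk_arcs p) \<subseteq> inner c \<inter> set_mset E' \<and> hd p = copy c 0 (src c) \<and>
    (c, 0, src c) \<in> cells \<and> last p = copy c (length (trail c) - 1) (tgt c)"
proof -
  have "arcs_on new_verts (new_arcs + E')"
    using E' arcs_on_new by (auto simp: eulerian_extension_def arcs_on_def)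
  then have eul: "new_verts \<times> new_verts \<subseteq> linked (new_arcs + E')"
      "\<And>v. v \<in> new_verts \<Longrightarrow> net (new_arcs + E') v = 0"
    using E' eulerian_iff[OF finite_new_verts] by (auto simp: eulerian_extension_def)
  have net0: "net E' (copy c i x) = 0" if "(c, i, x) \<in> cells" for c i x
    using eul(2)[OF copy_in_new_verts[OF that]] net_new_arcs_other[of "copy c i x"]
      copy_distinct(1)[OF that] by simp
  have entry_exists: "\<exists>c. c \<in> C \<and> owner c = k \<and> (c, 0, src c) \<in> cells \<and>
      (orig (src c), copy c 0 (src c)) \<in># E'"
  proof -
    \<comment> \<open>No tie crosses the boundary of \<open>F\<close>: its copies are tied to
      \<open>hub k\<close>, and all other copies have anchors outside. So connectivity forces an arc
      of \<open>E'\<close> across.\<close>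
    define F where "F = insert (hub k) {copy c 0 x | c x. (c, 0, x) \<in> cells \<and> owner c = k}"
    have orig_F: "orig x \<notin> F" for x
      using hub_neq_orig[OF k, symmetric] copy_distinct(3) by (auto simp: F_def)
    have copy_F: "copy c i x \<in> F \<longleftrightarrow> i = 0 \<and> owner c = k" if "(c, i, x) \<in> cells" for c i x
      using copy_distinct(2)[OF that k] copy_eq_iff[OF that] that by (auto simp: F_def)
    have hub_F: "hub l \<in> F \<longleftrightarrow> l = k" if "l \<in> H" for l
      using copy_distinct(4)[OF _ that] inj_onD[OF inj_hub _ that k] by (auto simp: F_def)
    have "component_walk V A (hint_trail (hint k))"
      using hint_on_component_walk[OF hint_ok[OF k]] .
    then obtain K where "K \<in> components V A"
      by (cases "hint_trail (hint k)") (auto simp: component_walk_def)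
    then obtain x0 where x0: "x0 \<in> V" using components_eq[OF arcs_A] by auto
    have "(hub k, orig x0) \<in> linked (new_arcs + E')"
      using eul(1) k x0 by (auto simp: new_verts_def)
    moreover have "hub k \<in> F" by (simp add: F_def)
    ultimately obtain a b where ab: "(a, b) \<in># new_arcs + E'" "a \<in> F \<longleftrightarrow> b \<notin> F"
      using orig_F by (rule linked_cut)
    have "(a, b) \<notin># new_arcs"
    proof
      assume "(a, b) \<in># new_arcs"
      then consider x y where "a = orig x" "b = orig y" | "(a, b) \<in># ties"
        by (auto simp: new_arcs_def)
      then show False
      proof cases
        case 1
        then show False using ab(2) orig_F by simp
      next
        case 2
        then obtain c i x where z: "(c, i, x) \<in> cells" "(a, b) = (copy c i x, anchor (c, i, x)) \<or>
            (a, b) = (anchor (c, i, x), copy c i x)"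
          by (auto simp: in_ties simp del: anchor.simps)
        then have "owner c \<in> H" using chain cells_D by blast
        then have "copy c i x \<in> F \<longleftrightarrow> anchor (c, i, x) \<in> F"
          using copy_F[OF z(1)] orig_F hub_F by auto
        then show False using z(2) ab(2) by auto
      qed
    qed
    then have abE: "(a, b) \<in># E'" using ab(1) by simp
    then have "(a, b) \<in> links" using fin by blast
    then show ?thesis
    proof (cases rule: links.cases)
      case (original x y)
      then show ?thesis using ab(2) orig_F by simp
    next
      case (entry c)
      then have "owner c = k" using ab(2) orig_F copy_F by auto
      then show ?thesis using entry abE cells_D by blast
    next
      \<comment> \<open>An exit from the first layer would need a chain with one layer, but trails
        have at least two entries.\<close>
      case (exit c i)
      then have "i = 0" using ab(2) orig_F copy_F by auto
      moreover have "c \<in> C" using exit cells_D by blast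
      ultimately show ?thesis using exit length_trail[of c] trail(3)[of c] by simp
    next
      case (inner c)
      then obtain i x j y where ij: "a = copy c i x" "b = copy c j y" "(c, i, x) \<in> cells"
          "(c, j, y) \<in> cells" "j = i \<or> j = Suc i"
        by (auto simp: inner_def)
      then have i: "i = 0" "j = 1" "owner c = k" using ab(2) copy_F by auto
      \<comment> \<open>Vertices from which the tail of the crossing arc is reachable inside the
        chain still lie in the first layer, as arcs never go back. These vertices are balanced and
        the crossing arc leaves \<open>B\<close>, so some arc enters \<open>B\<close>, and this can
        only be the entry.\<close>
      define B where "B = {z. (z, a) \<in> (inner c \<inter> set_mset E')\<^sup>*}"
      have B: "\<exists>u. z = copy c 0 u \<and> (c, 0, u) \<in> cells" if "z \<in> B" for z
      proof -
        have "(z, a) \<in> (inner c \<inter> set_mset E')\<^sup>*" using that by (simp add: B_def)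
        then show ?thesis
        proof (induction rule: converse_rtrancl_induct)
          case base
          then show ?case using ij i by auto
        next
          case (step z z')
          then obtain u where u: "z' = copy c 0 u" "(c, 0, u) \<in> cells" by blast
          from step.hyps(1) obtain i' u' j' v' where v: "z = copy c i' u'" "z' = copy c j' v'"
              "(c, i', u') \<in> cells" "(c, j', v') \<in> cells" "j' = i' \<or> j' = Suc i'"
            by (auto simp: inner_def)
          then have "j' = 0" using u copy_eq_iff[OF v(4) u(2)] by simp
          then show ?case using v by auto
        qed
      qed
      have "B \<subseteq> (\<lambda>(c, i, x). copy c i x) ` cells" using B by force
      then have "finite B" using finite_cells finite_surj by blast
      moreover have "net E' z = 0" if "z \<in> B" for z using B[OF that] net0 by auto
      moreover have "a \<in> B" by (simp add: B_def)
      moreover have "b \<notin> B"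
        using B[of b] ij(2,4) i(2) copy_eq_iff[OF ij(4)] by auto
      ultimately have "\<exists>e\<in>#E'. fst e \<notin> B \<and> snd e \<in> B"
        by (subst balanced_cut) (auto intro!: bexI[OF _ abE])
      then obtain d e where de: "(d, e) \<in># E'" "d \<notin> B" "e \<in> B" by auto
      obtain u where u: "e = copy c 0 u" "(c, 0, u) \<in> cells" using B[OF de(3)] by blast
      have "(d, e) \<in> links" using de(1) fin by blast
      then show ?thesis
      proof (cases rule: links.cases)
        case (original x y)
        then show ?thesis using u copy_distinct(1)[OF u(2)] by simp
      next
        case (exit d i)
        then show ?thesis using u copy_distinct(1)[OF u(2)] by simp
      next
        case (entry c')
        then have "c' = c" using u copy_eq_iff[OF entry(3) u(2)] by simp
        then show ?thesis using entry de(1) i(3) cells_D by blast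
      next
        case (inner c')
        then obtain j' y' where *: "e = copy c' j' y'" "(c', j', y') \<in> cells"
          by (auto simp: inner_def)
        then have "c' = c" using u(1) copy_eq_iff[OF *(2) u(2)] by simp
        then have "(d, e) \<in> inner c \<inter> set_mset E'" using inner de(1) by simp
        then have "d \<in> B" using de(3) unfolding B_def by (simp add: converse_rtrancl_into_rtrancl)
        then show ?thesis using de(2) by simp
      qed
    qed
  qed
  then obtain c where c: "c \<in> C" "owner c = k" "(c, 0, src c) \<in> cells"
      "(orig (src c), copy c 0 (src c)) \<in># E'" by blast
  \<comment> \<open>The entry arc enters this set of balanced vertices, so some arc leaves it. An
    arc inside the chain would end in the set again, hence the leaving arc is the exit, and its tail
    is reachable from the entry.\<close>
  define R where "R = {z. (copy c 0 (src c), z) \<in> (inner c \<inter> set_mset E')\<^sup>*}"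
  have R: "\<exists>j u. z = copy c j u \<and> (c, j, u) \<in> cells" if "z \<in> R" for z
  proof -
    have "(copy c 0 (src c), z) \<in> (inner c \<inter> set_mset E')\<^sup>*" using that by (simp add: R_def)
    then show ?thesis
    proof (cases rule: rtrancl.cases)
      case rtrancl_refl
      then show ?thesis using c(3) by blast
    next
      case (rtrancl_into_rtrancl b)
      then show ?thesis by (auto simp: inner_def)
    qed
  qed
  have "R \<subseteq> (\<lambda>(c, i, x). copy c i x) ` cells" using R by force
  then have "finite R" using finite_cells finite_surj by blast
  moreover have "net E' z = 0" if "z \<in> R" for z using R[OF that] net0 by auto
  moreover have "copy c 0 (src c) \<in> R" by (simp add: R_def)
  moreover have "orig (src c) \<notin> R" using R copy_distinct(3) by blast
  ultimately have "\<exists>e\<in>#E'. fst e \<in> R \<and> snd e \<notin> R"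
    by (subst balanced_cut[symmetric]) (auto intro!: bexI[OF _ c(4)])
  then obtain a b where ab: "(a, b) \<in># E'" "a \<in> R" "b \<notin> R" by auto
  obtain i u where a: "a = copy c i u" "(c, i, u) \<in> cells" using R[OF ab(2)] by blast
  have "(a, b) \<in> links" using ab(1) fin by blast
  then have "copy c (length (trail c) - 1) (tgt c) \<in> R"
  proof (cases rule: links.cases)
    case (original x y)
    then show ?thesis using a copy_distinct(1)[OF a(2)] by simp
  next
    case (entry c')
    then show ?thesis using a copy_distinct(1)[OF a(2)] by simp
  next
    case (exit c' i')
    then have "c' = c" using a copy_eq_iff[OF exit(3) a(2)] by simp
    moreover from this have "i' = length (trail c) - 1" using exit(4) trail(3)[OF c(1)] by simp
    ultimately show ?thesis using exit(1) ab(2) by simp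
  next
    case (inner c')
    then obtain i' x' where *: "a = copy c' i' x'" "(c', i', x') \<in> cells"
      by (auto simp: inner_def)
    then have "c' = c" using a(1) copy_eq_iff[OF *(2) a(2)] by simp
    then have "(a, b) \<in> inner c \<inter> set_mset E'" using inner ab(1) by simp
    then have "b \<in> R" using ab(2) unfolding R_def by (simp add: rtrancl_into_rtrancl)
    then show ?thesis using ab(3) by simp
  qed
  then obtain p where "p \<noteq> []" "distinct p" "hd p = copy c 0 (src c)"
      "last p = copy c (length (trail c) - 1) (tgt c)" "set (vwalk_arcs p) \<subseteq> inner c \<inter> set_mset E'"
    unfolding R_def mem_Collect_eq by (drule_tac rtrancl_imp_path) blast
  then show ?thesis using c by blast
qed

lemma total_weight_infinite:
  assumes "\<And>a. a \<in># M \<Longrightarrow> 0 \<le> f a" "a \<in># M" "f a = (\<infinity> :: ereal)"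
  shows "total_weight f M = \<infinity>"
proof -
  obtain N where N: "M = add_mset a N" using multi_member_split[OF assms(2)] by blast
  have "0 \<le> total_weight f K" if "\<And>a. a \<in># K \<Longrightarrow> 0 \<le> f a" for K
    using that
  proof (induction K)
    case (add b K)
    then have "0 \<le> f b" "0 \<le> total_weight f K" by simp_all
    then show ?case by simp
  qed simp
  then have "0 \<le> total_weight f N" using assms(1) N by simp
  then show ?thesis using N assms(3) by simp
qed

text \<open>\<open>E\<close> is the image of \<open>E'\<close> under \<open>proj\<close> without
  loops. Balanced copies contribute nothing to the balance of their original vertex, and for
  connectivity a hub is sent to the start of its realization.\<close>

lemma extension_if_extension_of_new:
  assumes E': "eulerian_extension new_verts new_arcs E'" and finite: "total_weight w' E' < \<infinity>"
  shows "\<exists>E. eulerian_extension V A E \<and> total_weight w E \<le> total_weight w' E' \<and> heeds V A E (hint ` H)"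
proof -
  have arcsE': "arcs_on new_verts E'" using E' by (simp add: eulerian_extension_def)
  then have "arcs_on new_verts (new_arcs + E')" using arcs_on_new by (auto simp: arcs_on_def)
  then have eul: "new_verts \<noteq> {}" "new_verts \<times> new_verts \<subseteq> linked (new_arcs + E')"
      "\<And>v. v \<in> new_verts \<Longrightarrow> net (new_arcs + E') v = 0"
    using E' eulerian_iff[OF finite_new_verts] by (auto simp: eulerian_extension_def)
  have w'_links: "w' (a, b) = (if proj a = proj b then w' (a, b) else w (proj a, proj b)) \<and> 0 \<le> w' (a, b)"
    if "(a, b) \<in> links" for a b
    using that
  proof (cases rule: links.cases)
    case (original x y)
    then show ?thesis using w'_original w_nonneg by auto
  next
    case (entry c)
    then show ?thesis using w'_entry by auto
  next
    case (exit c i)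
    then show ?thesis using w'_exit by auto
  next
    case (inner c)
    then show ?thesis using w'_inner w_nonneg links_cells_proj(1,2)[OF that] by auto
  qed
  \<comment> \<open>All weights are nonnegative, so a single arc of infinite weight would make the
    total infinite.\<close>
  have links: "set_mset E' \<subseteq> links"
  proof
    fix a assume a: "a \<in># E'"
    have new: "e \<in> new_verts \<times> new_verts" if "e \<in># E'" for e
      using that arcsE' by (auto simp: arcs_on_def)
    have "0 \<le> w' e" if "e \<in># E'" for e
      using w'_links w'_infinite[OF new[OF that]] by (cases e; cases "e \<in> links") auto
    then have "w' a \<noteq> \<infinity>" using total_weight_infinite[OF _ a] finite by fastforce
    then show "a \<in> links" using w'_infinite[OF new[OF a]] by blast
  qed
  define pr where "pr M = {#a \<in># image_mset (map_prod proj proj) M. fst a \<noteq> snd a#}" for M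
  define E where "E = pr E'"
  have "total_weight w (pr M) \<le> total_weight w' M" if "set_mset M \<subseteq> links" for M
    using that
  proof (induction M)
    case (add a M)
    obtain u v where a: "a = (u, v)" by (cases a)
    have l: "(u, v) \<in> links" and IH: "total_weight w (pr M) \<le> total_weight w' M"
      using add a by auto
    show ?case
    proof (cases "proj u = proj v")
      case True
      then show ?thesis using IH w'_links[OF l] by (simp add: a pr_def add_increasing)
    next
      case False
      then have "w (proj u, proj v) = w' (u, v)" using w'_links[OF l] by simp
      then show ?thesis using IH False by (simp add: a pr_def add_left_mono)
    qed
  qed (simp add: pr_def)
  then have weight: "total_weight w E \<le> total_weight w' E'" using links by (simp add: E_def)
  have arcsE: "arcs_on V E"
    using links links_cells_proj(1,2) by (fastforce simp: arcs_on_def E_def pr_def)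
  then have arcsAE: "arcs_on V (A + E)" using arcs_A by (auto simp: arcs_on_def)
  from chain_path_exists[OF E' links]
  have "\<forall>k\<in>H. \<exists>z. fst z \<in> C \<and> owner (fst z) = k \<and> snd z \<noteq> [] \<and> distinct (snd z) \<and>
    set (vwalk_arcs (snd z)) \<subseteq> inner (fst z) \<inter> set_mset E' \<and> hd (snd z) = copy (fst z) 0 (src (fst z)) \<and>
    (fst z, 0, src (fst z)) \<in> cells \<and>
    last (snd z) = copy (fst z) (length (trail (fst z)) - 1) (tgt (fst z))" by simp
  from bchoice[OF this] obtain g where g: "\<And>k. k \<in> H \<Longrightarrow> fst (g k) \<in> C"
    "\<And>k. k \<in> H \<Longrightarrow> owner (fst (g k)) = k" "\<And>k. k \<in> H \<Longrightarrow> snd (g k) \<noteq> []"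
    "\<And>k. k \<in> H \<Longrightarrow> distinct (snd (g k))"
    "\<And>k. k \<in> H \<Longrightarrow> set (vwalk_arcs (snd (g k))) \<subseteq> inner (fst (g k)) \<inter> set_mset E'"
    "\<And>k. k \<in> H \<Longrightarrow> hd (snd (g k)) = copy (fst (g k)) 0 (src (fst (g k)))"
    "\<And>k. k \<in> H \<Longrightarrow> (fst (g k), 0, src (fst (g k))) \<in> cells"
    "\<And>k. k \<in> H \<Longrightarrow> last (snd (g k)) = copy (fst (g k)) (length (trail (fst (g k))) - 1) (tgt (fst (g k)))"
    by blast
  define q where "q k = map proj (snd (g k))" for k
  have realizes: "realizes V A (q k) (hint k)" if "k \<in> H" for k
    using realizes_proj_path[OF g(1) _ g(3,4,6,7,8)] g(2,5) that by (simp add: q_def)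
  \<comment> \<open>Equal projections would mean the same vertex in consecutive layers, whose
    components differ. So no arc of a realization is lost when loops are removed.\<close>
  have walk_arcs: "proj a \<noteq> proj b" if ab: "(a, b) \<in> inner c" "(a, b) \<in># E'" for a b c
  proof
    assume eq: "proj a = proj b"
    obtain i x j y where ij: "a = copy c i x" "b = copy c j y" "(c, i, x) \<in> cells"
        "(c, j, y) \<in> cells" "j = i \<or> j = Suc i"
      using ab(1) by (auto simp: inner_def)
    then have "x = y" using eq by simp
    have "a \<noteq> b" using ab(2) arcsE' by (auto simp: arcs_on_def)
    then have "j = Suc i" using ij \<open>x = y\<close> by auto
    moreover have "trail c ! i = trail c ! j"
      using cells_trail(3)[OF ij(3)] cells_trail(3)[OF ij(4)] \<open>x = y\<close> by simp
    ultimately show False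
      using trail_adj[of c i] cells_D[OF ij(3)] cells_trail(1)[OF ij(4)] by simp
  qed
  \<comment> \<open>Chains with different owners share no arc and each path is simple, so together
    the paths use every arc of \<open>E'\<close> at most once; the projection preserves inclusion of
    multisets.\<close>
  have q_sum: "(\<Sum>k\<in>H. mset (vwalk_arcs (q k))) \<subseteq># E"
  proof -
    have "(\<Sum>k\<in>H. mset (vwalk_arcs (snd (g k)))) \<subseteq># E'"
    proof (rule sum_mset_disjoint_subseteq[OF finite_H])
      fix k l assume kl: "k \<in> H" "l \<in> H" "k \<noteq> l"
      have "inner (fst (g k)) \<inter> inner (fst (g l)) = {}"
      proof (rule ccontr)
        assume "inner (fst (g k)) \<inter> inner (fst (g l)) \<noteq> {}"
        then obtain a b where "(a, b) \<in> inner (fst (g k))" "(a, b) \<in> inner (fst (g l))" by auto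
        then obtain i x j y where *: "a = copy (fst (g k)) i x" "(fst (g k), i, x) \<in> cells"
            "a = copy (fst (g l)) j y" "(fst (g l), j, y) \<in> cells"
          unfolding inner_def by blast
        then have "fst (g k) = fst (g l)" using copy_eq_iff[OF *(2,4)] by simp
        then show False using g(2) kl by metis
      qed
      then show "set (vwalk_arcs (snd (g k))) \<inter> set (vwalk_arcs (snd (g l))) = {}"
        using g(5) kl by blast
    next
      fix k assume k: "k \<in> H"
      show "distinct (vwalk_arcs (snd (g k)))" using distinct_vwalk_arcs[OF g(4)[OF k]] .
      show "set (vwalk_arcs (snd (g k))) \<subseteq> set_mset E'" using g(5)[OF k] by blast
    qed
    then have "pr (\<Sum>k\<in>H. mset (vwalk_arcs (snd (g k)))) \<subseteq># E"
      unfolding E_def pr_def by (intro multiset_filter_mono image_mset_subseteq_mono)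
    moreover have "pr (\<Sum>k\<in>I. mset (vwalk_arcs (snd (g k)))) = (\<Sum>k\<in>I. mset (vwalk_arcs (q k)))"
      if "finite I" "I \<subseteq> H" for I
      using that
    proof (induction I rule: finite_induct)
      case (insert k I)
      have "pr (mset (vwalk_arcs (snd (g k)))) = image_mset (map_prod proj proj) (mset (vwalk_arcs (snd (g k))))"
        unfolding filter_mset_eq_conv pr_def using g(5)[of k] insert.prems walk_arcs by fastforce
      then show ?case using insert by (simp add: q_def vwalk_arcs_map pr_def)
    qed (simp add: pr_def)
    ultimately show ?thesis using finite_H by simp
  qed
  have heeds: "heeds V A E (hint ` H)"
  proof -
    note q_sum
    moreover define f where "f h = q (inv_into H hint h)" for h
    have f: "f (hint k) = q k" if "k \<in> H" for k using inj_hint that by (simp add: f_def)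
    ultimately have "(\<Sum>h\<in>hint ` H. mset (vwalk_arcs (f h))) \<subseteq># E"
      by (simp add: sum.reindex[OF inj_hint] f)
    moreover have "\<forall>h\<in>hint ` H. realizes V A (f h) h" using realizes f by simp
    ultimately show ?thesis unfolding heeds_def by blast
  qed
  have q_sub: "mset (vwalk_arcs (q k)) \<subseteq># E" if "k \<in> H" for k
    using q_sum unfolding sum.remove[OF finite_H that]
    by (rule subset_mset.order_trans[rotated]) simp
  have net: "net (A + E) x = 0" if x: "x \<in> V" for x
  proof -
    let ?D = "orig ` V \<union> copies"
    have D: "finite ?D" using finite_V finite_cells by (simp add: copies_def)
    have "net E x = net (image_mset (map_prod proj proj) E') x"
      unfolding E_def pr_def by (rule net_filter_loops)
    also have "\<dots> = (\<Sum>z\<in>{z \<in> ?D. proj z = x}. net E' z)"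
      by (rule net_image[OF D]) (use links links_cells_proj(3,4) in force)
    also have "\<dots> = (\<Sum>z\<in>{orig x}. net E' z)"
    proof (rule sum.mono_neutral_right)
      show "\<forall>z\<in>{z \<in> ?D. proj z = x} - {orig x}. net E' z = 0"
      proof
        fix z assume "z \<in> {z \<in> ?D. proj z = x} - {orig x}"
        then obtain c i y where z: "(c, i, y) \<in> cells" "z = copy c i y"
          by (auto simp: copies_def)
        then show "net E' z = 0"
          using eul(3)[OF copy_in_new_verts[OF z(1)]] net_new_arcs_other[of z] copy_distinct(1)[OF z(1)]
          by simp
      qed
    qed (use D x in auto)
    finally have "net E x = net E' (orig x)" by simp
    moreover have "net (new_arcs + E') (orig x) = 0" using eul(3) x by (simp add: new_verts_def)
    ultimately show ?thesis by (simp add: net_new_arcs_orig)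
  qed
  \<comment> \<open>Extends \<open>proj\<close> to hubs. The realization meets all components of its
    hint, in particular those of all first-layer copies tied to the hub, also in chains that
    \<open>E'\<close> does not use.\<close>
  define rep where "rep z = (if z \<in> hub ` H then hd (q (inv_into H hub z)) else proj z)" for z
  have rep_orig: "rep (orig x) = x" for x
    using hub_neq_orig[symmetric] by (auto simp: rep_def)
  have rep_copy: "rep (copy c i x) = x" if "(c, i, x) \<in> cells" for c i x
    using copy_distinct(2)[OF that] by (auto simp: rep_def)
  have rep_hub: "rep (hub k) = hd (q k)" if "k \<in> H" for k
    using that inj_hub by (simp add: rep_def)
  have A_sub: "A \<subseteq># A + E" and E_sub: "E \<subseteq># A + E" by simp_all
  have hub_linked: "(hd (q k), x) \<in> linked (A + E)"
    if k: "k \<in> H" and x: "x \<in> V" "component_of V A x \<in> set (hint_trail (hint k))" for k x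
  proof -
    have meta: "set (hint_trail (hint k)) = set (meta V A (q k))" "set (q k) \<subseteq> V" "q k \<noteq> []"
      using realizes[OF k] same_trail_component_walk(3)[OF hint_on_component_walk[OF hint_ok[OF k]]]
      by (cases "hint k"; auto simp: vwalk_full_digraph)+
    then obtain y where y: "y \<in> set (q k)" "component_of V A y = component_of V A x"
      using x(2) by (auto simp: meta_def)
    then have "(y, x) \<in> linked A" using component_of_eq_iff[OF arcs_A] meta(2) x(1) by blast
    moreover have "set (vwalk_arcs (q k)) \<subseteq> linked E"
      using q_sub[OF k] by (auto intro!: linked_arc dest: mset_subset_eqD)
    then have "(hd (q k), y) \<in> linked E" using linked_vwalk[OF _ y(1)] by simp
    ultimately show ?thesis
      using linked_mono[OF A_sub] linked_mono[OF E_sub] by (blast intro: linked_trans)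
  qed
  have "(x, y) \<in> linked (A + E)" if xy: "x \<in> V" "y \<in> V" for x y
  proof -
    have "(rep (orig x), rep (orig y)) \<in> linked (A + E)"
    proof (rule linked_least[where f = rep and M = "new_arcs + E'"])
      show "(orig x, orig y) \<in> linked (new_arcs + E')" using eul(2) xy by (auto simp: new_verts_def)
      fix a b assume "(a, b) \<in># new_arcs + E'"
      then consider u v where "(u, v) \<in># A" "a = orig u" "b = orig v" | "(a, b) \<in># ties" | "(a, b) \<in># E'"
        by (auto simp: new_arcs_def)
      then show "(rep a, rep b) \<in> linked (A + E)"
      proof cases
        case 1
        then show ?thesis by (simp add: rep_orig linked_arc)
      next
        case 2
        then obtain c i x where z: "(c, i, x) \<in> cells" "(a, b) = (copy c i x, anchor (c, i, x)) \<or>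
            (a, b) = (anchor (c, i, x), copy c i x)"
          by (auto simp: in_ties simp del: anchor.simps)
        have c: "c \<in> C" "owner c \<in> H" using chain cells_D[OF z(1)] by auto
        have "(rep (anchor (c, i, x)), x) \<in> linked (A + E)"
        proof (cases "i = 0")
          case True
          have "component_of V A x \<in> set (trail c)" using cells_trail(1,3)[OF z(1)] by simp
          also have "set (trail c) = set (hint_trail (hint (owner c)))"
            using same_trail_component_walk(3)[OF hint_on_component_walk[OF hint_ok[OF c(2)]] trail(1)[OF c(1)]] .
          finally show ?thesis using hub_linked[OF c(2) cells_V[OF z(1)]] True rep_hub[OF c(2)] by simp
        qed (simp add: rep_orig)
        then show ?thesis using z(2) rep_copy[OF z(1)] linked_sym by auto
      next
        case 3
        then have ab: "(a, b) \<in> links" using links by blast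
        have "rep a = proj a" "rep b = proj b"
          using links_cells_proj(3,4)[OF ab] rep_orig rep_copy by (auto simp: copies_def)
        moreover have "(proj a, proj b) \<in> linked (A + E)"
        proof (cases "proj a = proj b")
          case False
          then have "(proj a, proj b) \<in># E" using 3 by (force simp: E_def pr_def)
          then show ?thesis by (simp add: linked_arc)
        qed simp
        ultimately show ?thesis by simp
      qed
    qed
    then show ?thesis by (simp add: rep_orig)
  qed
  moreover have "V \<noteq> {}"
  proof -
    obtain z where "z \<in> new_verts" using eul(1) by blast
    then show ?thesis
    proof (cases rule: new_verts_cases)
      case (hub k)
      then show ?thesis using realizes[OF hub(1)] by (cases "hint k") (auto simp: vwalk_full_digraph neq_Nil_conv)
    qed (use cells_V in auto)
  qed
  ultimately have "eulerian_extension V A E"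
    unfolding eulerian_extension_def using eulerian_iff[OF finite_V arcsAE] net arcsE by auto
  with weight heeds show ?thesis by blast
qed

end

section \<open>The reduction as a function on trees\<close>

text \<open>
  A chain \<open>c\<close> is the tree \<open>Node h (Node ls (Node v u))\<close> for a hint \<open>h\<close>, layers \<open>ls\<close> and the end
  vertices \<open>v\<close> and \<open>u\<close>.  A copy is \<open>Node (Node c r) x\<close>, where the suffix \<open>r\<close> of \<open>ls\<close> starting at the
  layer of the copy stands for the index of the layer.
\<close>

abbreviation (input) orig :: "tree \<Rightarrow> tree" where
  "orig v \<equiv> Node Leaf v"

abbreviation (input) hub :: "tree \<Rightarrow> tree" where
  "hub h \<equiv> Node (Node Leaf Leaf) h"

abbreviation (input) chain_owner :: "tree \<Rightarrow> tree" where
  "chain_owner c \<equiv> left c"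

abbreviation (input) chain_layers :: "tree \<Rightarrow> tree" where
  "chain_layers c \<equiv> left (right c)"

abbreviation (input) chain_src :: "tree \<Rightarrow> tree" where
  "chain_src c \<equiv> left (right (right c))"

abbreviation (input) chain_tgt :: "tree \<Rightarrow> tree" where
  "chain_tgt c \<equiv> right (right (right c))"

text \<open>
  If \<open>b\<close> is distinct, its elements outside a suffix form the complementary prefix.  This yields
  rotations, each closed up by its first element.
\<close>

definition rotations :: "tree list \<Rightarrow> tree list" where
  "rotations b =
     map (\<lambda>r. tree_of_list ((elems r @ filter (\<lambda>K. K \<notin> set (elems r)) b) @ [left r])) (tails b)"

text \<open>One component may be listed in different orders at the two ends, so a closed trail is
  recognized by a vertex of the first component that occurs in the last one, not by equality of
  trees. Dropping a head between two reversals removes the last entry.\<close>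

definition variants :: "tree \<Rightarrow> tree list" where
  "variants t =
     (if left (left t) \<in> set (elems (left (tree_of_list (rev (elems t)))))
      then rotations (rev (tl (rev (elems t)))) @ rotations (rev (tl (elems t)))
      else [t, tree_of_list (rev (elems t))])"

definition more_in :: "tree list \<Rightarrow> tree \<Rightarrow> bool" where
  "more_in A v \<longleftrightarrow> length (filter (\<lambda>e. left e = v) A) < length (filter (\<lambda>e. right e = v) A)"

definition more_out :: "tree list \<Rightarrow> tree \<Rightarrow> bool" where
  "more_out A v \<longleftrightarrow> length (filter (\<lambda>e. right e = v) A) < length (filter (\<lambda>e. left e = v) A)"

text \<open>The tag \<open>Leaf\<close> marks path hints, which take all pairs of ends whose
  balances have the right signs. For cycle hints the first layer of \<open>s\<close> is replaced by
  the one-element list \<open>Node v Leaf\<close>.\<close>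

definition chains :: "tree list \<Rightarrow> tree list \<Rightarrow> tree \<Rightarrow> tree list" where
  "chains V A h =
     (if left h = Leaf
      then concat (map (\<lambda>s. concat (map (\<lambda>v. map (\<lambda>u. Node h (Node s (Node v u)))
        (filter (\<lambda>u. more_out A u) V)) (filter (\<lambda>v. more_in A v) V))) (variants (right h)))
      else concat (map (\<lambda>s. map (\<lambda>v. Node h (Node (Node (Node v Leaf) (right s)) (Node v v)))
        (elems (left s))) (variants (right h))))"

text \<open>\<open>remdups\<close> makes the copies distinct, as the encoding of a set demands, and
  lets each copy receive its ties once.\<close>

definition copy_list :: "tree list \<Rightarrow> tree list \<Rightarrow> tree list \<Rightarrow> tree list" where
  "copy_list V A H =
     remdups (concat (map (\<lambda>h. concat (map (\<lambda>c. concat (map (\<lambda>r. map (\<lambda>x. Node (Node c r) x)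
       (elems (left r))) (tails (elems (chain_layers c))))) (chains V A h))) H))"

definition vertex_list :: "tree list \<Rightarrow> tree list \<Rightarrow> tree list \<Rightarrow> tree list" where
  "vertex_list V A H = map (\<lambda>v. orig v) V @ map (\<lambda>h. hub h) H @ copy_list V A H"

text \<open>A copy lies in the first layer iff its suffix is the whole list of layers.\<close>

definition anchor_of :: "tree \<Rightarrow> tree" where
  "anchor_of z =
     (if right (left z) = chain_layers (left (left z)) then hub (chain_owner (left (left z)))
      else orig (right z))"

definition arc_list :: "tree list \<Rightarrow> tree list \<Rightarrow> tree list \<Rightarrow> tree list" where
  "arc_list V A H =
     map (\<lambda>e. Node (orig (left e)) (orig (right e))) A @
     concat (map (\<lambda>z. [Node z (anchor_of z), Node (anchor_of z) z]) (copy_list V A H))"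

definition lookup :: "tree list \<Rightarrow> tree \<Rightarrow> tree" where
  "lookup W e = right (left (tree_of_list (filter (\<lambda>p. left p = e) W)))"

text \<open>The fraction \<open>0 / 1\<close>.\<close>

definition zero_tree :: tree where
  "zero_tree = Node Leaf (Node (Node Leaf Leaf) Leaf)"

text \<open>Vertices are told apart by their left subtree: \<open>Leaf\<close> for original
  vertices, \<open>Node Leaf Leaf\<close> for hubs, and a pair with a chain other than
  \<open>Leaf\<close> for copies. The last layer has a suffix with empty tail, and the next layer is
  \<open>right\<close> of the current suffix. The result \<open>Leaf\<close> encodes an infinite
  weight.\<close>

definition weight_tree :: "tree list \<Rightarrow> tree \<Rightarrow> tree \<Rightarrow> tree" where
  "weight_tree W a b =
     (if left a = Leaf then
        if left b = Leaf then lookup W (Node (right a) (right b))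
        else if left (left b) \<noteq> Leaf \<and> right (left b) = chain_layers (left (left b)) \<and>
          right a = right b \<and> right b = chain_src (left (left b)) then zero_tree
        else Leaf
      else if left (left a) = Leaf then Leaf
      else if left b = Leaf then
        if right (right (left a)) = Leaf \<and> right a = right b \<and> right a = chain_tgt (left (left a))
        then zero_tree else Leaf
      else if left (left a) = left (left b) \<and>
        (right (left b) = right (left a) \<or> right (left b) = right (right (left a)))
      then lookup W (Node (right a) (right b)) else Leaf)"

definition weight_list :: "tree list \<Rightarrow> tree list \<Rightarrow> tree list" where
  "weight_list W V = concat (map (\<lambda>a. map (\<lambda>b. Node (Node a b) (weight_tree W a b)) V) V)"

definition reduction :: "tree \<Rightarrow> tree" where
  "reduction x =
     (let V = elems (left (left x)); A = elems (left (right (left x))); H = elems (right x);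
        W = elems (left (right (right (right (left x)))))
      in tree_of_list
        [tree_of_list (vertex_list V A H), tree_of_list (arc_list V A H),
         left (right (right (left x))), tree_of_list (weight_list W (vertex_list V A H))])"

section \<open>Running time of the reduction\<close>

lemma poly_time_list_comp: "poly_time_list l \<Longrightarrow> poly_time f \<Longrightarrow> poly_time_list (\<lambda>x. l (f x))"
  unfolding poly_time_list_def by (rule poly_time_comp)

lemma poly_time_rotations [poly_time_intros]:
  assumes "poly_time_list b"
  shows "poly_time_list (\<lambda>x. rotations (b x))"
  unfolding rotations_def
  by (intro poly_time_intros assms poly_time_list_comp[OF assms, of left]
      poly_time_list_comp[OF assms, of "\<lambda>x. left (left x)"])

lemma poly_time_variants [poly_time_intros]:
  "poly_time f \<Longrightarrow> poly_time_list (\<lambda>x. variants (f x))"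
  unfolding variants_def by (intro poly_time_intros)

lemma poly_time_more [poly_time_intros]:
  assumes "poly_time_list A" "poly_time f"
  shows "poly_time_test (\<lambda>x. more_in (A x) (f x))" "poly_time_test (\<lambda>x. more_out (A x) (f x))"
  unfolding more_in_def more_out_def
  by (intro poly_time_intros assms poly_time_comp[OF assms(2), of left])+

text \<open>The arguments are packed into a single tree, so that the nested maps only see
  projections of one variable.\<close>

lemma poly_time_chains [poly_time_intros]:
  assumes "poly_time_list V" "poly_time_list A" "poly_time f"
  shows "poly_time_list (\<lambda>x. chains (V x) (A x) (f x))"
proof -
  have "poly_time_list (\<lambda>x. chains (elems (left x)) (elems (left (right x))) (right (right x)))"
    unfolding chains_def by (intro poly_time_intros)
  from poly_time_list_comp[OF this, of "\<lambda>x. Node (tree_of_list (V x)) (Node (tree_of_list (A x)) (f x))"]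
  show ?thesis using assms by (simp add: poly_time_intros)
qed

lemma poly_time_copy_list [poly_time_intros]:
  assumes "poly_time_list V" "poly_time_list A" "poly_time_list H"
  shows "poly_time_list (\<lambda>x. copy_list (V x) (A x) (H x))"
proof -
  have "poly_time_list (\<lambda>x. copy_list (elems (left x)) (elems (left (right x))) (elems (right (right x))))"
    unfolding copy_list_def by (intro poly_time_intros)
  from poly_time_list_comp[OF this,
      of "\<lambda>x. Node (tree_of_list (V x)) (Node (tree_of_list (A x)) (tree_of_list (H x)))"]
  show ?thesis using assms by (simp add: poly_time_intros)
qed

lemma poly_time_vertex_list [poly_time_intros]:
  assumes "poly_time_list V" "poly_time_list A" "poly_time_list H"
  shows "poly_time_list (\<lambda>x. vertex_list (V x) (A x) (H x))"
  unfolding vertex_list_def by (intro poly_time_intros assms)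

lemma poly_time_anchor_of [poly_time_intros]:
  "poly_time f \<Longrightarrow> poly_time (\<lambda>x. anchor_of (f x))"
  unfolding anchor_of_def by (intro poly_time_intros)

lemma poly_time_arc_list [poly_time_intros]:
  assumes "poly_time_list V" "poly_time_list A" "poly_time_list H"
  shows "poly_time_list (\<lambda>x. arc_list (V x) (A x) (H x))"
  unfolding arc_list_def by (intro poly_time_intros assms)

lemma poly_time_lookup [poly_time_intros]:
  assumes "poly_time_list W" "poly_time f"
  shows "poly_time (\<lambda>x. lookup (W x) (f x))"
  unfolding lookup_def by (intro poly_time_intros assms poly_time_comp[OF assms(2), of left])

lemma poly_time_weight_tree [poly_time_intros]:
  assumes "poly_time_list W" "poly_time f" "poly_time g"
  shows "poly_time (\<lambda>x. weight_tree (W x) (f x) (g x))"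
  unfolding weight_tree_def by (intro poly_time_intros assms)

lemma poly_time_weight_list [poly_time_intros]:
  assumes "poly_time_list W" "poly_time_list V"
  shows "poly_time_list (\<lambda>x. weight_list (W x) (V x))"
proof -
  have "poly_time_list (\<lambda>x. weight_list (elems (left x)) (elems (right x)))"
    unfolding weight_list_def by (intro poly_time_intros)
  from poly_time_list_comp[OF this, of "\<lambda>x. Node (tree_of_list (W x)) (tree_of_list (V x))"]
  show ?thesis using assms by (simp add: poly_time_intros)
qed

lemma poly_time_reduction: "poly_time reduction"
proof -
  have "poly_time (\<lambda>x. reduction x)"
    unfolding reduction_def Let_def by (intro poly_time_intros)
  then show ?thesis by simp
qed

section \<open>Correctness of the reduction\<close>

lemma tree_of_nat_inject: "tree_of_nat m = tree_of_nat n \<Longrightarrow> m = n"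
proof (induction m arbitrary: n rule: less_induct)
  case (less m)
  show ?case
  proof (cases "m = 0 \<or> n = 0")
    case True
    then show ?thesis using less.prems tree_of_nat.simps[of m] tree_of_nat.simps[of n]
      by (auto split: if_splits)
  next
    case False
    then have "tree_of_nat (m div 2) = tree_of_nat (n div 2)" "even m = even n"
      using less.prems tree_of_nat.simps[of m] tree_of_nat.simps[of n] by (auto split: if_splits)
    then have "m div 2 = n div 2" "even m = even n" using less.IH[of "m div 2"] False by auto
    then show ?thesis by (metis dvd_mult_div_cancel odd_two_times_div_two_succ)
  qed
qed

text \<open>A value may be written as many fractions, but a tree determines its fraction and hence
  its value.\<close>

lemma encodes_weight_unique: "encodes_weight t a \<Longrightarrow> encodes_weight t b \<Longrightarrow> a = b"
  by (auto simp: encodes_weight_def encodes_real_def dest!: tree_of_nat_inject)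

definition decode_weight :: "tree \<Rightarrow> ereal" where
  "decode_weight t = (THE a. encodes_weight t a)"

lemma decode_weight_eq: "encodes_weight t a \<Longrightarrow> decode_weight t = a"
  unfolding decode_weight_def by (rule the_equality) (auto intro: encodes_weight_unique)

lemma encodes_weight_Leaf: "encodes_weight Leaf \<infinity>"
  by (simp add: encodes_weight_def)

lemma encodes_weight_zero: "encodes_weight zero_tree 0"
proof -
  have "tree_of_nat 0 = Leaf" "tree_of_nat 1 = Node (Node Leaf Leaf) Leaf"
    by (simp_all add: tree_of_nat.simps)
  then have "encodes_real zero_tree 0"
    unfolding encodes_real_def by (intro exI[of _ 0] exI[of _ 1]) (simp add: zero_tree_def)
  then show ?thesis unfolding encodes_weight_def by (metis zero_ereal_def)
qed

definition decode_set :: "tree \<Rightarrow> tree set" where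
  "decode_set K = set (elems K)"

definition decode_hint :: "tree \<Rightarrow> tree hint" where
  "decode_hint h = (if left h = Leaf then Path_Hint else Cycle_Hint) (map decode_set (elems (right h)))"

lemma decode_hint_eq: "encodes_hint t h \<Longrightarrow> decode_hint t = h"
proof -
  assume "encodes_hint t h"
  then obtain ts where ts: "list_all2 encodes_set ts (hint_trail h)"
      "t = Node (if is_Path_Hint h then Leaf else Node Leaf Leaf) (tree_of_list ts)"
    by (auto simp: encodes_hint_def)
  have "map decode_set ts = hint_trail h"
    using ts(1) by (induction rule: list_all2_induct) (auto simp: encodes_set_def decode_set_def)
  with ts(2) show ?thesis by (cases h) (auto simp: decode_hint_def)
qed

section \<open>Enumeration of all traversals of a hint\<close>

lemma tails_eq: "tails l = map (\<lambda>i. tree_of_list (drop i l)) [0..<length l]"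
proof (induction l)
  case (Cons t l)
  show ?case unfolding tails.simps Cons by (simp add: map_upt_Suc del: upt_Suc)
qed simp

lemma left_drop: "i < length l \<Longrightarrow> left (tree_of_list (drop i l)) = l ! i"
  by (simp add: left_tree_of_list hd_drop_conv_nth)

lemma set_rotations:
  assumes "distinct b" "b \<noteq> []"
  shows "elems ` set (rotations b) = range (\<lambda>n. rotate n b @ [hd (rotate n b)])"
proof -
  have r: "(elems (tree_of_list (drop i b)) @ filter (\<lambda>K. K \<notin> set (elems (tree_of_list (drop i b)))) b) @
      [left (tree_of_list (drop i b))] = rotate i b @ [hd (rotate i b)]" if i: "i < length b" for i
  proof -
    have "filter (\<lambda>K. K \<notin> set (drop i b)) (take i b) = take i b"
      using set_take_disj_set_drop_if_distinct[OF assms(1), of i i] by (intro filter_True) auto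
    moreover have "filter (\<lambda>K. K \<notin> set (drop i b)) (drop i b) = []" by simp
    ultimately have "filter (\<lambda>K. K \<notin> set (drop i b)) b = take i b"
      by (metis append_Nil2 append_take_drop_id filter_append)
    moreover have "rotate i b = drop i b @ take i b" using i by (simp add: rotate_drop_take)
    moreover have "hd (drop i b @ take i b) = b ! i" using i by (simp add: hd_append hd_drop_conv_nth)
    ultimately show ?thesis using left_drop[OF i] by simp
  qed
  have "elems ` set (rotations b) = (\<lambda>i. rotate i b @ [hd (rotate i b)]) ` {..<length b}"
    unfolding rotations_def tails_eq using r by (force simp: image_iff)
  also have "\<dots> = range (\<lambda>n. rotate n b @ [hd (rotate n b)])"
  proof (intro equalityI subsetI)
    fix s assume "s \<in> range (\<lambda>n. rotate n b @ [hd (rotate n b)])"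
    then obtain n where n: "s = rotate n b @ [hd (rotate n b)]" by blast
    \<comment> \<open>Rotations depend on \<open>n\<close> only modulo the length, so the finitely
      many suffixes give all of them.\<close>
    have "rotate n b = rotate (n mod length b) b" by (rule rotate_conv_mod)
    then show "s \<in> (\<lambda>i. rotate i b @ [hd (rotate i b)]) ` {..<length b}"
      using n assms(2) by (intro image_eqI[of _ _ "n mod length b"]) simp_all
  qed auto
  finally show ?thesis .
qed

text \<open>Both sides are compared after decoding, since encodings of sets are not unique.
  Components are nonempty and disjoint, which justifies testing for a closed trail with one
  vertex.\<close>

lemma set_variants:
  assumes arcs: "arcs_on V A" and walk: "component_walk V A (map decode_set (elems t))"
  shows "(\<lambda>s. map decode_set (elems s)) ` set (variants t) = {s. same_trail (map decode_set (elems t)) s}"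
proof -
  define l where "l = elems t"
  define T where "T = map decode_set l"
  have t: "t = tree_of_list l" by (simp add: l_def)
  have wT: "component_walk V A T" using walk by (simp add: T_def l_def)
  then have l2: "2 \<le> length l" and l: "l \<noteq> []" by (auto simp: component_walk_def T_def)
  have comp: "decode_set K \<in> components V A" if "K \<in> set l" for K
    using wT that by (auto simp: component_walk_def T_def)
  have "left t = hd l" "left (tree_of_list (rev l)) = last l"
    using l by (simp_all add: t left_tree_of_list hd_rev)
  moreover have closed: "left (hd l) \<in> set (elems (last l)) \<longleftrightarrow> closed_list T"
  proof -
    let ?x = "left (hd l)"
    have "decode_set (hd l) \<noteq> {}" using component_nonempty[OF arcs comp] l by simp
    then have "?x \<in> decode_set (hd l)"
      by (cases "hd l") (auto simp: decode_set_def)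
    then have 1: "component_of V A ?x = hd T"
      using in_component(2)[OF arcs comp] l by (simp add: T_def hd_map)
    have "?x \<in> set (elems (last l)) \<longleftrightarrow> component_of V A ?x = last T"
    proof
      assume "?x \<in> set (elems (last l))"
      then show "component_of V A ?x = last T"
        using in_component(2)[OF arcs comp] l by (simp add: T_def last_map decode_set_def)
    next
      assume "component_of V A ?x = last T"
      then show "?x \<in> set (elems (last l))"
        using \<open>?x \<in> decode_set (hd l)\<close> 1 l by (simp add: T_def last_map hd_map decode_set_def)
    qed
    then show ?thesis using 1 l2 by (simp add: closed_list_def T_def)
  qed
  ultimately have v: "variants t = (if closed_list T then rotations (butlast l) @ rotations (butlast (rev l))
      else [t, tree_of_list (rev l)])"
    by (simp add: variants_def l_def[symmetric] butlast_rev[of "rev l", simplified] butlast_rev)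
  have "(\<lambda>s. map decode_set (elems s)) ` set (variants t) = {s. same_trail T s}"
  proof (cases "closed_list T")
    case False
    then have "{s. same_trail T s} = {T, rev T}" by (auto simp: same_trail_def)
    with False show ?thesis by (simp add: v T_def rev_map l_def)
  next
    case True
    have dist: "distinct (butlast T)" "distinct (tl T)"
    proof -
      obtain B where B: "B \<noteq> []" "T = B @ [hd B]" using True by (auto simp: closed_list_iff)
      have "distinct B" using wT unfolding B(2) component_walk_closed_iff[OF B(1)] by blast
      then show "distinct (butlast T)" "distinct (tl T)"
        unfolding B(2) tl_append_hd[OF B(1)] by simp_all
    qed
    have rot: "(\<lambda>s. map decode_set (elems s)) ` set (rotations b) =
        {s. closed_list s \<and> (\<exists>n. butlast s = rotate n (map decode_set b))}"
      if b: "distinct (map decode_set b)" "b \<noteq> []" for b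
    proof -
      have "distinct b" using b(1) by (simp add: distinct_map)
      let ?B = "map decode_set b"
      have "(\<lambda>s. map decode_set (elems s)) ` set (rotations b) = map decode_set ` elems ` set (rotations b)"
        by (simp add: image_image)
      also have "\<dots> = range (\<lambda>n. rotate n ?B @ [hd (rotate n ?B)])"
        unfolding set_rotations[OF \<open>distinct b\<close> b(2)] image_image
        using b(2) by (simp add: rotate_map hd_map)
      also have "\<dots> = {s. closed_list s \<and> (\<exists>n. butlast s = rotate n ?B)}"
      proof (intro equalityI subsetI)
        fix s assume "s \<in> {s. closed_list s \<and> (\<exists>n. butlast s = rotate n ?B)}"
        then obtain d n where "s = d @ [hd d]" "butlast s = rotate n ?B" by (auto simp: closed_list_iff)
        then show "s \<in> range (\<lambda>n. rotate n ?B @ [hd (rotate n ?B)])" by auto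
      qed (use b(2) in \<open>auto simp: closed_list_iff\<close>)
      finally show ?thesis .
    qed
    have "butlast l \<noteq> []" using l2 by (cases l; cases "tl l") auto
    moreover have "butlast (rev l) = rev (tl l)" "tl l \<noteq> []"
      using l2 by (cases l; cases "tl l"; auto simp: butlast_append)+
    moreover have "map decode_set (butlast l) = butlast T" by (simp add: T_def map_butlast)
    moreover have "map decode_set (rev (tl l)) = rev (tl T)"
      by (simp add: T_def map_tl flip: rev_map)
    moreover have "butlast (rev T) = rev (tl T)" by (rule butlast_rev)
    ultimately show ?thesis
      using True dist rot[of "butlast l"] rot[of "rev (tl l)"]
      by (auto simp: v image_Un same_trail_closed_iff)
  qed
  then show ?thesis by (simp add: T_def l_def)
qed

text \<open>Here \<open>hs\<close> lists the codes of the hints, and hubs are indexed by codes;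
  \<open>inj_hint\<close> makes this one hub per hint.\<close>

locale encoded_advice =
  fixes V :: "tree set" and A :: "(tree \<times> tree) multiset" and w :: "tree \<times> tree \<Rightarrow> ereal"
    and m :: real and vs :: "tree list" and as :: "(tree \<times> tree) list"
    and tab :: "((tree \<times> tree) \<times> tree) list" and hs :: "tree list"
  assumes set_vs: "set vs = V" and distinct_vs: "distinct vs" and mset_as: "mset as = A"
    and arcs_A: "arcs_on V A"
    and tab: "set (map fst tab) = V \<times> V" "\<And>a t. (a, t) \<in> set tab \<Longrightarrow> encodes_weight t (w a)"
    and m_nonneg: "0 \<le> m" and w_range: "\<And>a. a \<in> V \<times> V \<Longrightarrow> w a \<in> {0..ereal m} \<union> {\<infinity>}"
    and advice: "advice_on V A (decode_hint ` set hs)" and inj_hint: "inj_on decode_hint (set hs)"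
    and distinct_hs: "distinct hs"
begin

definition es :: "tree list" where "es = map (\<lambda>(u, v). Node u v) as"

definition W :: "tree list" where "W = map (\<lambda>((u, v), t). Node (Node u v) t) tab"

definition all_chains :: "tree set" where "all_chains = (\<Union>h\<in>set hs. set (chains vs es h))"

definition lay :: "tree \<Rightarrow> tree set list" where "lay c = map decode_set (elems (chain_layers c))"

definition cp :: "tree \<Rightarrow> nat \<Rightarrow> tree \<Rightarrow> tree" where
  "cp c i x = Node (Node c (tree_of_list (drop i (elems (chain_layers c))))) x"

text \<open>Read off from the output of the reduction, so that table and weight function belong
  together by construction. It remains to show that every entry is a code and that the values on
  \<open>links\<close> are the intended ones.\<close>

definition w' :: "tree \<times> tree \<Rightarrow> ereal" where
  "w' = (\<lambda>(a, b). decode_weight (weight_tree W a b))"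

lemma more_in_iff: "more_in es v \<longleftrightarrow> 0 < net A v"
  and more_out_iff: "more_out es v \<longleftrightarrow> net A v < 0"
proof -
  have "length (filter (\<lambda>e. left e = v) es) = size {#a \<in># A. fst a = v#}"
    "length (filter (\<lambda>e. right e = v) es) = size {#a \<in># A. snd a = v#}"
    unfolding es_def filter_map mset_as[symmetric]
    by (simp_all add: comp_def case_prod_beta flip: mset_filter)
  then show "more_in es v \<longleftrightarrow> 0 < net A v" "more_out es v \<longleftrightarrow> net A v < 0"
    by (simp_all add: more_in_def more_out_def net_eq_size)
qed

lemma hint_walk:
  assumes "h \<in> set hs"
  shows "component_walk V A (map decode_set (elems (right h)))"
proof -
  have "hint_on V A (decode_hint h)" using advice assms by (auto simp: advice_on_def)
  from hint_on_component_walk[OF this] show ?thesis by (simp add: decode_hint_def split: if_splits)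
qed

lemma variant_walk:
  assumes "h \<in> set hs" "s \<in> set (variants (right h))"
  shows "same_trail (map decode_set (elems (right h))) (map decode_set (elems s))"
    and "elems s \<noteq> []"
proof -
  show *: "same_trail (map decode_set (elems (right h))) (map decode_set (elems s))"
    using set_variants[OF arcs_A hint_walk[OF assms(1)]] assms(2) by blast
  then show "elems s \<noteq> []"
    using same_trail_component_walk(1)[OF hint_walk[OF assms(1)] *] by (auto simp: component_walk_def)
qed

lemma variant_exists:
  assumes "h \<in> set hs" "same_trail (map decode_set (elems (right h))) r"
  obtains s where "s \<in> set (variants (right h))" "map decode_set (elems s) = r"
proof -
  have "r \<in> (\<lambda>s. map decode_set (elems s)) ` set (variants (right h))"
    unfolding set_variants[OF arcs_A hint_walk[OF assms(1)]] using assms(2) by simp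
  then show thesis by (elim imageE) (rule that, simp_all)
qed

lemma chain_ok:
  assumes "h \<in> set hs" "c \<in> set (chains vs es h)"
  shows "chain_owner c = h" "c \<noteq> Leaf"
    "fits V A (decode_hint h) (lay c) (chain_src c) (chain_tgt c)"
proof -
  have "chain_owner c = h \<and> c \<noteq> Leaf \<and> fits V A (decode_hint h) (lay c) (chain_src c) (chain_tgt c)"
  proof (cases "left h = Leaf")
    case True
    then obtain s v u where "s \<in> set (variants (right h))" "more_in es v" "more_out es u"
        "c = Node h (Node s (Node v u))"
      using assms(2) by (auto simp: chains_def)
    then show ?thesis
      using variant_walk(1)[OF assms(1)] True
      by (simp add: decode_hint_def lay_def more_in_iff more_out_iff)
  next
    case False
    then obtain s v where s: "s \<in> set (variants (right h))" "v \<in> set (elems (left s))"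
        "c = Node h (Node (Node (Node v Leaf) (right s)) (Node v v))"
      using assms(2) by (auto simp: chains_def)
    obtain K s' where K: "s = Node K s'" using variant_walk(2)[OF assms(1) s(1)] by (cases s) auto
    have "same_trail (map decode_set (elems (right h))) (decode_set K # map decode_set (elems s'))"
      using variant_walk(1)[OF assms(1) s(1)] K by simp
    moreover have "v \<in> decode_set K" using s(2) K by (simp add: decode_set_def)
    moreover have "lay c = {v} # map decode_set (elems s')" using s(3) K by (simp add: lay_def decode_set_def)
    ultimately show ?thesis
      using False s(3) by (auto simp: decode_hint_def intro!: exI[of _ "decode_set K # map decode_set (elems s')"])
  qed
  then show "chain_owner c = h" "c \<noteq> Leaf"
    "fits V A (decode_hint h) (lay c) (chain_src c) (chain_tgt c)" by auto
qed

text \<open>Completeness of the enumeration: when an extension of the old graph is lifted, the chain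
  for its own realization has to exist.\<close>

lemma chain_found:
  assumes "h \<in> set hs" "fits V A (decode_hint h) ls x y" "x \<in> V" "y \<in> V"
  shows "\<exists>c\<in>set (chains vs es h). lay c = ls \<and> chain_src c = x \<and> chain_tgt c = y"
proof (cases "left h = Leaf")
  case True
  then have f: "same_trail (map decode_set (elems (right h))) ls" "0 < net A x" "net A y < 0"
    using assms(2) by (simp_all add: decode_hint_def)
  then obtain s where s: "s \<in> set (variants (right h))" "map decode_set (elems s) = ls"
    using variant_exists[OF assms(1)] by blast
  have "Node h (Node s (Node x y)) \<in> set (chains vs es h)"
    using True s(1) f assms(3,4) by (auto simp: chains_def more_in_iff more_out_iff set_vs)
  then show ?thesis using s(2) by (intro bexI[of _ "Node h (Node s (Node x y))"]) (simp_all add: lay_def)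
next
  case False
  then obtain r where r: "same_trail (map decode_set (elems (right h))) r" "x \<in> hd r" "ls = {x} # tl r" "y = x"
    using assms(2) by (auto simp: decode_hint_def)
  then obtain s where s: "s \<in> set (variants (right h))" "map decode_set (elems s) = r"
    using variant_exists[OF assms(1)] by blast
  obtain K s' where K: "s = Node K s'" using variant_walk(2)[OF assms(1) s(1)] by (cases s) auto
  let ?c = "Node h (Node (Node (Node x Leaf) s') (Node x x))"
  have "x \<in> set (elems K)" using r(2) s(2) K by (auto simp: decode_set_def)
  then have "?c \<in> set (chains vs es h)"
    using False s(1) K by (force simp: chains_def)
  then show ?thesis using r s(2) K by (intro bexI[of _ ?c]) (auto simp: lay_def decode_set_def)
qed

section \<open>The gadget locales for encoded instances\<close>

sublocale G: hint_gadgets V A w "set hs" decode_hint all_chains left lay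
  "\<lambda>c. chain_src c" "\<lambda>c. chain_tgt c" "\<lambda>v. orig v" "\<lambda>h. hub h" cp right w'
proof
  show "finite V" using set_vs by auto
  show "finite all_chains" by (simp add: all_chains_def)
  show "0 \<le> w a" if "a \<in> V \<times> V" for a using w_range[OF that] by auto
  show "left c \<in> set hs \<and> fits V A (decode_hint (left c)) (lay c) (chain_src c) (chain_tgt c)"
    if "c \<in> all_chains" for c
    using that chain_ok(1,3) by (auto simp: all_chains_def)
  show "\<exists>c\<in>all_chains. left c = k \<and> lay c = ls \<and> chain_src c = x \<and> chain_tgt c = y"
    if "k \<in> set hs" "fits V A (decode_hint k) ls x y" "x \<in> V" "y \<in> V" for k ls x y
    using chain_found[OF that] chain_ok(1) that(1) by (fastforce simp: all_chains_def)
  show "c = d \<and> i = j" if "i < length (lay c)" "j < length (lay d)" "cp c i x = cp d j y" for c d i j x y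
  proof -
    let ?l = "elems (chain_layers c)"
    have "c = d" "drop i ?l = drop j ?l" using that(3) by (auto simp: cp_def)
    then have "length ?l - i = length ?l - j" by (metis length_drop)
    then show ?thesis using that(1,2) \<open>c = d\<close> by (simp add: lay_def)
  qed
  show "cp c i x \<noteq> hub k" if "c \<in> all_chains" for c i x k
    using that chain_ok(2) by (auto simp: cp_def all_chains_def)
qed (use arcs_A advice inj_hint in \<open>auto simp: cp_def inj_on_def\<close>)

lemma chain_not_Leaf: "c \<in> all_chains \<Longrightarrow> c \<noteq> Leaf"
  using chain_ok(2) by (auto simp: all_chains_def)

text \<open>A nonempty suffix is identified by its length; beyond the end all suffixes
  coincide.\<close>

lemma drop_eq_iff: "i < length l \<Longrightarrow> drop j l = drop i l \<longleftrightarrow> j = i"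
  by (metis diff_diff_cancel length_drop less_imp_le_nat zero_less_diff nat_le_linear diff_is_0_eq' less_not_refl)

lemma lookup_encodes:
  assumes "x \<in> V" "y \<in> V"
  shows "encodes_weight (lookup W (Node x y)) (w (x, y))"
proof -
  let ?f = "filter (\<lambda>p. left p = Node x y) W"
  have "(x, y) \<in> fst ` set tab" using tab(1) assms by simp
  then obtain t where "((x, y), t) \<in> set tab" by force
  then have "Node (Node x y) t \<in> set ?f" by (force simp: W_def)
  then have "?f \<noteq> []" by (metis empty_iff list.set(1))
  then have "hd ?f \<in> set ?f" by (rule hd_in_set)
  then obtain s where s: "((x, y), s) \<in> set tab" "hd ?f = Node (Node x y) s" by (auto simp: W_def)
  have "lookup W (Node x y) = s"
    using s(2) \<open>?f \<noteq> []\<close> by (simp add: lookup_def left_tree_of_list)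
  then show ?thesis using tab(2)[OF s(1)] by simp
qed

lemma decode_Leaf: "decode_weight Leaf = \<infinity>" and decode_zero: "decode_weight zero_tree = 0"
  using decode_weight_eq encodes_weight_Leaf encodes_weight_zero by blast+

lemma decode_lookup: "x \<in> V \<Longrightarrow> y \<in> V \<Longrightarrow> decode_weight (lookup W (Node x y)) = w (x, y)"
  using decode_weight_eq lookup_encodes by blast

lemma right_drop: "right (tree_of_list (drop i l)) = tree_of_list (drop (Suc i) l)"
  by (metis drop_Suc elems_right elems_tree_of_list tl_drop tree_of_list_elems)

lemma cell_index: "(c, i, x) \<in> G.cells \<Longrightarrow> c \<in> all_chains \<and> i < length (elems (chain_layers c))"
  using G.cells_D by (auto simp: lay_def)

lemma weight_tree_orig: "weight_tree W (orig x) (orig y) = lookup W (Node x y)"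
  by (simp add: weight_tree_def)

lemma weight_tree_entry:
  assumes "(c, i, y) \<in> G.cells"
  shows "weight_tree W (orig x) (cp c i y) = (if i = 0 \<and> x = y \<and> y = chain_src c then zero_tree else Leaf)"
proof -
  let ?l = "elems (chain_layers c)"
  have c: "c \<noteq> Leaf" "i < length ?l" using cell_index[OF assms] chain_not_Leaf by auto
  have "tree_of_list (drop i ?l) = chain_layers c \<longleftrightarrow> drop i ?l = drop 0 ?l"
    by (metis drop_0 tree_of_list_elems tree_of_list_eq_iff)
  also have "\<dots> \<longleftrightarrow> i = 0" using c(2) by (intro drop_eq_iff) linarith
  finally show ?thesis using c by (simp add: weight_tree_def cp_def)
qed

lemma weight_tree_exit:
  assumes "(c, i, x) \<in> G.cells"
  shows "weight_tree W (cp c i x) (orig y) =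
    (if Suc i = length (lay c) \<and> x = y \<and> x = chain_tgt c then zero_tree else Leaf)"
proof -
  let ?l = "elems (chain_layers c)"
  have c: "c \<noteq> Leaf" "i < length ?l" using cell_index[OF assms] chain_not_Leaf by auto
  have "right (tree_of_list (drop i ?l)) = Leaf \<longleftrightarrow> drop (Suc i) ?l = []"
    unfolding right_drop by (cases "drop (Suc i) ?l") simp_all
  also have "\<dots> \<longleftrightarrow> Suc i = length (lay c)" using c(2) by (auto simp: lay_def)
  finally show ?thesis using c by (simp add: weight_tree_def cp_def)
qed

lemma weight_tree_copies:
  assumes "(c, i, x) \<in> G.cells" "(d, j, y) \<in> G.cells"
  shows "weight_tree W (cp c i x) (cp d j y) =
    (if c = d \<and> (j = i \<or> j = Suc i) then lookup W (Node x y) else Leaf)"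
proof -
  let ?l = "elems (chain_layers c)"
  have c: "c \<noteq> Leaf" "d \<noteq> Leaf" "j < length (elems (chain_layers d))"
    using cell_index[OF assms(1)] cell_index[OF assms(2)] chain_not_Leaf by auto
  have "tree_of_list (drop j ?l) = tree_of_list (drop i ?l) \<longleftrightarrow> j = i"
    "tree_of_list (drop j ?l) = right (tree_of_list (drop i ?l)) \<longleftrightarrow> j = Suc i" if "c = d"
    unfolding right_drop tree_of_list_eq_iff
    using drop_eq_iff[of j ?l i] drop_eq_iff[of j ?l "Suc i"] c(3) that by metis+
  then show ?thesis using c by (auto simp: weight_tree_def cp_def)
qed

lemma weight_tree_hub:
  assumes "b \<in> G.new_verts"
  shows "weight_tree W (hub h) b = Leaf" "weight_tree W b (hub h) = Leaf"
proof -
  have "weight_tree W b (hub h) = Leaf"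
    using assms
  proof (cases rule: G.new_verts_cases)
    case (copy c i x)
    then have "c \<noteq> Leaf" using cell_index chain_not_Leaf by blast
    then show ?thesis by (simp add: weight_tree_def cp_def copy(2))
  qed (simp_all add: weight_tree_def)
  then show "weight_tree W b (hub h) = Leaf" "weight_tree W (hub h) b = Leaf"
    by (simp_all add: weight_tree_def)
qed

sublocale G: weighted_hint_gadgets V A w "set hs" decode_hint all_chains left lay
  "\<lambda>c. chain_src c" "\<lambda>c. chain_tgt c" "\<lambda>v. orig v" "\<lambda>h. hub h" cp right w'
proof
  show "w' (orig x, orig y) = w (x, y)" if "x \<in> V" "y \<in> V" for x y
    using that by (simp add: w'_def weight_tree_orig decode_lookup)
  show "w' (orig (chain_src c), cp c 0 (chain_src c)) = 0" if "(c, 0, chain_src c) \<in> G.cells" for c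
    using weight_tree_entry[OF that] by (simp add: w'_def decode_zero)
  show "w' (cp c i (chain_tgt c), orig (chain_tgt c)) = 0"
    if "(c, i, chain_tgt c) \<in> G.cells" "Suc i = length (lay c)" for c i
    using weight_tree_exit[OF that(1)] that(2) by (simp add: w'_def decode_zero)
  show "w' (z, z') = w (right z, right z')" if z: "(z, z') \<in> G.inner c" for c z z'
  proof -
    obtain i x j y where *: "z = cp c i x" "z' = cp c j y" "(c, i, x) \<in> G.cells" "(c, j, y) \<in> G.cells"
        "j = i \<or> j = Suc i"
      using z by (auto simp: G.inner_def)
    then show ?thesis
      using weight_tree_copies[OF *(3,4)] decode_lookup[OF G.cells_V[OF *(3)] G.cells_V[OF *(4)]]
      by (simp add: w'_def)
  qed
  show "w' e = \<infinity>" if e: "e \<in> G.new_verts \<times> G.new_verts" "e \<notin> G.links" for e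
  proof -
    obtain a b where ab: "e = (a, b)" "a \<in> G.new_verts" "b \<in> G.new_verts" using e(1) by auto
    have "weight_tree W a b = Leaf"
      using ab(2)
    proof (cases rule: G.new_verts_cases)
      case a: (orig x)
      show ?thesis
        using ab(3)
      proof (cases rule: G.new_verts_cases)
        case (orig y)
        then show ?thesis using e(2) ab(1) a G.links.original by simp
      next
        case (copy c i y)
        then show ?thesis
          using e(2) ab(1) a weight_tree_entry[OF copy(1), of x] G.links.entry[of c] by auto
      qed (use weight_tree_hub ab in simp)
    next
      case a: (copy c i x)
      show ?thesis
        using ab(3)
      proof (cases rule: G.new_verts_cases)
        case (orig y)
        then show ?thesis
          using e(2) ab(1) a weight_tree_exit[OF a(1), of y] G.links.exit[of c i] by auto
      next
        case (copy d j y)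
        have "c = d \<and> (j = i \<or> j = Suc i) \<Longrightarrow> e \<in> G.links"
          using G.links.inner[of c] cell_index[OF a(1)] a copy ab(1) unfolding G.inner_def by blast
        then show ?thesis using e(2) a copy weight_tree_copies[OF a(1) copy(1)] by auto
      qed (use weight_tree_hub ab in simp)
    qed (use weight_tree_hub ab in simp)
    then show ?thesis by (simp add: w'_def ab(1) decode_Leaf)
  qed
qed

text \<open>The new table consists of codes of infinity and zero and of entries of the old one; so
  it is well formed and its weights stay in the range given by \<open>m\<close>.\<close>

lemma weight_tree_values:
  assumes "a \<in> G.new_verts" "b \<in> G.new_verts"
  shows "weight_tree W a b \<in> {Leaf, zero_tree} \<union> (\<lambda>(x, y). lookup W (Node x y)) ` (V \<times> V)"
  using assms(1)
proof (cases rule: G.new_verts_cases)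
  case a: (orig x)
  show ?thesis
    using assms(2)
    by (cases rule: G.new_verts_cases)
      (use a weight_tree_hub assms weight_tree_entry in \<open>auto simp: weight_tree_orig\<close>)
next
  case a: (copy c i x)
  show ?thesis
    using assms(2)
  proof (cases rule: G.new_verts_cases)
    case (copy d j y)
    then show ?thesis using weight_tree_copies[OF a(1) copy(1)] a G.cells_V by auto
  qed (use a weight_tree_hub assms weight_tree_exit in auto)
qed (use weight_tree_hub assms in simp)

lemma weight_encodes:
  assumes "a \<in> G.new_verts" "b \<in> G.new_verts"
  shows "encodes_weight (weight_tree W a b) (w' (a, b))" "w' (a, b) \<in> {0..ereal m} \<union> {\<infinity>}"
proof -
  have "\<exists>r. encodes_weight (weight_tree W a b) r \<and> r \<in> {0..ereal m} \<union> {\<infinity>}"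
    using weight_tree_values[OF assms] lookup_encodes w_range encodes_weight_Leaf encodes_weight_zero m_nonneg
    by fastforce
  then obtain r where "encodes_weight (weight_tree W a b) r" "r \<in> {0..ereal m} \<union> {\<infinity>}" by blast
  then show "encodes_weight (weight_tree W a b) (w' (a, b))" "w' (a, b) \<in> {0..ereal m} \<union> {\<infinity>}"
    by (simp_all add: w'_def decode_weight_eq)
qed

lemma set_copy_list: "set (copy_list vs es hs) = G.copies"
proof -
  have "set (copy_list vs es hs) = (\<Union>c\<in>all_chains. \<Union>r\<in>set (tails (elems (chain_layers c))).
      (\<lambda>x. Node (Node c r) x) ` set (elems (left r)))"
    by (simp add: copy_list_def all_chains_def)
  also have "\<dots> = (\<Union>c\<in>all_chains. \<Union>i<length (lay c). cp c i ` (lay c ! i))"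
  proof (rule SUP_cong[OF refl])
    fix c
    let ?l = "elems (chain_layers c)"
    have "(\<Union>r\<in>set (tails ?l). (\<lambda>x. Node (Node c r) x) ` set (elems (left r))) =
        (\<Union>i<length ?l. (\<lambda>x. Node (Node c (tree_of_list (drop i ?l))) x) `
          set (elems (left (tree_of_list (drop i ?l)))))"
      by (simp add: tails_eq atLeast0LessThan)
    also have "\<dots> = (\<Union>i<length (lay c). cp c i ` (lay c ! i))"
      by (rule SUP_cong) (simp_all add: lay_def cp_def left_drop decode_set_def)
    finally show "(\<Union>r\<in>set (tails ?l). (\<lambda>x. Node (Node c r) x) ` set (elems (left r))) =
        (\<Union>i<length (lay c). cp c i ` (lay c ! i))" .
  qed
  also have "\<dots> = G.copies"
    unfolding G.copies_def G.cells_def by (force simp: image_iff)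
  finally show ?thesis .
qed

lemma set_vertex_list: "set (vertex_list vs es hs) = G.new_verts"
  by (simp add: vertex_list_def G.new_verts_def set_copy_list set_vs Un_assoc)

lemma distinct_vertex_list: "distinct (vertex_list vs es hs)"
proof -
  have "G.copies \<inter> range (\<lambda>v. orig v) = {}" "G.copies \<inter> range (\<lambda>h. hub h) = {}"
    using cell_index chain_not_Leaf by (fastforce simp: G.copies_def cp_def)+
  then show ?thesis
    using distinct_vs distinct_hs set_copy_list
    by (auto simp: vertex_list_def distinct_map inj_on_def copy_list_def[of vs es hs])
qed

lemma anchor_of_cp:
  assumes "(c, i, x) \<in> G.cells"
  shows "anchor_of (cp c i x) = G.anchor (c, i, x)"
proof -
  let ?l = "elems (chain_layers c)"
  have "tree_of_list (drop i ?l) = chain_layers c \<longleftrightarrow> drop i ?l = drop 0 ?l"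
    by (metis drop_0 tree_of_list_elems tree_of_list_eq_iff)
  also have "\<dots> \<longleftrightarrow> i = 0" using cell_index[OF assms] by (intro drop_eq_iff) linarith
  finally show ?thesis by (simp add: anchor_of_def cp_def)
qed

text \<open>The list of copies is distinct, so concatenating along it gives the sum over
  \<open>cells\<close> that defines \<open>ties\<close>.\<close>

lemma encodes_arc_list: "encodes_arcs (tree_of_list (arc_list vs es hs)) G.new_arcs"
proof -
  let ?Z = "copy_list vs es hs"
  let ?ties = "concat (map (\<lambda>z. [(z, anchor_of z), (anchor_of z, z)]) ?Z)"
  let ?as = "map (\<lambda>(u, v). (orig u, orig v)) as @ ?ties"
  have "arc_list vs es hs = map (\<lambda>(u, v). Node u v) ?as"
    by (simp add: arc_list_def es_def case_prod_beta map_concat comp_def)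
  moreover have "mset ?as = G.new_arcs"
  proof -
    have dist: "distinct ?Z" by (simp add: copy_list_def)
    have "mset (concat (map f l)) = (\<Sum>z\<in>set l. mset (f z))" if "distinct l"
      for f :: "tree \<Rightarrow> (tree \<times> tree) list" and l
      using that by (induction l) auto
    from this[OF dist] have "mset ?ties = (\<Sum>z\<in>G.copies. {#(z, anchor_of z), (anchor_of z, z)#})"
      by (simp add: set_copy_list)
    also have "\<dots> = (\<Sum>(c, i, x)\<in>G.cells. {#(cp c i x, anchor_of (cp c i x)), (anchor_of (cp c i x), cp c i x)#})"
      unfolding G.copies_def
      by (subst sum.reindex) (auto simp: inj_on_def G.copy_eq_iff case_prod_beta intro!: sum.cong)
    also have "\<dots> = G.ties"
      unfolding G.ties_def by (intro sum.cong) (auto simp: anchor_of_cp simp del: G.anchor.simps)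
    finally show ?thesis
      by (simp add: G.new_arcs_def map_prod_def mset_as)
  qed
  ultimately show ?thesis
    unfolding encodes_arcs_def by (intro exI[of _ ?as] conjI) (simp_all only:)
qed

lemma encodes_weight_list:
  "encodes_weights (tree_of_list (weight_list W (vertex_list vs es hs))) G.new_verts w'"
proof -
  let ?vs = "vertex_list vs es hs"
  let ?tab = "map (\<lambda>(a, b). ((a, b), weight_tree W a b)) (List.product ?vs ?vs)"
  have "weight_list W ?vs = map (\<lambda>((u, v), t). Node (Node u v) t) ?tab"
    by (simp add: weight_list_def product_concat_map map_concat comp_def case_prod_beta)
  moreover have "map fst ?tab = List.product ?vs ?vs" by (simp add: comp_def case_prod_beta)
  moreover have "\<forall>(e, t) \<in> set ?tab. encodes_weight t (w' e)"
    using weight_encodes(1) by (auto simp: set_vertex_list)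
  ultimately show ?thesis
    unfolding encodes_weights_def
    using distinct_vertex_list by (intro exI[of _ ?tab]) (simp add: distinct_product set_vertex_list)
qed

section \<open>The new instance and its correctness\<close>

definition new_instance :: "tree ee_instance" where
  "new_instance = \<lparr>vertices = G.new_verts, arc_mset = G.new_arcs, max_weight = m, weight = w'\<rparr>"

lemma new_instance_ok: "ee_instance_ok new_instance"
  using weight_encodes(2) m_nonneg G.finite_new_verts G.arcs_on_new
  by (auto simp: ee_instance_ok_def new_instance_def)

lemma encodes_new_instance:
  assumes "encodes_real xm m"
  shows "encodes_ee (tree_of_list [tree_of_list (vertex_list vs es hs), tree_of_list (arc_list vs es hs),
    xm, tree_of_list (weight_list W (vertex_list vs es hs))]) new_instance"
  unfolding encodes_ee_def new_instance_def
  using assms encodes_arc_list encodes_weight_list distinct_vertex_list set_vertex_list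
  by (auto simp: encodes_set_def)

lemma component_number_new_instance:
  "component_number new_instance \<le> card (components V A) + card (components V A) * card (components V A)"
  using G.card_components_new G.card_hints by (simp add: new_instance_def component_number_def)

lemma ee_yes_new_instance:
  "ee_yes new_instance \<longleftrightarrow> (\<exists>E. eulerian_extension V A E \<and> total_weight w E \<le> ereal m \<and>
     heeds V A E (decode_hint ` set hs))"
proof
  assume "ee_yes new_instance"
  then obtain E' where E': "eulerian_extension G.new_verts G.new_arcs E'" "total_weight w' E' \<le> ereal m"
    by (auto simp: ee_yes_def new_instance_def)
  \<comment> \<open>The bound \<open>m\<close> is a real number, so the total weight is finite and
    all arcs of \<open>E'\<close> are in \<open>links\<close>.\<close>
  then have "total_weight w' E' < \<infinity>" by (rule_tac le_less_trans) auto
  from G.extension_if_extension_of_new[OF E'(1) this] E'(2)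
  show "\<exists>E. eulerian_extension V A E \<and> total_weight w E \<le> ereal m \<and> heeds V A E (decode_hint ` set hs)"
    by (meson order_trans)
next
  assume "\<exists>E. eulerian_extension V A E \<and> total_weight w E \<le> ereal m \<and> heeds V A E (decode_hint ` set hs)"
  then show "ee_yes new_instance"
    using G.extension_of_new_if_extension by (fastforce simp: ee_yes_def new_instance_def)
qed

end

lemma reduction_correct:
  assumes I: "eea_instance_ok I" and x: "encodes_eea x I"
  shows "\<exists>J. ee_instance_ok J \<and> encodes_ee (reduction x) J \<and> (eea_yes I \<longleftrightarrow> ee_yes J) \<and>
    component_number J \<le> component_number I + component_number I * component_number I"
proof -
  obtain xg xp where xg: "x = Node xg xp" "encodes_ee xg I" "encodes_advice xp (advice I)"
    using x by (auto simp: encodes_eea_def)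
  obtain xv xa xm xw where xs: "xg = tree_of_list [xv, xa, xm, xw]" "encodes_set xv (vertices I)"
      "encodes_arcs xa (arc_mset I)" "encodes_real xm (max_weight I)"
      "encodes_weights xw (vertices I) (weight I)"
    using xg(2) by (auto simp: encodes_ee_def)
  obtain vs where vs: "xv = tree_of_list vs" "distinct vs" "set vs = vertices I"
    using xs(2) by (auto simp: encodes_set_def)
  obtain as where as: "xa = tree_of_list (map (\<lambda>(u, v). Node u v) as)" "mset as = arc_mset I"
    using xs(3) by (auto simp: encodes_arcs_def)
  obtain tab where xw: "xw = tree_of_list (map (\<lambda>((u, v), t). Node (Node u v) t) tab)"
      and tab: "set (map fst tab) = vertices I \<times> vertices I"
      "\<forall>(a, t) \<in> set tab. encodes_weight t (weight I a)"
    using xs(5) by (auto simp: encodes_weights_def)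
  obtain ts hs where ts: "xp = tree_of_list ts" "list_all2 encodes_hint ts hs" "distinct hs"
      "set hs = advice I"
    using xg(3) by (auto simp: encodes_advice_def)
  have hs: "map decode_hint ts = hs"
    using ts(2) by (induction rule: list_all2_induct) (auto simp: decode_hint_eq)
  then have "distinct (map decode_hint ts)" using ts(3) by simp
  \<comment> \<open>Distinctness of the decoded hints gives both distinct codes and injective
    decoding.\<close>
  then have inj: "distinct ts" "inj_on decode_hint (set ts)" by (simp_all add: distinct_map)
  have hints: "decode_hint ` set ts = advice I" using arg_cong[OF hs, of set] ts(4) by simp
  interpret encoded_advice "vertices I" "arc_mset I" "weight I" "max_weight I" vs as tab ts
    using I vs as tab inj hints by unfold_locales (auto simp: eea_instance_ok_def ee_instance_ok_def)
  have "reduction x = tree_of_list [tree_of_list (vertex_list vs es ts), tree_of_list (arc_list vs es ts),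
      xm, tree_of_list (weight_list W (vertex_list vs es ts))]"
    by (simp add: reduction_def Let_def xg(1) xs(1) vs(1) as(1) xw ts(1) es_def W_def)
  then have "encodes_ee (reduction x) new_instance" using encodes_new_instance[OF xs(4)] by simp
  moreover have "eea_yes I \<longleftrightarrow> ee_yes new_instance"
    unfolding ee_yes_new_instance eea_yes_def hints ..
  ultimately show ?thesis
    using new_instance_ok component_number_new_instance by (auto simp: component_number_def)
qed

theorem mainTheorem6:
  shows "poly_time_poly_parameter_reducible EEA EE"
proof -
  obtain c time where c: "runs_in 0 c reduction (poly time)"
    by (rule poly_time_program[OF poly_time_reduction])
  \<comment> \<open>With \<open>k\<close> old components there are at most \<open>k * k\<close>
    hints, each adding at most one component; this is the polynomial
    \<open>[:0, 1, 1:]\<close>.\<close>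
  have "\<exists>J y n. computes_in_time c x y n \<and> n \<le> poly time (size x) \<and> is_instance EE J \<and>
      encodes EE y J \<and> (is_yes EEA I \<longleftrightarrow> is_yes EE J) \<and>
      parameter EE J \<le> poly [:0, 1, 1:] (parameter EEA I)"
    if I: "is_instance EEA I \<and> encodes EEA x I" for I x
  proof -
    obtain n s' where "exec c ((\<lambda>_. Leaf)(0 := x)) n s'" "s' 0 = reduction x" "n \<le> poly time (size x)"
      using runs_inD[OF c, of "(\<lambda>_. Leaf)(0 := x)"] by auto
    then have "computes_in_time c x (reduction x) n" "n \<le> poly time (size x)"
      unfolding computes_in_time_def by blast+
    moreover obtain J where "ee_instance_ok J" "encodes_ee (reduction x) J" "eea_yes I \<longleftrightarrow> ee_yes J"
        "component_number J \<le> component_number I + component_number I * component_number I"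
      using reduction_correct I by (auto simp: EEA_def)
    ultimately show ?thesis
      by (intro exI[of _ J] exI[of _ "reduction x"] exI[of _ n])
        (simp add: EE_def EEA_def algebra_simps)
  qed
  then show ?thesis unfolding poly_time_poly_parameter_reducible_def by blast
qed

end
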